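(* Let $k$ be an algebraically closed field of characteristic $0$ and let $X\subset\mathbf{P}^n_k$ be an integral non-linear hypersurface which either has dimension at least four, or has dimension three and degree at least three. Suppose that for every hyperplane $\Pi\subset\mathbf{P}^n$, the scheme-theoretic hyperplane section $\Pi\cap X$ is covered by its linear divisors. Then $X$ is covered by its linear divisors.
   Context: Let $Z\subset\mathbf{P}^n_k$ ($k$ algebraically closed) be a closed equidimensional subscheme of dimension $s\ge1$. $Z$ is said to be covered by its linear divisors if every closed point of $Z$ lies on some linear subspace of $\mathbf{P}^n$ of dimension $s-1$ which is contained in $Z$ (as a closed subscheme); equivalently, the projection to $Z$ of the universal family over the Hilbert scheme $F_{s-1}(Z)$ of $(s-1)$-planes contained in $Z$ is surjective. Hyperplane sections are scheme-theoretic intersections (possibly reducible or non-reduced). *)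

theory Defs
  imports "HOL-Library.Poly_Mapping" "HOL-Computational_Algebra.Polynomial"
    "HOL-Computational_Algebra.Factorial_Ring"
begin

text \<open>Multivariate polynomials over 'k in the variables x_0, x_1, ...:
  finitely supported maps from monomials (exponent vectors) to coefficients.
  The ring structure is the convolution product of HOL-Library.Poly_Mapping.\<close>
type_synonym 'k mpoly = "(nat \<Rightarrow>\<^sub>0 nat) \<Rightarrow>\<^sub>0 'k"

definition alg_closed_field :: "'k::field itself \<Rightarrow> bool" where
  "alg_closed_field _ \<longleftrightarrow> (\<forall>p::'k poly. degree p \<ge> 1 \<longrightarrow> (\<exists>x. poly p x = 0))"

definition mon_deg :: "(nat \<Rightarrow>\<^sub>0 nat) \<Rightarrow> nat" where
  "mon_deg m = (\<Sum>i\<in>Poly_Mapping.keys m. Poly_Mapping.lookup m i)"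

definition meval :: "'k::comm_ring_1 mpoly \<Rightarrow> (nat \<Rightarrow> 'k) \<Rightarrow> 'k" where
  "meval F x = (\<Sum>m\<in>Poly_Mapping.keys F. Poly_Mapping.lookup F m * (\<Prod>i\<in>Poly_Mapping.keys m. x i ^ Poly_Mapping.lookup m i))"

definition homog_form :: "nat \<Rightarrow> nat \<Rightarrow> 'k::comm_ring_1 mpoly \<Rightarrow> bool" where
  "homog_form n d F \<longleftrightarrow> F \<noteq> 0 \<and>
     (\<forall>m\<in>Poly_Mapping.keys F. mon_deg m = d \<and> Poly_Mapping.keys m \<subseteq> {0..n})"

text \<open>Vectors of k^{n+1} (coordinates 0..n); the points of P^n are the nonzero ones up to scalars.\<close>
definition vec_in :: "nat \<Rightarrow> (nat \<Rightarrow> 'k::zero) \<Rightarrow> bool" where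
  "vec_in n v \<longleftrightarrow> (\<forall>i>n. v i = 0)"

definition proj_point :: "nat \<Rightarrow> (nat \<Rightarrow> 'k::zero) \<Rightarrow> bool" where
  "proj_point n v \<longleftrightarrow> vec_in n v \<and> v \<noteq> (\<lambda>_. 0)"

definition lincomb :: "nat \<Rightarrow> (nat \<Rightarrow> 'k::comm_ring_1) \<Rightarrow> (nat \<Rightarrow> nat \<Rightarrow> 'k) \<Rightarrow> nat \<Rightarrow> 'k" where
  "lincomb r c v = (\<lambda>i. \<Sum>j\<le>r. c j * v j i)"

text \<open>v_0..v_r are linearly independent vectors in k^{n+1}; their span is
  (the cone over) a linear subspace of P^n of dimension r.\<close>
definition lin_frame :: "nat \<Rightarrow> nat \<Rightarrow> (nat \<Rightarrow> nat \<Rightarrow> 'k::comm_ring_1) \<Rightarrow> bool" where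
  "lin_frame n r v \<longleftrightarrow> (\<forall>j\<le>r. vec_in n (v j)) \<and>
     (\<forall>c. lincomb r c v = (\<lambda>_. 0) \<longrightarrow> (\<forall>j\<le>r. c j = 0))"

definition in_span :: "nat \<Rightarrow> (nat \<Rightarrow> nat \<Rightarrow> 'k::comm_ring_1) \<Rightarrow> (nat \<Rightarrow> 'k) \<Rightarrow> bool" where
  "in_span r v p \<longleftrightarrow> (\<exists>c. p = lincomb r c v)"

definition lin_form :: "nat \<Rightarrow> (nat \<Rightarrow> 'k::comm_ring_1) \<Rightarrow> (nat \<Rightarrow> 'k) \<Rightarrow> 'k" where
  "lin_form n a x = (\<Sum>i\<le>n. a i * x i)"

definition hyperplane_coeffs :: "nat \<Rightarrow> (nat \<Rightarrow> 'k::comm_ring_1) \<Rightarrow> bool" where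
  "hyperplane_coeffs n a \<longleftrightarrow> (\<exists>i\<le>n. a i \<noteq> 0)"

definition hypersurface_covered :: "nat \<Rightarrow> 'k::comm_ring_1 mpoly \<Rightarrow> bool" where
  "hypersurface_covered n F \<longleftrightarrow>
     (\<forall>p. proj_point n p \<and> meval F p = 0 \<longrightarrow>
        (\<exists>v. lin_frame n (n - 2) v \<and> in_span (n - 2) v p \<and>
             (\<forall>q. in_span (n - 2) v q \<longrightarrow> meval F q = 0)))"

text \<open>The hyperplane section V(l) \<inter> V(F) (of dimension n-2) is covered by its linear
  divisors: every point of it lies on an (n-3)-plane contained in it.\<close>
definition section_covered :: "nat \<Rightarrow> (nat \<Rightarrow> 'k::comm_ring_1) \<Rightarrow> 'k mpoly \<Rightarrow> bool" where
  "section_covered n a F \<longleftrightarrow>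
     (\<forall>p. proj_point n p \<and> lin_form n a p = 0 \<and> meval F p = 0 \<longrightarrow>
        (\<exists>v. lin_frame n (n - 3) v \<and> in_span (n - 3) v p \<and>
             (\<forall>q. in_span (n - 3) v q \<longrightarrow> lin_form n a q = 0 \<and> meval F q = 0)))"

end

theory Submission
  imports Defs "HOL-Library.Function_Algebras"
begin

text \<open>Work on the affine cone \<open>X = {F = 0}\<close>. At a smooth point \<open>p\<close> let \<open>g p\<close> be the differential,
  \<open>T p = ker (g p)\<close> the tangent hyperplane and \<open>H p\<close> the Hessian form. A linear subspace of \<open>X\<close>
  through \<open>p\<close> lies in \<open>T p\<close> and is isotropic for \<open>H p\<close>, so the hypothesis puts an isotropic
  subspace of codimension one into every hyperplane section of \<open>T p\<close> through \<open>p\<close>. At a general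
  point \<open>H p\<close> does not vanish on \<open>T p\<close>. If its rank there is at most two, it splits into two
  linear factors and the zero set of one of them is a linear divisor in \<open>X\<close>. Rank three or more is
  impossible for \<open>n \<ge> 5\<close>, since an isotropic codimension-one subspace forces rank at most two. For
  \<open>n = 4\<close> and rank three, the whole null cone of \<open>H p\<close> in \<open>T p\<close> lies in \<open>X\<close>; these quadric cones
  fit together into a single quadric containing \<open>X\<close>, which contradicts \<open>d \<ge> 3\<close>. Thus the general
  point lies on a linear divisor, and a place specializing the general point to an arbitrary one
  carries the divisors along.\<close>

section \<open>Multivariate polynomials\<close>

text \<open>Quadric threefolds have to be excluded: the hyperplane sections of a smooth quadric in
  \<open>P^4\<close> are quadric surfaces, all covered by lines, yet the quadric contains no plane.
  Seen from \<open>p\<close>: the form \<open>H p\<close> lives on \<open>T p\<close> modulo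
  \<open>p\<close>, of dimension \<open>n - 1\<close>. For \<open>n = 4\<close> a hyperplane of that
  space has dimension two, where an isotropic line always exists, so counting dimensions at one
  point excludes nothing and the degree must enter globally. It does so by comparing different
  points: a form of degree below \<open>d\<close> that vanishes on the hypersurface is zero.

  The field is any algebraically closed field of characteristic 0, so there is no topology in which
  to take limits. A place is a maximal homomorphism on functions on a dense set of points that
  extends evaluation at \<open>p\<close>. It takes over the role of properness: after shrinking the
  set, a family of nonzero vectors can be rescaled to have a nonzero limit. It also gives
  first-order information, since a displacement can be divided by its largest coordinate; limits of
  tangent planes are computed in this way. The general point itself is a filter, generated by the
  nonempty open subsets of the cone.\<close>

definition mon_eval :: "(nat \<Rightarrow>\<^sub>0 nat) \<Rightarrow> (nat \<Rightarrow> 'k::comm_ring_1) \<Rightarrow> 'k" where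
  "mon_eval m x = (\<Prod>i\<in>Poly_Mapping.keys m. x i ^ Poly_Mapping.lookup m i)"

lemma mon_eval_superset:
  assumes "finite K" "Poly_Mapping.keys m \<subseteq> K"
  shows "mon_eval m x = (\<Prod>i\<in>K. x i ^ Poly_Mapping.lookup m i)"
  unfolding mon_eval_def
  by (rule prod.mono_neutral_left) (use assms in \<open>auto simp: in_keys_iff\<close>)

lemma mon_eval_0 [simp]: "mon_eval 0 x = 1"
  by (simp add: mon_eval_def)

lemma mon_eval_add: "mon_eval (m + m') x = mon_eval m x * mon_eval m' x"
proof -
  let ?K = "Poly_Mapping.keys m \<union> Poly_Mapping.keys m'"
  have "mon_eval (m + m') x = (\<Prod>i\<in>?K. x i ^ Poly_Mapping.lookup (m + m') i)"
    by (rule mon_eval_superset) (use keys_add[of m m'] in auto)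
  also have "\<dots> = mon_eval m x * mon_eval m' x"
    by (simp add: mon_eval_superset[of ?K] lookup_add power_add prod.distrib)
  finally show ?thesis .
qed

lemma mon_eval_single: "mon_eval (Poly_Mapping.single i e) x = x i ^ e"
  by (cases "e = 0") (auto simp: mon_eval_def)

lemma meval_superset:
  assumes "finite K" "Poly_Mapping.keys F \<subseteq> K"
  shows "meval F x = (\<Sum>m\<in>K. Poly_Mapping.lookup F m * mon_eval m x)"
  unfolding meval_def mon_eval_def
  by (rule sum.mono_neutral_left) (use assms in \<open>auto simp: in_keys_iff\<close>)

lemma meval_0 [simp]: "meval 0 x = 0"
  by (simp add: meval_def)

lemma meval_single: "meval (Poly_Mapping.single m c) x = c * mon_eval m x"
  by (cases "c = 0") (auto simp: meval_def mon_eval_def)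

lemma meval_1 [simp]: "meval 1 x = 1"
  using meval_single[of 0 1 x] by simp

lemma meval_add [simp]: "meval (F + G) x = meval F x + meval G x"
proof -
  let ?K = "Poly_Mapping.keys F \<union> Poly_Mapping.keys G"
  have "meval (F + G) x = (\<Sum>m\<in>?K. Poly_Mapping.lookup (F + G) m * mon_eval m x)"
    by (rule meval_superset) (use keys_add[of F G] in auto)
  also have "\<dots> = meval F x + meval G x"
    by (simp add: meval_superset[of ?K] lookup_add ring_distribs sum.distrib)
  finally show ?thesis .
qed

lemma poly_mapping_add_induct [case_names zero single add]:
  fixes F :: "'a \<Rightarrow>\<^sub>0 'b::comm_monoid_add"
  assumes "P 0" "\<And>m c. m \<in> Poly_Mapping.keys F \<Longrightarrow> P (Poly_Mapping.single m c)"
    "\<And>G H. P G \<Longrightarrow> P H \<Longrightarrow> P (G + H)"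
  shows "P F"
  using assms(2)
proof (induction F rule: update_induct)
  case const
  then show ?case using assms(1) by simp
next
  case (update f a b)
  have eq: "Poly_Mapping.update a b f = Poly_Mapping.single a b + f"
    using update.hyps by (intro poly_mapping_eqI) (auto simp: lookup_update lookup_add lookup_single when_def in_keys_iff)
  have "P f"
    using update by (auto simp: keys_update)
  moreover have "P (Poly_Mapping.single a b)"
    using update by (auto simp: keys_update)
  ultimately show ?case
    unfolding eq by (rule assms(3)[rotated])
qed

lemma meval_mult [simp]: "meval (F * G) x = meval F x * meval G x"
proof (induction F rule: poly_mapping_add_induct)
  case (single m c)
  show ?case
    by (induction G rule: poly_mapping_add_induct)
       (simp_all add: mult_single meval_single mon_eval_add ring_distribs)
qed (simp_all add: ring_distribs)

lemma meval_uminus [simp]: "meval (- F) x = - meval F x"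
  using meval_add[of F "- F" x] by (simp add: eq_neg_iff_add_eq_0 add.commute)

lemma meval_diff [simp]: "meval (F - G) x = meval F x - meval G x"
  using meval_add[of F "- G" x] by simp

lemma meval_sum [simp]: "meval (sum f A) x = (\<Sum>i\<in>A. meval (f i) x)"
  by (induction A rule: infinite_finite_induct) auto

lemma meval_power [simp]: "meval (F ^ e) x = meval F x ^ e"
  by (induction e) auto

section \<open>The subrings of polynomials in the first \<open>m\<close> variables\<close>

definition mvar :: "nat \<Rightarrow> 'k::comm_ring_1 mpoly" where
  "mvar i = Poly_Mapping.single (Poly_Mapping.single i 1) 1"

lemma meval_mvar [simp]: "meval (mvar i) x = x i"
  by (simp add: mvar_def meval_single mon_eval_single)

lemma mvar_power: "mvar i ^ e = Poly_Mapping.single (Poly_Mapping.single i e) 1"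
  by (induction e) (simp_all add: mvar_def mult_single flip: single_add)

text \<open>All polynomial rings live in one type, and the ring in \<open>m\<close> variables is
  this subset. Inductions on the number of variables need no change of type, and divisibility is
  always that of the big ring.\<close>

definition first_vars :: "nat \<Rightarrow> 'k::comm_ring_1 mpoly set" where
  "first_vars m = {P. \<forall>t\<in>Poly_Mapping.keys P. Poly_Mapping.keys t \<subseteq> {..<m}}"

lemma first_vars_0 [simp]: "0 \<in> first_vars m"
  by (simp add: first_vars_def)

lemma first_vars_const [simp]: "Poly_Mapping.single 0 c \<in> first_vars m"
  by (cases "c = 0") (auto simp: first_vars_def)

lemma first_vars_1 [simp]: "1 \<in> first_vars m"
  using first_vars_const[of 1 m] by simp

lemma first_vars_mvar: "i < m \<Longrightarrow> mvar i \<in> first_vars m"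
  by (auto simp: first_vars_def mvar_def)

lemma first_vars_add: "P \<in> first_vars m \<Longrightarrow> Q \<in> first_vars m \<Longrightarrow> P + Q \<in> first_vars m"
  unfolding first_vars_def using keys_add[of P Q] by blast

lemma first_vars_uminus: "P \<in> first_vars m \<Longrightarrow> - P \<in> first_vars m"
  by (auto simp: first_vars_def in_keys_iff)

lemma first_vars_diff: "P \<in> first_vars m \<Longrightarrow> Q \<in> first_vars m \<Longrightarrow> P - Q \<in> first_vars m"
  using first_vars_add[of P m "- Q"] first_vars_uminus by auto

lemma first_vars_mult:
  assumes "P \<in> first_vars m" "Q \<in> first_vars m"
  shows "P * Q \<in> first_vars m"
proof -
  have "Poly_Mapping.keys t \<subseteq> {..<m}" if t: "t \<in> Poly_Mapping.keys (P * Q)" for t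
  proof -
    obtain a b where "t = a + b" "a \<in> Poly_Mapping.keys P" "b \<in> Poly_Mapping.keys Q"
      using subsetD[OF keys_mult t] by auto
    then show ?thesis
      using assms keys_add[of a b] by (fastforce simp: first_vars_def)
  qed
  then show ?thesis by (auto simp: first_vars_def)
qed

lemma first_vars_sum: "(\<And>i. i \<in> A \<Longrightarrow> f i \<in> first_vars m) \<Longrightarrow> sum f A \<in> first_vars m"
  by (induction A rule: infinite_finite_induct) (auto intro: first_vars_add)

lemma first_vars_power: "P \<in> first_vars m \<Longrightarrow> P ^ e \<in> first_vars m"
  by (induction e) (auto intro: first_vars_mult)

lemma first_vars_mono: "m \<le> m' \<Longrightarrow> P \<in> first_vars m \<Longrightarrow> P \<in> first_vars m'"
  by (fastforce simp: first_vars_def)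

lemma first_vars_ex: "\<exists>m. P \<in> first_vars m"
proof -
  have "finite (\<Union>t\<in>Poly_Mapping.keys P. Poly_Mapping.keys t)" by simp
  then obtain m where "\<forall>i\<in>(\<Union>t\<in>Poly_Mapping.keys P. Poly_Mapping.keys t). i < m"
    by (metis finite_nat_set_iff_bounded)
  then show ?thesis by (auto simp: first_vars_def)
qed

lemma first_vars_zeroD: "P \<in> first_vars 0 \<Longrightarrow> \<exists>c. P = Poly_Mapping.single 0 c"
proof -
  assume "P \<in> first_vars 0"
  then have "Poly_Mapping.keys P \<subseteq> {0}" by (auto simp: first_vars_def)
  then have "P = Poly_Mapping.single 0 (Poly_Mapping.lookup P 0)"
    by (intro poly_mapping_eqI) (auto simp: lookup_single when_def in_keys_iff)
  then show ?thesis by blast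
qed

lemma meval_first_vars_cong:
  assumes "P \<in> first_vars m" "\<And>i. i < m \<Longrightarrow> x i = y i"
  shows "meval P x = meval P y"
  unfolding meval_def
  by (intro sum.cong prod.cong arg_cong2[where f="(*)"] refl)
     (use assms in \<open>fastforce simp: first_vars_def\<close>)

text \<open>The polynomial ring in \<open>m + 1\<close> variables as a univariate polynomial ring over the one
  in \<open>m\<close> variables.\<close>

definition pcoeffs :: "nat \<Rightarrow> 'k::comm_ring_1 mpoly poly set" where
  "pcoeffs m = {p. \<forall>i. coeff p i \<in> first_vars m}"

lemma pcoeffs_0 [simp]: "0 \<in> pcoeffs m"
  by (simp add: pcoeffs_def)

lemma pcoeffs_pCons: "a \<in> first_vars m \<Longrightarrow> p \<in> pcoeffs m \<Longrightarrow> pCons a p \<in> pcoeffs m"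
  by (auto simp: pcoeffs_def coeff_pCons split: nat.split)

lemma pcoeffs_add: "p \<in> pcoeffs m \<Longrightarrow> q \<in> pcoeffs m \<Longrightarrow> p + q \<in> pcoeffs m"
  by (auto simp: pcoeffs_def first_vars_add)

lemma pcoeffs_diff: "p \<in> pcoeffs m \<Longrightarrow> q \<in> pcoeffs m \<Longrightarrow> p - q \<in> pcoeffs m"
  by (auto simp: pcoeffs_def first_vars_diff)

lemma pcoeffs_mult: "p \<in> pcoeffs m \<Longrightarrow> q \<in> pcoeffs m \<Longrightarrow> p * q \<in> pcoeffs m"
  by (auto simp: pcoeffs_def coeff_mult intro!: first_vars_sum first_vars_mult)

lemma pcoeffs_smult: "a \<in> first_vars m \<Longrightarrow> p \<in> pcoeffs m \<Longrightarrow> smult a p \<in> pcoeffs m"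
  by (auto simp: pcoeffs_def first_vars_mult)

lemma pcoeffs_monom: "a \<in> first_vars m \<Longrightarrow> monom a i \<in> pcoeffs m"
  by (auto simp: pcoeffs_def)

lemma poly_mvar_first_vars:
  assumes "p \<in> pcoeffs m"
  shows "poly p (mvar m) \<in> first_vars (Suc m)"
proof -
  have "coeff p i \<in> first_vars (Suc m)" for i
    using assms first_vars_mono[of m "Suc m"] by (auto simp: pcoeffs_def)
  then show ?thesis
    by (auto simp: poly_altdef intro!: first_vars_sum first_vars_mult first_vars_power first_vars_mvar)
qed

lemma poly_mvar_rep:
  assumes "P \<in> first_vars (Suc m)"
  shows "\<exists>p\<in>pcoeffs m. P = poly p (mvar m)"
proof (induction P rule: poly_mapping_add_induct)
  case zero
  show ?case by (rule bexI[of _ 0]) auto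
next
  case (single t c)
  define e where "e = Poly_Mapping.lookup t m"
  define s where "s = Poly_Mapping.update m 0 t"
  have t: "t = s + Poly_Mapping.single m e"
    by (intro poly_mapping_eqI) (auto simp: s_def e_def lookup_add lookup_update lookup_single when_def)
  have keys: "Poly_Mapping.keys t \<subseteq> {..<Suc m}"
    using single assms by (auto simp: first_vars_def)
  have "i < m" if "i \<in> Poly_Mapping.keys s" for i
  proof -
    have "i \<noteq> m" "i \<in> Poly_Mapping.keys t"
      using that by (auto simp: s_def in_keys_iff lookup_update split: if_splits)
    then show ?thesis using keys by auto
  qed
  then have "Poly_Mapping.single s c \<in> first_vars m"
    by (cases "c = 0") (auto simp: first_vars_def)
  then show ?case
    by (intro bexI[of _ "monom (Poly_Mapping.single s c) e"])
       (auto simp: poly_monom pcoeffs_monom mvar_power mult_single t)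
next
  case (add G H)
  then obtain p q where "p \<in> pcoeffs m" "q \<in> pcoeffs m" "G = poly p (mvar m)" "H = poly q (mvar m)"
    by blast
  then show ?case by (intro bexI[of _ "p + q"]) (auto simp: pcoeffs_add)
qed

lemma meval_poly_mvar:
  assumes "p \<in> pcoeffs m"
  shows "meval (poly p (mvar m)) (x(m := t)) = poly (map_poly (\<lambda>c. meval c x) p) t"
    (is "_ = poly ?q t")
proof -
  have "meval (coeff p i) (x(m := t)) = meval (coeff p i) x" for i
    using assms by (intro meval_first_vars_cong[of _ m]) (auto simp: pcoeffs_def)
  then have "meval (poly p (mvar m)) (x(m := t)) = (\<Sum>i\<le>degree p. meval (coeff p i) x * t ^ i)"
    by (simp add: poly_altdef)
  also have "\<dots> = (\<Sum>i\<le>degree p. coeff ?q i * t ^ i)"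
    by (simp add: coeff_map_poly)
  also have "\<dots> = (\<Sum>i\<le>degree ?q. coeff ?q i * t ^ i)"
    by (rule sum.mono_neutral_right) (auto simp: map_poly_degree_leq coeff_eq_0)
  also have "\<dots> = poly ?q t"
    by (simp add: poly_altdef)
  finally show ?thesis .
qed

text \<open>Some coefficient with respect to the last variable is nonzero and, by induction, takes a
  nonzero value. The remaining univariate polynomial is then nonzero and has a non-root because the
  field is infinite.\<close>

lemma meval_nonzero_first_vars:
  fixes P :: "'k::field_char_0 mpoly"
  assumes "P \<in> first_vars m" "P \<noteq> 0"
  shows "\<exists>x. meval P x \<noteq> 0"
  using assms
proof (induction m arbitrary: P)
  case 0
  then obtain c where "P = Poly_Mapping.single 0 c" using first_vars_zeroD by blast
  then show ?case using 0 by (auto simp: meval_single)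
next
  case (Suc m)
  obtain p where p: "p \<in> pcoeffs m" "P = poly p (mvar m)" using poly_mvar_rep[OF Suc.prems(1)] by blast
  with Suc.prems obtain j where "coeff p j \<noteq> 0" by (metis leading_coeff_0_iff poly_0)
  then obtain x where x: "meval (coeff p j) x \<noteq> 0"
    using Suc.IH[of "coeff p j"] p by (auto simp: pcoeffs_def)
  then have "coeff (map_poly (\<lambda>c. meval c x) p) j \<noteq> 0" by (simp add: coeff_map_poly)
  then have "map_poly (\<lambda>c. meval c x) p \<noteq> 0" by force
  then obtain t where "poly (map_poly (\<lambda>c. meval c x) p) t \<noteq> 0"
    using poly_all_0_iff_0 by blast
  then show ?case using meval_poly_mvar[OF p(1)] p(2) by metis
qed

lemma meval_eq_iff:
  fixes P Q :: "'k::field_char_0 mpoly"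
  shows "(\<forall>x. meval P x = meval Q x) \<longleftrightarrow> P = Q"
proof -
  obtain m where "P - Q \<in> first_vars m" using first_vars_ex by blast
  then show ?thesis using meval_nonzero_first_vars[of "P - Q" m] by auto
qed

text \<open>A nonzero leading coefficient has a nonzero value somewhere; specializing there leaves a
  nonzero univariate polynomial that would vanish everywhere. Degree and leading coefficient in
  \<open>mvar m\<close> are thereby well defined.\<close>

lemma poly_mvar_inj:
  fixes p :: "'k::field_char_0 mpoly poly"
  assumes "p \<in> pcoeffs m" "poly p (mvar m) = 0"
  shows "p = 0"
proof (rule ccontr)
  assume "p \<noteq> 0"
  then have "lead_coeff p \<noteq> 0" by simp
  moreover have "lead_coeff p \<in> first_vars m" using assms by (auto simp: pcoeffs_def)
  ultimately obtain x where "meval (lead_coeff p) x \<noteq> 0"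
    using meval_nonzero_first_vars by blast
  then have "coeff (map_poly (\<lambda>c. meval c x) p) (degree p) \<noteq> 0" by (simp add: coeff_map_poly)
  then have "map_poly (\<lambda>c. meval c x) p \<noteq> 0" by force
  moreover have "poly (map_poly (\<lambda>c. meval c x) p) t = 0" for t
    using meval_poly_mvar[OF assms(1), of x t] assms(2) by simp
  ultimately show False using poly_all_0_iff_0 by blast
qed

lemma poly_mvar_eq:
  fixes p q :: "'k::field_char_0 mpoly poly"
  assumes "p \<in> pcoeffs m" "q \<in> pcoeffs m" "poly p (mvar m) = poly q (mvar m)"
  shows "p = q"
  using poly_mvar_inj[of "p - q" m] assms pcoeffs_diff by auto

text \<open>Degrees in the top variable add up, so a nonzero product free of that variable has
  factors free of it; the variables from \<open>M\<close> down to \<open>m\<close> are removed one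
  at a time. Hence units and irreducibility do not depend on the ambient number of
  variables.\<close>

lemma first_vars_divisor_aux:
  fixes b c :: "'k::field_char_0 mpoly"
  assumes "b \<in> first_vars M" "c \<in> first_vars M" "b * c \<in> first_vars m" "b * c \<noteq> 0"
  shows "b \<in> first_vars m"
  using assms
proof (induction M)
  case 0
  then show ?case using first_vars_mono[of 0 m b] by simp
next
  case (Suc M)
  show ?case
  proof (cases "Suc M \<le> m")
    case True
    then show ?thesis using Suc.prems first_vars_mono by blast
  next
    case False
    then have bc: "b * c \<in> first_vars M" using Suc.prems first_vars_mono[of m M] by auto
    obtain p q where pq: "p \<in> pcoeffs M" "q \<in> pcoeffs M" "b = poly p (mvar M)" "c = poly q (mvar M)"
      using Suc.prems poly_mvar_rep by metis
    have "p * q = [:b * c:]"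
      by (rule poly_mvar_eq[of _ M]) (use pq bc in \<open>auto intro: pcoeffs_mult pcoeffs_pCons\<close>)
    moreover from this have "p \<noteq> 0" "q \<noteq> 0" using Suc.prems by auto
    ultimately have "degree p = 0" "degree q = 0"
      by (metis add_is_0 degree_mult_eq degree_pCons_0)+
    then obtain b' c' where "p = [:b':]" "q = [:c':]" by (metis degree_eq_zeroE)
    then have "b \<in> first_vars M" "c \<in> first_vars M"
      using pq by (auto simp: pcoeffs_def dest: spec[of _ 0])
    then show ?thesis using Suc by blast
  qed
qed

lemma first_vars_divisor:
  fixes b c :: "'k::field_char_0 mpoly"
  assumes "b * c \<in> first_vars m" "b * c \<noteq> 0"
  shows "b \<in> first_vars m" "c \<in> first_vars m"
proof -
  obtain i j where "b \<in> first_vars i" "c \<in> first_vars j" using first_vars_ex by metis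
  then have "b \<in> first_vars (max i j)" "c \<in> first_vars (max i j)"
    using first_vars_mono[of i "max i j"] first_vars_mono[of j "max i j"] by auto
  then show "b \<in> first_vars m" "c \<in> first_vars m"
    using first_vars_divisor_aux[of b "max i j" c m] first_vars_divisor_aux[of c "max i j" b m] assms
    by (auto simp: mult.commute)
qed

text \<open>Leading coefficients are not invertible, so each removal of a top term first multiplies
  by \<open>lead_coeff d\<close>; the factor \<open>a\<close> collects these
  multiplications.\<close>

lemma pseudo_division:
  fixes f d :: "'k::field_char_0 mpoly poly"
  assumes "f \<in> pcoeffs m" "d \<in> pcoeffs m" "d \<noteq> 0"
  shows "\<exists>a q r. a \<in> first_vars m \<and> a \<noteq> 0 \<and> q \<in> pcoeffs m \<and> r \<in> pcoeffs m \<and>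
    smult a f = d * q + r \<and> (r = 0 \<or> degree r < degree d)"
  using assms
proof (induction "degree f" arbitrary: f rule: less_induct)
  case less
  show ?case
  proof (cases "f = 0 \<or> degree f < degree d")
    case True
    then show ?thesis using less.prems by (intro exI[of _ 1] exI[of _ 0] exI[of _ f]) auto
  next
    case False
    define k where "k = degree f - degree d"
    define f' where "f' = smult (lead_coeff d) f - d * monom (lead_coeff f) k"
    have lc: "lead_coeff d \<in> first_vars m" "lead_coeff f \<in> first_vars m"
      using less.prems by (auto simp: pcoeffs_def)
    have f': "f' \<in> pcoeffs m"
      unfolding f'_def using less.prems lc
      by (intro pcoeffs_diff pcoeffs_mult pcoeffs_smult pcoeffs_monom)
    have "degree (d * monom (lead_coeff f) k) \<le> degree d + degree (monom (lead_coeff f) k)"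
      by (rule degree_mult_le)
    also have "\<dots> \<le> degree f"
      using False degree_monom_le[of "lead_coeff f" k] by (auto simp: k_def)
    finally have le: "degree f' \<le> degree f"
      unfolding f'_def by (rule degree_diff_le[OF degree_smult_le])
    have "coeff (d * monom (lead_coeff f) k) (degree d + k) = lead_coeff d * lead_coeff f"
      by (simp add: coeff_monom_mult mult.commute[of d "monom _ _"] mult.commute[of "lead_coeff d"])
    then have c0: "coeff f' (degree f) = 0"
      using False by (simp add: f'_def k_def)
    show ?thesis
    proof (cases "degree f = 0")
      case True
      then have "f' = 0" using le c0 by (metis le_zero_eq leading_coeff_0_iff)
      then show ?thesis
        using less.prems lc
        by (intro exI[of _ "lead_coeff d"] exI[of _ "monom (lead_coeff f) k"] exI[of _ 0])
           (auto simp: f'_def pcoeffs_monom)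
    next
      case pos: False
      have "degree f' < degree f"
        using le c0 pos by (metis leading_coeff_0_iff degree_0 le_neq_implies_less neq0_conv)
      from less.hyps[OF this f' less.prems(2,3)] obtain a q r where
        *: "a \<in> first_vars m" "a \<noteq> 0" "q \<in> pcoeffs m" "r \<in> pcoeffs m"
          "smult a f' = d * q + r" "r = 0 \<or> degree r < degree d" by blast
      have "smult (a * lead_coeff d) f = d * (q + smult a (monom (lead_coeff f) k)) + r"
      proof -
        have "smult a f' = smult (a * lead_coeff d) f - d * smult a (monom (lead_coeff f) k)"
          by (simp add: f'_def smult_diff_right)
        then show ?thesis using *(5) by (simp add: algebra_simps)
      qed
      then show ?thesis
        using * lc less.prems
        by (intro exI[of _ "a * lead_coeff d"] exI[of _ "q + smult a (monom (lead_coeff f) k)"] exI[of _ r])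
           (auto intro!: first_vars_mult pcoeffs_add pcoeffs_smult pcoeffs_monom)
    qed
  qed
qed

section \<open>Unique factorization and the Nullstellensatz for hypersurfaces\<close>

text \<open>A substitute for the number of irreducible factors, which is not yet known to be well
  defined. Additive and zero exactly at units, it drops whenever a nonunit factor is
  removed.\<close>

definition additive_size :: "nat \<Rightarrow> ('k::field_char_0 mpoly \<Rightarrow> nat) \<Rightarrow> bool" where
  "additive_size m \<mu> \<longleftrightarrow> (\<forall>a\<in>first_vars m. \<forall>b\<in>first_vars m. a \<noteq> 0 \<longrightarrow> b \<noteq> 0 \<longrightarrow>
     \<mu> (a * b) = \<mu> a + \<mu> b \<and> (\<mu> a = 0 \<longleftrightarrow> a dvd 1))"

text \<open>Divisibility is meant in the whole ring but tested on \<open>first_vars m\<close> only,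
  since primality of irreducible elements is proved by induction on \<open>m\<close>.\<close>

definition prime_in :: "nat \<Rightarrow> 'k::field_char_0 mpoly \<Rightarrow> bool" where
  "prime_in m \<pi> \<longleftrightarrow> \<pi> \<noteq> 0 \<and> (\<forall>a\<in>first_vars m. \<forall>b\<in>first_vars m. \<pi> dvd a * b \<longrightarrow> \<pi> dvd a \<or> \<pi> dvd b)"

lemma first_vars_unit: "(a::'k::field_char_0 mpoly) dvd 1 \<Longrightarrow> a \<in> first_vars m"
  by (metis dvdE first_vars_1 first_vars_divisor(1) one_neq_zero)

lemma first_vars_dvdE:
  fixes a b :: "'k::field_char_0 mpoly"
  assumes "a dvd b" "b \<in> first_vars m"
  obtains c where "b = a * c" "c \<in> first_vars m"
proof (cases "b = 0")
  case True
  then show ?thesis using that[of 0] by simp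
next
  case False
  from assms(1) obtain c where "b = a * c" ..
  then show ?thesis using that[of c] first_vars_divisor(2)[of a c m] False assms(2) by auto
qed

lemma first_vars_0_unit:
  fixes a :: "'k::field_char_0 mpoly"
  assumes "a \<in> first_vars 0" "a \<noteq> 0"
  shows "a dvd 1"
proof -
  obtain c where c: "a = Poly_Mapping.single 0 c" using first_vars_zeroD assms(1) by blast
  with assms(2) have "c \<noteq> 0" by auto
  then have "a * Poly_Mapping.single 0 (inverse c) = 1" by (simp add: c mult_single)
  then show ?thesis by (metis dvd_triv_left)
qed

text \<open>Degree in the last variable plus the size of the leading coefficient; both parts are
  additive because leading coefficients multiply. In degree zero the polynomial equals its leading
  coefficient, which makes the units come out right.\<close>

lemma additive_size_exists: "\<exists>\<mu>. additive_size m (\<mu> :: 'k::field_char_0 mpoly \<Rightarrow> nat)"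
proof (induction m)
  case 0
  have "additive_size 0 (\<lambda>_::'k mpoly. 0)"
    by (auto simp: additive_size_def first_vars_0_unit)
  then show ?case by blast
next
  case (Suc m)
  then obtain \<mu> :: "'k mpoly \<Rightarrow> nat" where \<mu>: "additive_size m \<mu>" by blast
  define rep where "rep P = (SOME p. p \<in> pcoeffs m \<and> P = poly p (mvar m))" for P :: "'k mpoly"
  have rep: "rep P \<in> pcoeffs m \<and> P = poly (rep P) (mvar m)" if "P \<in> first_vars (Suc m)" for P
    unfolding rep_def by (rule someI_ex) (use poly_mvar_rep[OF that] in blast)
  have rep_eq: "rep (poly p (mvar m)) = p" if "p \<in> pcoeffs m" for p
    using poly_mvar_eq[of "rep (poly p (mvar m))" m p] rep[OF poly_mvar_first_vars[OF that]] that
    by simp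
  have lc: "lead_coeff p \<in> first_vars m" if "p \<in> pcoeffs m" for p :: "'k mpoly poly"
    using that by (auto simp: pcoeffs_def)
  define \<mu>' where "\<mu>' P = degree (rep P) + \<mu> (lead_coeff (rep P))" for P
  have "additive_size (Suc m) \<mu>'"
    unfolding additive_size_def
  proof (intro ballI impI conjI)
    fix a b :: "'k mpoly"
    assume ab: "a \<in> first_vars (Suc m)" "b \<in> first_vars (Suc m)" "a \<noteq> 0" "b \<noteq> 0"
    obtain p q where pq: "p \<in> pcoeffs m" "q \<in> pcoeffs m" "a = poly p (mvar m)" "b = poly q (mvar m)"
      using rep ab by metis
    then have nz: "p \<noteq> 0" "q \<noteq> 0" using ab by auto
    have "rep (a * b) = p * q" using rep_eq[of "p * q"] pq by (simp add: pcoeffs_mult)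
    moreover have "\<mu> (lead_coeff p * lead_coeff q) = \<mu> (lead_coeff p) + \<mu> (lead_coeff q)"
      using \<mu> nz lc pq unfolding additive_size_def by auto
    ultimately show "\<mu>' (a * b) = \<mu>' a + \<mu>' b"
      using nz pq by (simp add: \<mu>'_def rep_eq degree_mult_eq coeff_mult_degree_sum)
    have unit: "\<mu> (lead_coeff p) = 0 \<longleftrightarrow> lead_coeff p dvd 1"
      using \<mu> nz lc pq unfolding additive_size_def by (metis leading_coeff_0_iff)
    show "\<mu>' a = 0 \<longleftrightarrow> a dvd 1"
    proof
      assume "\<mu>' a = 0"
      then have "degree p = 0" "lead_coeff p dvd 1"
        using pq unit by (auto simp: \<mu>'_def rep_eq)
      moreover from this obtain c where "p = [:c:]" by (metis degree_eq_zeroE)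
      ultimately show "a dvd 1" using pq by auto
    next
      assume "a dvd 1"
      then have "a \<in> first_vars m" by (rule first_vars_unit)
      then have "rep a = [:a:]" using rep_eq[of "[:a:]"] by (simp add: pcoeffs_pCons)
      then have p: "p = [:a:]" using rep_eq[OF pq(1)] pq(3) by metis
      have "degree p = 0" "lead_coeff p = a"
        using arg_cong[OF p, of degree] arg_cong[OF p, of lead_coeff] by simp_all
      then show "\<mu>' a = 0" using \<open>a dvd 1\<close> unit rep_eq[OF pq(1)] pq(3) by (simp add: \<mu>'_def)
    qed
  qed
  then show ?case by blast
qed

lemma irreducible_factor_exists:
  fixes a :: "'k::field_char_0 mpoly"
  assumes "a \<in> first_vars m" "a \<noteq> 0" "\<not> a dvd 1"
  shows "\<exists>\<pi>\<in>first_vars m. irreducible \<pi> \<and> \<pi> dvd a"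
proof -
  obtain \<mu> :: "'k mpoly \<Rightarrow> nat" where \<mu>: "additive_size m \<mu>" using additive_size_exists by blast
  show ?thesis using assms
  proof (induction "\<mu> a" arbitrary: a rule: less_induct)
    case less
    show ?case
    proof (cases "irreducible a")
      case False
      then obtain b c where bc: "a = b * c" "\<not> b dvd 1" "\<not> c dvd 1"
        using less.prems by (auto simp: irreducible_def)
      then have fv: "b \<in> first_vars m" "c \<in> first_vars m" "b \<noteq> 0" "c \<noteq> 0"
        using less.prems first_vars_divisor[of b c m] by auto
      then have "\<mu> a = \<mu> b + \<mu> c" "\<mu> c \<noteq> 0"
        using \<mu> bc unfolding additive_size_def by auto
      then have "\<mu> b < \<mu> a" by simp
      then obtain \<pi> where "\<pi> \<in> first_vars m" "irreducible \<pi>" "\<pi> dvd b"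
        using less.hyps[of b] fv bc by blast
      then show ?thesis using bc by auto
    qed (use less.prems in auto)
  qed
qed

lemma const_dvd_poly_mvar:
  fixes \<pi> :: "'k::field_char_0 mpoly"
  assumes "\<pi> \<in> first_vars m" "p \<in> pcoeffs m"
  shows "\<pi> dvd poly p (mvar m) \<longleftrightarrow> (\<forall>i. \<pi> dvd coeff p i)"
proof
  assume "\<pi> dvd poly p (mvar m)"
  then obtain c where c: "poly p (mvar m) = \<pi> * c" "c \<in> first_vars (Suc m)"
    using first_vars_dvdE poly_mvar_first_vars[OF assms(2)] by metis
  then obtain q where q: "q \<in> pcoeffs m" "c = poly q (mvar m)" using poly_mvar_rep by blast
  have "p = smult \<pi> q"
    by (rule poly_mvar_eq[of _ m]) (use assms q c in \<open>auto simp: pcoeffs_smult\<close>)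
  then show "\<forall>i. \<pi> dvd coeff p i" by simp
next
  assume "\<forall>i. \<pi> dvd coeff p i"
  then show "\<pi> dvd poly p (mvar m)" by (auto simp: poly_altdef intro: dvd_sum)
qed

section \<open>Gauss's lemma and elimination of one variable\<close>

text \<open>If \<open>i\<close> and \<open>j\<close> are the first indices of coefficients not
  divisible by \<open>\<pi>\<close>, then every term but one in the coefficient of index
  \<open>i + j\<close> of the product is divisible.\<close>

lemma prime_in_Suc:
  fixes \<pi> :: "'k::field_char_0 mpoly"
  assumes "\<pi> \<in> first_vars m" "prime_in m \<pi>"
  shows "prime_in (Suc m) \<pi>"
  unfolding prime_in_def
proof (intro conjI ballI impI)
  fix a b :: "'k mpoly"
  assume ab: "a \<in> first_vars (Suc m)" "b \<in> first_vars (Suc m)" "\<pi> dvd a * b"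
  obtain p q where pq: "p \<in> pcoeffs m" "q \<in> pcoeffs m" "a = poly p (mvar m)" "b = poly q (mvar m)"
    using poly_mvar_rep ab by metis
  show "\<pi> dvd a \<or> \<pi> dvd b"
  proof (rule ccontr)
    assume "\<not> (\<pi> dvd a \<or> \<pi> dvd b)"
    then have ex: "\<exists>i. \<not> \<pi> dvd coeff p i" "\<exists>i. \<not> \<pi> dvd coeff q i"
      using const_dvd_poly_mvar[OF assms(1)] pq by auto
    define i where "i = (LEAST i. \<not> \<pi> dvd coeff p i)"
    define j where "j = (LEAST j. \<not> \<pi> dvd coeff q j)"
    have i: "\<not> \<pi> dvd coeff p i" "\<And>k. k < i \<Longrightarrow> \<pi> dvd coeff p k"
      unfolding i_def using LeastI_ex[OF ex(1)] not_less_Least by blast+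
    have j: "\<not> \<pi> dvd coeff q j" "\<And>k. k < j \<Longrightarrow> \<pi> dvd coeff q k"
      unfolding j_def using LeastI_ex[OF ex(2)] not_less_Least by blast+
    have "\<pi> dvd poly (p * q) (mvar m)" using ab pq by simp
    then have "\<pi> dvd coeff (p * q) (i + j)"
      using const_dvd_poly_mvar[OF assms(1) pcoeffs_mult[OF pq(1,2)]] by blast
    moreover have "coeff (p * q) (i + j) =
        coeff p i * coeff q j + (\<Sum>k\<in>{..i + j} - {i}. coeff p k * coeff q (i + j - k))"
      by (simp add: coeff_mult sum.remove[of _ i])
    moreover have "\<pi> dvd (\<Sum>k\<in>{..i + j} - {i}. coeff p k * coeff q (i + j - k))"
    proof (rule dvd_sum)
      fix k assume "k \<in> {..i + j} - {i}"
      then consider "k < i" | "i + j - k < j" by fastforce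
      then show "\<pi> dvd coeff p k * coeff q (i + j - k)" using i j by cases auto
    qed
    ultimately have "\<pi> dvd coeff p i * coeff q j" by (simp add: dvd_add_left_iff)
    then show False using assms(2) i(1) j(1) pq(1,2) unfolding prime_in_def pcoeffs_def by blast
  qed
qed (use assms in \<open>auto simp: prime_in_def\<close>)

text \<open>By Gauss's lemma each irreducible factor of \<open>a\<close> divides \<open>D\<close> or
  \<open>q\<close> and is cancelled there. Those taken out of \<open>D\<close> are collected in
  \<open>e\<close>; a remaining unit is absorbed by the cofactor.\<close>

lemma cancel_first_vars:
  fixes a :: "'k::field_char_0 mpoly"
  assumes prime: "\<And>\<pi>::'k mpoly. \<pi> \<in> first_vars m \<Longrightarrow> irreducible \<pi> \<Longrightarrow> prime_in m \<pi>"
    and "a \<in> first_vars m" "a \<noteq> 0" "D \<in> first_vars (Suc m)" "q \<in> first_vars (Suc m)" "a * F = D * q"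
  shows "\<exists>D1 q1 e. D1 \<in> first_vars (Suc m) \<and> q1 \<in> first_vars (Suc m) \<and> e \<in> first_vars m \<and>
    e \<noteq> 0 \<and> D = e * D1 \<and> F = D1 * q1"
proof -
  obtain \<mu> :: "'k mpoly \<Rightarrow> nat" where \<mu>: "additive_size m \<mu>" using additive_size_exists by blast
  show ?thesis using assms(2-)
  proof (induction "\<mu> a" arbitrary: a D q rule: less_induct)
    case less
    show ?case
    proof (cases "a dvd 1")
      case True
      then obtain u where u: "1 = a * u" ..
      then have "u \<in> first_vars (Suc m)" by (metis dvd_triv_right first_vars_unit)
      moreover have "F = D * (u * q)"
      proof -
        have "F = (a * u) * F" using u by (metis mult_1)
        also have "\<dots> = u * (a * F)" by (simp only: ac_simps)
        also have "\<dots> = D * (u * q)" unfolding less.prems(5) by (simp only: ac_simps)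
        finally show ?thesis .
      qed
      ultimately show ?thesis
        using less.prems by (intro exI[of _ D] exI[of _ "u * q"] exI[of _ 1]) (auto intro: first_vars_mult)
    next
      case False
      then obtain \<pi> where \<pi>: "\<pi> \<in> first_vars m" "irreducible \<pi>" "\<pi> dvd a"
        using irreducible_factor_exists less.prems by blast
      then obtain a' where a': "a = \<pi> * a'" "a' \<in> first_vars m"
        using first_vars_dvdE less.prems(1) by metis
      have nz: "\<pi> \<noteq> 0" "a' \<noteq> 0" using a' less.prems by auto
      have "\<mu> a = \<mu> \<pi> + \<mu> a'" "\<mu> \<pi> \<noteq> 0"
        using \<mu> a' \<pi> nz unfolding additive_size_def by (auto simp: irreducible_def)
      then have lt: "\<mu> a' < \<mu> a" by simp
      have "\<pi> dvd D * q" using less.prems(5) a' by (metis dvd_triv_left mult.assoc)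
      then consider "\<pi> dvd D" | "\<pi> dvd q"
        using prime_in_Suc[OF \<pi>(1) prime[OF \<pi>(1,2)]] less.prems unfolding prime_in_def by blast
      then show ?thesis
      proof cases
        case 1
        then obtain D' where D': "D = \<pi> * D'" "D' \<in> first_vars (Suc m)"
          using first_vars_dvdE less.prems(3) by metis
        have "a' * F = D' * q" using less.prems(5) nz by (simp add: D' a' mult.assoc)
        then obtain D1 q1 e where "D1 \<in> first_vars (Suc m)" "q1 \<in> first_vars (Suc m)"
            "e \<in> first_vars m" "e \<noteq> 0" "D' = e * D1" "F = D1 * q1"
          using less.hyps[OF lt a'(2) nz(2) D'(2) less.prems(4)] by blast
        then show ?thesis using D' \<pi> nz
          by (intro exI[of _ D1] exI[of _ q1] exI[of _ "\<pi> * e"]) (auto intro: first_vars_mult simp: mult.assoc)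
      next
        case 2
        then obtain q' where q': "q = \<pi> * q'" "q' \<in> first_vars (Suc m)"
          using first_vars_dvdE less.prems(4) by metis
        have "a' * F = D * q'" using less.prems(5) nz by (simp add: q' a' mult.left_commute mult.assoc)
        then show ?thesis
          using less.hyps[OF lt a'(2) nz(2) less.prems(3) q'(2)] by blast
      qed
    qed
  qed
qed

text \<open>A replacement for the resultant. Over the fraction field of the first \<open>m\<close>
  variables, the ideal of \<open>F\<close> and \<open>P\<close> is generated by an element of least
  degree in \<open>mvar m\<close>. Up to factors free of \<open>mvar m\<close> this element divides
  \<open>F\<close>; as \<open>F\<close> is irreducible, it is itself free of \<open>mvar m\<close>
  or is essentially \<open>F\<close>, and the latter would make \<open>F\<close> divide
  \<open>P\<close>.\<close>

lemma elimination:
  fixes F P :: "'k::field_char_0 mpoly"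
  assumes prime: "\<And>\<pi>::'k mpoly. \<pi> \<in> first_vars m \<Longrightarrow> irreducible \<pi> \<Longrightarrow> prime_in m \<pi>"
    and F: "F \<in> first_vars (Suc m)" "F \<notin> first_vars m" "irreducible F"
    and P: "P \<in> first_vars (Suc m)" "\<not> F dvd P"
  shows "\<exists>U V e. U \<in> first_vars (Suc m) \<and> V \<in> first_vars (Suc m) \<and> e \<in> first_vars m \<and> e \<noteq> 0 \<and>
    e = U * F + V * P"
proof -
  \<comment> \<open>Only degrees in \<open>mvar m\<close> matter, so the combinations of
    \<open>F\<close> and \<open>P\<close> are represented by univariate polynomials.\<close>
  define J where "J = {d \<in> pcoeffs m. d \<noteq> 0 \<and> (\<exists>U\<in>first_vars (Suc m). \<exists>V\<in>first_vars (Suc m).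
    poly d (mvar m) = U * F + V * P)}"
  obtain f p where fp: "f \<in> pcoeffs m" "p \<in> pcoeffs m" "F = poly f (mvar m)" "P = poly p (mvar m)"
    using poly_mvar_rep F P by metis
  have Fnz: "F \<noteq> 0" using F by (auto simp: irreducible_def)
  have "f \<noteq> 0" using fp Fnz by auto
  moreover have "poly f (mvar m) = 1 * F + 0 * P" using fp by simp
  ultimately have "f \<in> J" unfolding J_def using fp(1) first_vars_0 first_vars_1 by blast
  then obtain d where d: "d \<in> J" "\<And>d'. d' \<in> J \<Longrightarrow> degree d \<le> degree d'"
    using arg_min_nat_lemma[of "\<lambda>d. d \<in> J" f degree] by blast
  define D where "D = poly d (mvar m)"
  from d obtain U V where UV: "U \<in> first_vars (Suc m)" "V \<in> first_vars (Suc m)" "D = U * F + V * P"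
    unfolding J_def D_def by blast
  have dm: "d \<in> pcoeffs m" "d \<noteq> 0" using d by (auto simp: J_def)
  have Dm: "D \<in> first_vars (Suc m)" unfolding D_def using dm poly_mvar_first_vars by blast
  have divides: "\<exists>a q. a \<in> first_vars m \<and> a \<noteq> 0 \<and> q \<in> first_vars (Suc m) \<and> a * poly g (mvar m) = D * q"
    if g: "g \<in> pcoeffs m" "U' \<in> first_vars (Suc m)" "V' \<in> first_vars (Suc m)"
      "poly g (mvar m) = U' * F + V' * P" for g U' V'
  proof -
    obtain a q r where *: "a \<in> first_vars m" "a \<noteq> 0" "q \<in> pcoeffs m" "r \<in> pcoeffs m"
      "smult a g = d * q + r" "r = 0 \<or> degree r < degree d"
      using pseudo_division[OF g(1) dm] by blast
    define Q where "Q = poly q (mvar m)"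
    have Qm: "Q \<in> first_vars (Suc m)" unfolding Q_def using * poly_mvar_first_vars by blast
    have am: "a \<in> first_vars (Suc m)" using *(1) first_vars_mono[of m "Suc m"] by simp
    have eq: "a * poly g (mvar m) = D * Q + poly r (mvar m)"
      using arg_cong[OF *(5), of "\<lambda>h. poly h (mvar m)"] by (simp add: D_def Q_def)
    have "r = 0"
    proof (rule ccontr)
      assume "r \<noteq> 0"
      have "poly r (mvar m) = (a * U' - Q * U) * F + (a * V' - Q * V) * P"
        using eq g(4) UV(3) by (simp add: algebra_simps)
      moreover have "a * U' - Q * U \<in> first_vars (Suc m)" "a * V' - Q * V \<in> first_vars (Suc m)"
        using am Qm UV g by (auto intro!: first_vars_diff first_vars_mult)
      ultimately have "r \<in> J" using \<open>r \<noteq> 0\<close> * unfolding J_def by blast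
      then show False using d(2)[of r] *(6) \<open>r \<noteq> 0\<close> by auto
    qed
    then show ?thesis using eq * Qm by auto
  qed
  obtain a q where aq: "a \<in> first_vars m" "a \<noteq> 0" "q \<in> first_vars (Suc m)" "a * F = D * q"
    using divides[OF fp(1), of 1 0] fp by auto
  obtain b q' where bq: "b \<in> first_vars m" "b \<noteq> 0" "q' \<in> first_vars (Suc m)" "b * P = D * q'"
    using divides[OF fp(2), of 0 1] fp by auto
  obtain D1 q1 e where 1: "D1 \<in> first_vars (Suc m)" "q1 \<in> first_vars (Suc m)" "e \<in> first_vars m"
      "e \<noteq> 0" "D = e * D1" "F = D1 * q1"
    using cancel_first_vars[OF prime aq(1,2) Dm aq(3,4)] by metis
  have "D1 dvd 1 \<or> q1 dvd 1" using F(3) 1(6) by (auto simp: irreducible_def)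
  then show ?thesis
  proof
    assume "D1 dvd 1"
    then have "D \<in> first_vars m" using 1 first_vars_unit first_vars_mult by metis
    moreover have "D \<noteq> 0" using 1 \<open>D1 dvd 1\<close> by auto
    ultimately show ?thesis using UV by blast
  next
    assume "q1 dvd 1"
    then obtain u where u: "1 = q1 * u" ..
    have um: "u \<in> first_vars (Suc m)" by (metis u dvd_triv_right first_vars_unit)
    have "D1 = F * u" using 1(6) u by (simp add: mult.assoc)
    then have "b * P = F * (u * e * q')" using bq(4) 1(5) by (simp add: algebra_simps)
    moreover have "u * e * q' \<in> first_vars (Suc m)"
      using um 1(3) bq(3) first_vars_mono[of m "Suc m"] by (auto intro!: first_vars_mult)
    ultimately obtain D2 q2 e2 where 2: "e2 \<in> first_vars m" "F = e2 * D2" "P = D2 * q2"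
      using cancel_first_vars[OF prime bq(1,2) F(1)] by metis
    have "e2 dvd 1 \<or> D2 dvd 1" using F(3) 2(2) by (auto simp: irreducible_def)
    then show ?thesis
    proof
      assume "e2 dvd 1"
      then obtain v where "1 = e2 * v" ..
      then have "P = e2 * v * P" by (metis mult_1)
      also have "\<dots> = F * (v * q2)" unfolding 2(2,3) by (simp only: ac_simps)
      finally have "P = F * (v * q2)" .
      then show ?thesis using P by auto
    next
      assume "D2 dvd 1"
      then have "F \<in> first_vars m" using 2 first_vars_unit first_vars_mult by metis
      then show ?thesis using F by simp
    qed
  qed
qed

text \<open>If \<open>F\<close> involves the last variable and does not divide \<open>P\<close>,
  elimination gives a nonzero \<open>e\<close> without that variable such that \<open>F\<close>
  divides \<open>e * Q\<close>, and \<open>e\<close> can be cancelled because primality is known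
  with one variable less. If \<open>F\<close> is free of the last variable, Gauss's lemma
  applies.\<close>

lemma irreducible_prime_in:
  fixes F :: "'k::field_char_0 mpoly"
  assumes "F \<in> first_vars m" "irreducible F"
  shows "prime_in m F"
  using assms
proof (induction m arbitrary: F)
  case 0
  then show ?case using first_vars_0_unit by (auto simp: irreducible_def)
next
  case (Suc m)
  show ?case
  proof (cases "F \<in> first_vars m")
    case True
    then show ?thesis using Suc prime_in_Suc by blast
  next
    case nF: False
    show ?thesis unfolding prime_in_def
    proof (intro conjI ballI impI)
      fix P Q assume PQ: "P \<in> first_vars (Suc m)" "Q \<in> first_vars (Suc m)" "F dvd P * Q"
      show "F dvd P \<or> F dvd Q"
      proof (cases "F dvd P")
        case False
        from False obtain U V e where e: "e \<in> first_vars m" "e \<noteq> 0" "e = U * F + V * P"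
          using elimination[OF Suc.IH Suc.prems(1) nF Suc.prems(2) PQ(1)] by blast
        have "e * Q = F * (U * Q) + V * (P * Q)" by (simp add: e(3) algebra_simps)
        then have "F dvd e * Q" using PQ(3) by simp
        moreover have "e * Q \<in> first_vars (Suc m)"
          using e PQ first_vars_mono[of m "Suc m"] by (auto intro!: first_vars_mult)
        ultimately obtain z where "e * Q = F * z" "z \<in> first_vars (Suc m)"
          using first_vars_dvdE by metis
        then obtain D2 q2 e2 where 2: "e2 \<in> first_vars m" "F = e2 * D2" "Q = D2 * q2"
          using cancel_first_vars[OF Suc.IH e(1,2) Suc.prems(1)] by metis
        have "e2 dvd 1 \<or> D2 dvd 1" using Suc.prems 2(2) by (auto simp: irreducible_def)
        then have "F dvd Q"
        proof
          assume "e2 dvd 1"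
          then obtain v where "1 = e2 * v" ..
          then have "Q = e2 * v * Q" by (metis mult_1)
          also have "\<dots> = F * (v * q2)" unfolding 2(2,3) by (simp only: ac_simps)
          finally have "Q = F * (v * q2)" .
          then show ?thesis by simp
        next
          assume "D2 dvd 1"
          then have "F \<in> first_vars m" using 2 first_vars_unit first_vars_mult by metis
          then show ?thesis using nF by simp
        qed
        then show ?thesis ..
      qed simp
    qed (use Suc.prems in \<open>auto simp: irreducible_def\<close>)
  qed
qed

lemma irreducible_mpoly_prime:
  fixes F :: "'k::field_char_0 mpoly"
  assumes "irreducible F" "F dvd P * Q"
  shows "F dvd P \<or> F dvd Q"
proof -
  obtain i j k where "F \<in> first_vars i" "P \<in> first_vars j" "Q \<in> first_vars k"
    using first_vars_ex by metis
  then have "F \<in> first_vars (i + j + k)" "P \<in> first_vars (i + j + k)" "Q \<in> first_vars (i + j + k)"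
    by (auto elim: first_vars_mono[rotated])
  then show ?thesis
    using irreducible_prime_in[of F "i + j + k"] assms unfolding prime_in_def by blast
qed

text \<open>If \<open>F\<close> involves the last variable and does not divide \<open>P\<close>,
  take an eliminant \<open>e\<close> and a point where neither \<open>e\<close> nor the leading
  coefficient of \<open>F\<close> vanishes. Over it lies a zero of \<open>F\<close>, by algebraic
  closedness; there \<open>P\<close> and hence \<open>e\<close> vanish, which is absurd. If
  \<open>F\<close> is free of the last variable, its zero set is a cylinder and the claim passes to
  the coefficients of \<open>P\<close>.\<close>

lemma hypersurface_nullstellensatz:
  fixes F P :: "'k::field_char_0 mpoly"
  assumes "alg_closed_field TYPE('k)" "irreducible F" "F \<in> first_vars m" "P \<in> first_vars m"
    and "\<And>x. meval F x = 0 \<Longrightarrow> meval P x = 0"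
  shows "F dvd P"
  using assms(3-)
proof (induction m arbitrary: P)
  case 0
  then show ?case using first_vars_0_unit assms(2) by (auto simp: irreducible_def)
next
  case (Suc m)
  obtain p where p: "p \<in> pcoeffs m" "P = poly p (mvar m)" using poly_mvar_rep Suc.prems by metis
  show ?case
  proof (cases "F \<in> first_vars m")
    case True
    have "F dvd coeff p i" for i
    proof (rule Suc.IH[OF True])
      show "coeff p i \<in> first_vars m" using p by (auto simp: pcoeffs_def)
      fix x assume x: "meval F x = 0"
      have "poly (map_poly (\<lambda>c. meval c x) p) t = 0" for t
      proof -
        have "meval F (x(m := t)) = 0"
          using x meval_first_vars_cong[OF True, of "x(m := t)" x] by auto
        then show ?thesis using Suc.prems(3)[of "x(m := t)"] p meval_poly_mvar[OF p(1)] by metis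
      qed
      then have "map_poly (\<lambda>c. meval c x) p = 0" using poly_all_0_iff_0 by blast
      then have "coeff (map_poly (\<lambda>c. meval c x) p) i = 0" by simp
      then show "meval (coeff p i) x = 0" by (simp add: coeff_map_poly)
    qed
    then show ?thesis using const_dvd_poly_mvar[OF True p(1)] p(2) by blast
  next
    case False
    show ?thesis
    proof (rule ccontr)
      assume "\<not> F dvd P"
      then obtain U V e where e: "e \<in> first_vars m" "e \<noteq> 0" "e = U * F + V * P"
        using elimination[OF irreducible_prime_in Suc.prems(1) False assms(2) Suc.prems(2)] by blast
      obtain f where f: "f \<in> pcoeffs m" "F = poly f (mvar m)" using poly_mvar_rep Suc.prems by metis
      have deg: "degree f \<noteq> 0"
      proof
        assume "degree f = 0"
        then obtain c where "f = [:c:]" by (metis degree_eq_zeroE)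
        then show False using f False by (auto simp: pcoeffs_def dest: spec[of _ 0])
      qed
      then have "f \<noteq> 0" by auto
      then have "e * lead_coeff f \<noteq> 0" using e by simp
      moreover have "e * lead_coeff f \<in> first_vars m"
        using e f by (auto intro!: first_vars_mult simp: pcoeffs_def)
      ultimately obtain x where x: "meval (e * lead_coeff f) x \<noteq> 0"
        using meval_nonzero_first_vars by blast
      define g where "g = map_poly (\<lambda>c. meval c x) f"
      have "coeff g (degree f) \<noteq> 0" using x by (simp add: g_def coeff_map_poly)
      then have "degree g \<ge> 1" using deg le_degree[of g "degree f"] by simp
      then obtain t where t: "poly g t = 0" using assms(1) by (auto simp: alg_closed_field_def)
      have F0: "meval F (x(m := t)) = 0" using t meval_poly_mvar[OF f(1)] f(2) by (simp add: g_def)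
      have "meval e (x(m := t)) = 0"
        unfolding e(3) meval_add meval_mult F0 Suc.prems(3)[OF F0] by simp
      moreover have "meval e (x(m := t)) = meval e x"
        using meval_first_vars_cong[OF e(1), of "x(m := t)" x] by simp
      ultimately show False using x by simp
    qed
  qed
qed

section \<open>Polynomial functions and their directional derivatives\<close>

definition scl :: "'k::times \<Rightarrow> (nat \<Rightarrow> 'k) \<Rightarrow> (nat \<Rightarrow> 'k)" (infixr "\<cdot>" 75) where
  "c \<cdot> v = (\<lambda>i. c * v i)"

lemma scl_apply [simp]: "(c \<cdot> v) i = c * v i"
  by (simp add: scl_def)

text \<open>Polynomial functions replace formal polynomials: over an infinite field nothing is lost,
  and closure under substitution and differentiation follows by rule induction.\<close>

inductive polyfun :: "nat \<Rightarrow> ((nat \<Rightarrow> 'k::field_char_0) \<Rightarrow> 'k) \<Rightarrow> bool" for n where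
  const [intro, simp]: "polyfun n (\<lambda>_. c)"
| coord [intro]: "i \<le> n \<Longrightarrow> polyfun n (\<lambda>x. x i)"
| add [intro]: "polyfun n f \<Longrightarrow> polyfun n g \<Longrightarrow> polyfun n (\<lambda>x. f x + g x)"
| mult [intro]: "polyfun n f \<Longrightarrow> polyfun n g \<Longrightarrow> polyfun n (\<lambda>x. f x * g x)"

lemma polyfun_uminus [intro]: "polyfun n f \<Longrightarrow> polyfun n (\<lambda>x. - f x)"
  using polyfun.mult[OF polyfun.const[of n "-1"]] by fastforce

lemma polyfun_diff [intro]: "polyfun n f \<Longrightarrow> polyfun n g \<Longrightarrow> polyfun n (\<lambda>x. f x - g x)"
  using polyfun.add[OF _ polyfun_uminus] by fastforce

lemma polyfun_power [intro]: "polyfun n f \<Longrightarrow> polyfun n (\<lambda>x. f x ^ e)"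
  by (induction e) auto

lemma polyfun_sum [intro]: "(\<And>i. i \<in> A \<Longrightarrow> polyfun n (f i)) \<Longrightarrow> polyfun n (\<lambda>x. \<Sum>i\<in>A. f i x)"
  by (induction A rule: infinite_finite_induct) auto

lemma polyfun_prod [intro]: "(\<And>i. i \<in> A \<Longrightarrow> polyfun n (f i)) \<Longrightarrow> polyfun n (\<lambda>x. \<Prod>i\<in>A. f i x)"
  by (induction A rule: infinite_finite_induct) auto

lemma polyfun_meval:
  assumes "P \<in> first_vars (Suc n)"
  shows "polyfun n (meval P)"
proof -
  have "polyfun n (\<lambda>x. \<Sum>m\<in>Poly_Mapping.keys P. Poly_Mapping.lookup P m *
      (\<Prod>i\<in>Poly_Mapping.keys m. x i ^ Poly_Mapping.lookup m i))"
    using assms by (intro polyfun_sum polyfun.mult polyfun.const polyfun_prod polyfun_power polyfun.coord)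
      (auto simp: first_vars_def subset_iff less_Suc_eq_le)
  then show ?thesis by (simp add: meval_def[abs_def])
qed

lemma polyfun_meval_ex: "polyfun n f \<Longrightarrow> \<exists>P\<in>first_vars (Suc n). f = meval P"
proof (induction rule: polyfun.induct)
  case (const c)
  then show ?case
    by (intro bexI[of _ "Poly_Mapping.single 0 c"]) (auto simp: meval_single)
next
  case (coord i)
  then show ?case by (intro bexI[of _ "mvar i"]) (auto simp: first_vars_mvar)
next
  case (add f g)
  then obtain P Q where "P \<in> first_vars (Suc n)" "Q \<in> first_vars (Suc n)" "f = meval P" "g = meval Q" by blast
  then show ?case by (intro bexI[of _ "P + Q"]) (auto simp: first_vars_add)
next
  case (mult f g)
  then obtain P Q where "P \<in> first_vars (Suc n)" "Q \<in> first_vars (Suc n)" "f = meval P" "g = meval Q" by blast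
  then show ?case by (intro bexI[of _ "P * Q"]) (auto simp: first_vars_mult)
qed

lemma polyfun_mult_eq_0:
  assumes "polyfun n f" "polyfun n g" "\<And>x. f x * g x = 0"
  shows "(\<forall>x. f x = 0) \<or> (\<forall>x. g x = 0)"
proof -
  obtain P Q where PQ: "f = meval P" "g = meval Q" using polyfun_meval_ex assms(1,2) by metis
  then have "\<forall>x. meval (P * Q) x = meval 0 x" using assms(3) by simp
  then have "P * Q = 0" using meval_eq_iff by blast
  then show ?thesis using PQ by auto
qed

lemma polyfun_cong:
  assumes "polyfun n f" "\<And>i. i \<le> n \<Longrightarrow> x i = y i"
  shows "f x = f y"
  using assms by (induction rule: polyfun.induct) auto

lemma polyfun_comp:
  assumes "polyfun m f" "\<And>i. i \<le> m \<Longrightarrow> polyfun n (\<lambda>x. g x i)"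
  shows "polyfun n (\<lambda>x. f (g x))"
  using assms by (induction rule: polyfun.induct) auto

section \<open>Restriction to lines and directional derivatives\<close>

text \<open>The description is unique because a polynomial over an infinite field is determined by
  its values; for polynomial functions such a polynomial exists.\<close>

definition tay :: "((nat \<Rightarrow> 'k::field_char_0) \<Rightarrow> 'k) \<Rightarrow> (nat \<Rightarrow> 'k) \<Rightarrow> (nat \<Rightarrow> 'k) \<Rightarrow> 'k poly" where
  "tay f p w = (THE P. \<forall>t. poly P t = f (p + t \<cdot> w))"

lemma tay_eqI: "(\<And>t. poly P t = f (p + t \<cdot> w)) \<Longrightarrow> tay f p w = P"
  unfolding tay_def by (rule the_equality) (auto simp flip: poly_eq_poly_eq_iff)

lemma poly_tay:
  assumes "polyfun n f"
  shows "poly (tay f p w) t = f (p + t \<cdot> w)"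
proof -
  have "\<exists>P. \<forall>t. poly P t = f (p + t \<cdot> w)"
    using assms
  proof (induction rule: polyfun.induct)
    case (const c)
    show ?case by (rule exI[of _ "[:c:]"]) simp
  next
    case (coord i)
    show ?case by (rule exI[of _ "[:p i, w i:]"]) simp
  next
    case (add f g)
    then show ?case by (metis poly_add)
  next
    case (mult f g)
    then show ?case by (metis poly_mult)
  qed
  then show ?thesis using tay_eqI by metis
qed

lemma tay_const [simp]: "tay (\<lambda>_. c) p w = [:c:]"
  by (rule tay_eqI) simp

lemma tay_coord [simp]: "tay (\<lambda>x. x i) p w = [:p i, w i:]"
  by (rule tay_eqI) simp

lemma tay_add: "polyfun n f \<Longrightarrow> polyfun n g \<Longrightarrow> tay (\<lambda>x. f x + g x) p w = tay f p w + tay g p w"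
  by (rule tay_eqI) (simp add: poly_tay)

lemma tay_mult: "polyfun n f \<Longrightarrow> polyfun n g \<Longrightarrow> tay (\<lambda>x. f x * g x) p w = tay f p w * tay g p w"
  by (rule tay_eqI) (simp add: poly_tay)

lemma coeff_0_tay: "polyfun n f \<Longrightarrow> coeff (tay f p w) 0 = f p"
proof -
  assume "polyfun n f"
  have "p + 0 \<cdot> w = p" by (simp add: fun_eq_iff)
  then show ?thesis using poly_tay[OF \<open>polyfun n f\<close>, of p w 0] by (simp add: poly_0_coeff_0)
qed

definition dd :: "(nat \<Rightarrow> 'k::field_char_0) \<Rightarrow> ((nat \<Rightarrow> 'k) \<Rightarrow> 'k) \<Rightarrow> (nat \<Rightarrow> 'k) \<Rightarrow> 'k" where
  "dd w f p = coeff (tay f p w) 1"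

lemma dd_const [simp]: "dd w (\<lambda>_. c) = (\<lambda>_. 0)"
  by (simp add: dd_def fun_eq_iff)

lemma dd_coord [simp]: "dd w (\<lambda>x. x i) = (\<lambda>_. w i)"
  by (simp add: dd_def fun_eq_iff)

lemma dd_add: "polyfun n f \<Longrightarrow> polyfun n g \<Longrightarrow> dd w (\<lambda>x. f x + g x) = (\<lambda>x. dd w f x + dd w g x)"
  by (simp add: dd_def fun_eq_iff tay_add)

lemma dd_mult:
  assumes "polyfun n f" "polyfun n g"
  shows "dd w (\<lambda>x. f x * g x) = (\<lambda>x. dd w f x * g x + f x * dd w g x)"
proof -
  have "coeff (p * q) 1 = coeff p 1 * coeff q 0 + coeff p 0 * coeff q 1" for p q :: "'a poly"
    by (simp add: coeff_mult)
  then show ?thesis using assms by (simp add: dd_def fun_eq_iff tay_mult coeff_0_tay)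
qed

lemma polyfun_dd [intro]: "polyfun n f \<Longrightarrow> polyfun n (dd w f)"
proof (induction rule: polyfun.induct)
  case (add f g)
  then show ?case by (auto simp: dd_add)
next
  case (mult f g)
  then show ?case by (auto simp: dd_mult)
qed auto

lemma dd_dir_add: "polyfun n f \<Longrightarrow> dd (u + w) f x = dd u f x + dd w f x"
  by (induction arbitrary: x rule: polyfun.induct) (auto simp: dd_add dd_mult algebra_simps)

lemma dd_dir_scl: "polyfun n f \<Longrightarrow> dd (c \<cdot> w) f x = c * dd w f x"
  by (induction arbitrary: x rule: polyfun.induct) (auto simp: dd_add dd_mult algebra_simps)

lemma dd_dir_0: "polyfun n f \<Longrightarrow> dd 0 f x = 0"
  using dd_dir_scl[of n f 0 0 x] by (simp add: scl_def zero_fun_def)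

lemma dd_commute: "polyfun n f \<Longrightarrow> dd u (dd w f) = dd w (dd u f)"
proof (induction rule: polyfun.induct)
  case (add f g)
  then show ?case by (simp add: dd_add[of n] polyfun_dd)
next
  case (mult f g)
  then show ?case
    by (simp add: dd_mult[of n] dd_add[of n] polyfun_dd polyfun.mult) (simp add: algebra_simps)
qed auto

lemma dd_cong:
  assumes "polyfun n f" "\<And>i. i \<le> n \<Longrightarrow> u i = w i"
  shows "dd u f x = dd w f x"
  using assms by (induction arbitrary: x rule: polyfun.induct) (auto simp: dd_add[of n] dd_mult[of n])

lemma pderiv_tay: "polyfun n f \<Longrightarrow> pderiv (tay f p w) = tay (dd w f) p w"
proof (induction rule: polyfun.induct)
  case (add f g)
  then show ?case by (simp add: tay_add[of n] dd_add[of n] pderiv_add polyfun_dd)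
next
  case (mult f g)
  then show ?case
    by (simp add: tay_mult[of n] tay_add[of n] dd_mult[of n] pderiv_mult polyfun_dd polyfun.mult)
qed (auto simp: pderiv_pCons)

lemma coeff_2_tay: "polyfun n f \<Longrightarrow> coeff (tay f p w) 2 = dd w (dd w f) p / 2"
  unfolding dd_def[of w "dd w f"]
  by (simp add: coeff_pderiv numeral_2_eq_2 flip: pderiv_tay)

lemma poly_eq_0_if_derivatives_0:
  fixes P :: "'k::field_char_0 poly"
  assumes "\<And>j. poly ((pderiv ^^ j) P) 0 = 0"
  shows "P = 0"
  using assms
proof (induction "degree P" arbitrary: P rule: less_induct)
  case less
  have "pderiv P = 0"
  proof (cases "degree P = 0")
    case False
    then have "degree (pderiv P) < degree P" by (simp add: degree_pderiv)
    moreover have "poly ((pderiv ^^ j) (pderiv P)) 0 = 0" for j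
      using less.prems[of "Suc j"] by (simp add: funpow_swap1)
    ultimately show ?thesis using less.hyps by blast
  qed (auto elim!: degree_eq_zeroE simp: pderiv_pCons)
  then obtain c where "P = [:c:]" by (metis pderiv_eq_0_iff degree_eq_zeroE)
  then show ?case using less.prems[of 0] by simp
qed

lemma polyfun_eq_0_on_line:
  assumes "polyfun n f" "\<And>j. (dd w ^^ j) f p = 0"
  shows "f (p + t \<cdot> w) = 0"
proof -
  have pf: "polyfun n ((dd w ^^ j) f)" for j
    by (induction j) (use assms(1) in auto)
  have "(pderiv ^^ j) (tay f p w) = tay ((dd w ^^ j) f) p w" for j
    by (induction j) (use pf in \<open>auto simp: pderiv_tay[of n]\<close>)
  then have "poly ((pderiv ^^ j) (tay f p w)) 0 = 0" for j
    using coeff_0_tay[OF pf] assms(2) by (simp add: poly_0_coeff_0)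
  then have "tay f p w = 0" by (rule poly_eq_0_if_derivatives_0)
  then show ?thesis using poly_tay[OF assms(1), of p w t] by simp
qed

lemma dd_eq_0_of_line:
  assumes "polyfun n f" "\<And>t. f (p + t \<cdot> w) = 0"
  shows "dd w f p = 0" "dd w (dd w f) p = 0"
proof -
  have "tay f p w = 0" by (rule tay_eqI) (use assms in auto)
  then show "dd w f p = 0" "dd w (dd w f) p = 0"
    using coeff_2_tay[OF assms(1), of p w] by (auto simp: dd_def)
qed

lemma dd_expand:
  assumes "polyfun n f"
  shows "dd w f p = (\<Sum>i\<le>n. w i * dd (\<lambda>j. if j = i then 1 else 0) f p)"
proof -
  have "dd (\<lambda>j. \<Sum>i\<in>A. w i * (if j = i then 1 else 0)) f p = (\<Sum>i\<in>A. w i * dd (\<lambda>j. if j = i then 1 else 0) f p)"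
    if "finite A" for A
    using that
  proof (induction A)
    case empty
    then show ?case using dd_dir_0[OF assms, of p] by (simp add: zero_fun_def)
  next
    case (insert a A)
    let ?e = "\<lambda>i j. if j = i then 1 else (0::'a)"
    have "(\<lambda>j. \<Sum>i\<in>insert a A. w i * ?e i j) = w a \<cdot> ?e a + (\<lambda>j. \<Sum>i\<in>A. w i * ?e i j)"
      using insert by (simp add: fun_eq_iff)
    then show ?case using insert dd_dir_add[OF assms] dd_dir_scl[OF assms] by simp
  qed
  then have "dd (\<lambda>j. \<Sum>i\<le>n. w i * (if j = i then 1 else 0)) f p = (\<Sum>i\<le>n. w i * dd (\<lambda>j. if j = i then 1 else 0) f p)"
    by blast
  moreover have "w i * (if j = i then 1 else 0) = (if j = i then w i else 0)" for i j
    by simp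
  then have "dd w f p = dd (\<lambda>j. \<Sum>i\<le>n. w i * (if j = i then 1 else 0)) f p"
    by (intro dd_cong[OF assms]) simp
  ultimately show ?thesis by simp
qed

section \<open>Homogeneous functions\<close>

definition homog :: "nat \<Rightarrow> ((nat \<Rightarrow> 'k::field_char_0) \<Rightarrow> 'k) \<Rightarrow> bool" where
  "homog m f \<longleftrightarrow> (\<forall>c x. f (c \<cdot> x) = c ^ m * f x)"

lemma tay_0_homog:
  assumes "polyfun n f" "\<And>c x. c \<noteq> 0 \<Longrightarrow> f (c \<cdot> x) = c ^ m * f x"
  shows "tay f 0 x = monom (f x) m"
proof -
  \<comment> \<open>The factor \<open>[:0, 1:]\<close> makes both sides agree at
    \<open>c = 0\<close>, where the hypothesis says nothing.\<close>
  have "poly ([:0, 1:] * tay f 0 x) c = poly ([:0, 1:] * monom (f x) m) c" for c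
    using assms(2)[of c x] by (cases "c = 0") (auto simp: poly_tay[OF assms(1)] poly_monom mult.commute)
  then have "[:0, 1:] * tay f 0 x = [:0, 1:] * monom (f x) m"
    using poly_eq_poly_eq_iff by blast
  then show ?thesis by simp
qed

lemma homogI:
  assumes "polyfun n f" "\<And>c x. c \<noteq> 0 \<Longrightarrow> f (c \<cdot> x) = c ^ m * f x"
  shows "homog m f"
  unfolding homog_def
proof (intro allI)
  fix c x
  show "f (c \<cdot> x) = c ^ m * f x"
    using poly_tay[OF assms(1), of 0 x c] tay_0_homog[OF assms, of x] by (simp add: poly_monom mult.commute)
qed

text \<open>Along its own direction \<open>f\<close> is \<open>(1 + t) ^ m * f x\<close>; compare
  linear coefficients in \<open>t\<close>.\<close>

lemma euler:
  assumes "polyfun n f" "homog m f"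
  shows "dd x f x = of_nat m * f x"
proof -
  have "tay f x x = smult (f x) ([:1, 1:] ^ m)"
  proof (rule tay_eqI)
    fix t
    have "x + t \<cdot> x = (1 + t) \<cdot> x" by (simp add: fun_eq_iff algebra_simps)
    then show "poly (smult (f x) ([:1, 1:] ^ m)) t = f (x + t \<cdot> x)"
      using assms(2) by (simp add: homog_def mult.commute)
  qed
  then have "poly (pderiv (tay f x x)) 0 = of_nat m * f x"
    by (simp only: pderiv_smult pderiv_power) (simp add: pderiv_pCons)
  then show ?thesis by (simp add: dd_def poly_0_coeff_0 coeff_pderiv)
qed

lemma homog_dd:
  assumes "polyfun n f" "homog (Suc m) f"
  shows "homog m (dd v f)"
proof (rule homogI)
  fix c :: 'a and x assume "c \<noteq> 0"
  have "tay f (c \<cdot> x) v = smult (c ^ Suc m) (pcompose (tay f x v) [:0, inverse c:])"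
  proof (rule tay_eqI)
    fix t
    have "c \<cdot> x + t \<cdot> v = c \<cdot> (x + (t * inverse c) \<cdot> v)"
      using \<open>c \<noteq> 0\<close> by (simp add: fun_eq_iff algebra_simps)
    then show "poly (smult (c ^ Suc m) (pcompose (tay f x v) [:0, inverse c:])) t = f (c \<cdot> x + t \<cdot> v)"
      using assms(2) by (simp add: homog_def poly_pcompose poly_tay[OF assms(1)])
  qed
  then have "pderiv (tay f (c \<cdot> x) v) =
      smult (c ^ Suc m) (pcompose (pderiv (tay f x v)) [:0, inverse c:] * [:inverse c:])"
    by (simp add: pderiv_smult pderiv_pcompose pderiv_pCons)
  then have "poly (pderiv (tay f (c \<cdot> x) v)) 0 = c ^ m * poly (pderiv (tay f x v)) 0"
    using \<open>c \<noteq> 0\<close> by (simp add: poly_pcompose)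
  then show "dd v f (c \<cdot> x) = c ^ m * dd v f x"
    by (simp add: dd_def poly_0_coeff_0 coeff_pderiv)
qed (use assms in auto)

text \<open>On the ray through \<open>x\<close> the left side is a monomial of degree
  \<open>m\<close> in the parameter, while the right side is divisible by the power
  \<open>d > m\<close> of it.\<close>

lemma homog_multiple_eq_0:
  assumes "polyfun n f" "homog m f" "polyfun n F" "homog d F" "polyfun n Q" "m < d"
    and "\<And>x. f x = F x * Q x"
  shows "f x = 0"
proof -
  have "monom (f x) m = monom (F x) d * tay Q 0 x"
  proof -
    have "tay f 0 x = tay (\<lambda>x. F x * Q x) 0 x" using assms(7) by presburger
    also have "\<dots> = tay F 0 x * tay Q 0 x" by (rule tay_mult[OF assms(3,5)])
    finally show ?thesis
      using tay_0_homog[OF assms(1), of m x] tay_0_homog[OF assms(3), of d x] assms(2,4)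
      by (simp add: homog_def)
  qed
  then have "coeff (monom (f x) m) m = coeff (monom (F x) d * tay Q 0 x) m" by simp
  then show ?thesis using assms(6) by (simp add: coeff_monom_mult)
qed

text \<open>Division with remainder: for linear \<open>l\<close> with \<open>l e = 1\<close>, the
  map \<open>x - l x \<cdot> e\<close> projects onto the kernel of \<open>l\<close>. The quotient is
  built along the rules for \<open>polyfun\<close>, with the product rule for differences.\<close>

lemma polyfun_divide_linear:
  assumes "polyfun n f" "polyfun n l"
  shows "\<exists>Q. polyfun n Q \<and> (\<forall>x. f x - f (x - l x \<cdot> e) = l x * Q x)"
  using assms(1)
proof (induction rule: polyfun.induct)
  case (const c)
  then show ?case by (intro exI[of _ "\<lambda>_. 0"]) auto
next
  case (coord i)
  then show ?case by (intro exI[of _ "\<lambda>_. e i"]) auto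
next
  case (add f g)
  then obtain P Q where PQ: "polyfun n P" "polyfun n Q" "\<And>x. f x - f (x - l x \<cdot> e) = l x * P x"
      "\<And>x. g x - g (x - l x \<cdot> e) = l x * Q x" by blast
  have "f x + g x - (f (x - l x \<cdot> e) + g (x - l x \<cdot> e)) = l x * (P x + Q x)" for x
    by (simp only: distrib_left flip: PQ(3,4)) simp
  then show ?case using PQ(1,2) polyfun.add[of n P Q] by blast
next
  case (mult f g)
  then obtain P Q where PQ: "polyfun n P" "polyfun n Q" "\<And>x. f x - f (x - l x \<cdot> e) = l x * P x"
      "\<And>x. g x - g (x - l x \<cdot> e) = l x * Q x" by blast
  have pf: "polyfun n (\<lambda>x. f (x - l x \<cdot> e))"
    by (rule polyfun_comp[OF mult.hyps(1)]) (use assms(2) in \<open>simp add: polyfun_diff polyfun.mult polyfun.coord\<close>)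
  have "f x * g x - f (x - l x \<cdot> e) * g (x - l x \<cdot> e) = l x * (P x * g x + f (x - l x \<cdot> e) * Q x)" for x
  proof -
    have "f x * g x - f (x - l x \<cdot> e) * g (x - l x \<cdot> e) =
        (f x - f (x - l x \<cdot> e)) * g x + f (x - l x \<cdot> e) * (g x - g (x - l x \<cdot> e))"
      by (simp add: algebra_simps)
    then show ?thesis unfolding PQ by (simp add: algebra_simps)
  qed
  moreover have "polyfun n (\<lambda>x. P x * g x + f (x - l x \<cdot> e) * Q x)"
    by (intro polyfun.add polyfun.mult pf PQ(1,2) mult.hyps)
  ultimately show ?case by blast
qed

section \<open>Places on rings of functions\<close>

text \<open>A relation \<open>G\<close> is read as a homomorphism to \<open>'k\<close> on a ring of functions restricted
  to \<open>S\<close>; single-valuedness follows from the last clause.\<close>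

definition partial_hom :: "'a set \<Rightarrow> (('a \<Rightarrow> 'k::field_char_0) \<times> 'k) set \<Rightarrow> bool" where
  "partial_hom S G \<longleftrightarrow> (\<forall>c. ((\<lambda>_. c), c) \<in> G) \<and>
     (\<forall>f a g b. (f, a) \<in> G \<longrightarrow> (g, b) \<in> G \<longrightarrow>
        ((\<lambda>x. f x + g x), a + b) \<in> G \<and> ((\<lambda>x. f x * g x), a * b) \<in> G) \<and>
     (\<forall>f a. (f, a) \<in> G \<longrightarrow> (\<forall>x\<in>S. f x = 0) \<longrightarrow> a = 0)"

lemma partial_hom_const: "partial_hom S G \<Longrightarrow> ((\<lambda>_. c), c) \<in> G"
  and partial_hom_add: "partial_hom S G \<Longrightarrow> (f, a) \<in> G \<Longrightarrow> (g, b) \<in> G \<Longrightarrow> ((\<lambda>x. f x + g x), a + b) \<in> G"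
  and partial_hom_mult: "partial_hom S G \<Longrightarrow> (f, a) \<in> G \<Longrightarrow> (g, b) \<in> G \<Longrightarrow> ((\<lambda>x. f x * g x), a * b) \<in> G"
  and partial_hom_zero: "partial_hom S G \<Longrightarrow> (f, a) \<in> G \<Longrightarrow> (\<And>x. x \<in> S \<Longrightarrow> f x = 0) \<Longrightarrow> a = 0"
  unfolding partial_hom_def by blast+

lemma partial_hom_cmult: "partial_hom S G \<Longrightarrow> (f, a) \<in> G \<Longrightarrow> ((\<lambda>x. c * f x), c * a) \<in> G"
  using partial_hom_mult[OF _ partial_hom_const] by blast

lemma partial_hom_uminus: "partial_hom S G \<Longrightarrow> (f, a) \<in> G \<Longrightarrow> ((\<lambda>x. - f x), - a) \<in> G"
  using partial_hom_cmult[of S G f a "-1"] by simp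

lemma partial_hom_diff:
  "partial_hom S G \<Longrightarrow> (f, a) \<in> G \<Longrightarrow> (g, b) \<in> G \<Longrightarrow> ((\<lambda>x. f x - g x), a - b) \<in> G"
  using partial_hom_add[of S G f a "\<lambda>x. - g x" "- b"] partial_hom_uminus[of S G g b] by simp

lemma partial_hom_sum:
  assumes "partial_hom S G" "finite A" "\<And>i. i \<in> A \<Longrightarrow> (f i, a i) \<in> G"
  shows "((\<lambda>x. \<Sum>i\<in>A. f i x), \<Sum>i\<in>A. a i) \<in> G"
  using assms(2,3)
  by (induction A) (auto simp: partial_hom_const[OF assms(1)] intro!: partial_hom_add[OF assms(1)])

lemma partial_hom_unique:
  assumes "partial_hom S G" "(f, a) \<in> G" "(g, b) \<in> G" "\<And>x. x \<in> S \<Longrightarrow> f x = g x"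
  shows "a = b"
  using partial_hom_zero[OF assms(1) partial_hom_diff[OF assms(1-3)]] assms(4) by simp

text \<open>The ring generated by \<open>f\<close> over the domain of \<open>G\<close>, with the
  value of \<open>f\<close> left open: \<open>(g, B)\<close> records an expression of
  \<open>g\<close> as a polynomial in \<open>f\<close>, and \<open>B\<close> is that polynomial with
  its coefficients replaced by their values. One function may occur with several
  \<open>B\<close>.\<close>

inductive_set adjoin for G :: "(('a \<Rightarrow> 'k::field_char_0) \<times> 'k) set" and f :: "'a \<Rightarrow> 'k" where
  base: "(h, b) \<in> G \<Longrightarrow> (h, [:b:]) \<in> adjoin G f"
| step: "(g, B) \<in> adjoin G f \<Longrightarrow> (h, b) \<in> G \<Longrightarrow> ((\<lambda>x. h x + f x * g x), pCons b B) \<in> adjoin G f"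

context
  fixes S :: "'a set" and G :: "(('a \<Rightarrow> 'k::field_char_0) \<times> 'k) set" and f :: "'a \<Rightarrow> 'k"
  assumes G: "partial_hom S G"
begin

lemma adjoin_coeffs:
  "(g, B) \<in> adjoin G f \<Longrightarrow>
    \<exists>N a. (\<forall>i. (a i, coeff B i) \<in> G) \<and> (\<forall>x. g x = (\<Sum>i\<le>N. a i x * f x ^ i))"
proof (induction rule: adjoin.induct)
  case (base h b)
  then show ?case
    by (intro exI[of _ 0] exI[of _ "\<lambda>i. if i = 0 then h else (\<lambda>_. 0)"])
       (auto simp: coeff_pCons partial_hom_const[OF G] split: nat.split)
next
  case (step g B h b)
  then obtain N a where "\<forall>i. (a i, coeff B i) \<in> G" "\<forall>x. g x = (\<Sum>i\<le>N. a i x * f x ^ i)" by blast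
  then show ?case using step
    by (intro exI[of _ "Suc N"] exI[of _ "\<lambda>i. case i of 0 \<Rightarrow> h | Suc j \<Rightarrow> a j"])
       (auto simp: coeff_pCons sum.atMost_Suc_shift sum_distrib_left algebra_simps split: nat.split
         simp del: sum.atMost_Suc)
qed

lemma adjoin_add:
  "(g, B) \<in> adjoin G f \<Longrightarrow> (g', B') \<in> adjoin G f \<Longrightarrow> ((\<lambda>x. g x + g' x), B + B') \<in> adjoin G f"
proof (induction arbitrary: g' B' rule: adjoin.induct)
  case (base h b)
  from base(2) show ?case
  proof cases
    case (base b')
    then show ?thesis
      using adjoin.base[OF partial_hom_add[OF G \<open>(h, b) \<in> G\<close>, of g' b']] by simp
  next
    case (step g1 B1 h' b')
    then show ?thesis
      using adjoin.step[OF step(3) partial_hom_add[OF G \<open>(h, b) \<in> G\<close> step(4)]]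
      by (simp add: add.assoc)
  qed
next
  case (step g B h b)
  note IH = step.IH and hb = \<open>(h, b) \<in> G\<close> and gB = \<open>(g, B) \<in> adjoin G f\<close>
  from step.prems show ?case
  proof cases
    case (base b')
    then show ?thesis
      using adjoin.step[OF gB partial_hom_add[OF G hb, of g' b']] by (simp add: ac_simps)
  next
    case (step g1 B1 h' b')
    then show ?thesis
      using adjoin.step[OF IH[OF step(3)] partial_hom_add[OF G hb step(4)]]
      by (simp add: algebra_simps)
  qed
qed

lemma adjoin_smult:
  assumes "(h, b) \<in> G"
  shows "(g, B) \<in> adjoin G f \<Longrightarrow> ((\<lambda>x. h x * g x), smult b B) \<in> adjoin G f"
proof (induction rule: adjoin.induct)
  case (base h' b')
  then show ?case using adjoin.base[OF partial_hom_mult[OF G assms base]] by simp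
next
  case (step g B h' b')
  then show ?case
    using adjoin.step[OF step.IH partial_hom_mult[OF G assms step(2)]] by (simp add: algebra_simps)
qed

lemma adjoin_mult:
  "(g, B) \<in> adjoin G f \<Longrightarrow> (g', B') \<in> adjoin G f \<Longrightarrow> ((\<lambda>x. g x * g' x), B * B') \<in> adjoin G f"
proof (induction rule: adjoin.induct)
  case (base h b)
  then show ?case using adjoin_smult by simp
next
  case (step g B h b)
  have "((\<lambda>x. 0 + f x * (g x * g' x)), pCons 0 (B * B')) \<in> adjoin G f"
    by (rule adjoin.step[OF step.IH[OF step.prems] partial_hom_const[OF G]])
  from adjoin_add[OF adjoin_smult[OF step(2) step.prems] this]
  show ?case by (simp add: algebra_simps)
qed

lemma adjoin_poly: "((\<lambda>x. poly C (f x)), C) \<in> adjoin G f"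
proof (induction C)
  case 0
  show ?case using adjoin.base[OF partial_hom_const[OF G, of 0]] by simp
next
  case (pCons c C)
  then show ?case using adjoin.step[OF pCons(2) partial_hom_const[OF G, of c]] by simp
qed

text \<open>The polynomials attached to functions that vanish on \<open>S\<close> form an ideal. A
  common root \<open>c\<close> would allow the value \<open>c\<close> for \<open>f\<close>, against
  maximality. Over an algebraically closed field the ideal therefore contains 1, which is the
  asserted relation.\<close>

lemma adjoin_extend:
  assumes alg: "alg_closed_field TYPE('k)"
    and max: "\<And>G'. partial_hom S G' \<Longrightarrow> G \<subseteq> G' \<Longrightarrow> G' = G"
    and "\<nexists>c. (f, c) \<in> G"
  shows "\<exists>N a. (\<forall>i. (a i, if i = 0 then 1 else 0) \<in> G) \<and> (\<forall>x\<in>S. (\<Sum>i\<le>N. a i x * f x ^ i) = 0)"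
proof -
  define I where "I = {B. \<exists>g. (g, B) \<in> adjoin G f \<and> (\<forall>x\<in>S. g x = 0)}"
  have noroot: "\<exists>B\<in>I. poly B c \<noteq> 0" for c
  proof (rule ccontr)
    assume "\<not> (\<exists>B\<in>I. poly B c \<noteq> 0)"
    then have root: "poly B c = 0" if "(g, B) \<in> adjoin G f" "\<forall>x\<in>S. g x = 0" for g B
      using that unfolding I_def by blast
    define G' where "G' = {(g, poly B c) |g B. (g, B) \<in> adjoin G f}"
    have "partial_hom S G'"
      unfolding partial_hom_def
    proof (intro conjI allI impI)
      fix b show "((\<lambda>_. b), b) \<in> G'"
        unfolding G'_def using adjoin.base[OF partial_hom_const[OF G, of b]] by force
    next
      fix g a g' b assume "(g, a) \<in> G'" "(g', b) \<in> G'"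
      then obtain A B where "(g, A) \<in> adjoin G f" "(g', B) \<in> adjoin G f" "a = poly A c" "b = poly B c"
        unfolding G'_def by blast
      then show "((\<lambda>x. g x + g' x), a + b) \<in> G'" "((\<lambda>x. g x * g' x), a * b) \<in> G'"
        unfolding G'_def using adjoin_add[of g A g' B] adjoin_mult[of g A g' B] by force+
    next
      fix g a assume "(g, a) \<in> G'" "\<forall>x\<in>S. g x = 0"
      then show "a = 0" unfolding G'_def using root by blast
    qed
    moreover have "G \<subseteq> G'" unfolding G'_def using adjoin.base[of _ _ G f] by force
    ultimately have "G' = G" by (rule max)
    moreover have "((\<lambda>x. poly [:0, 1:] (f x)), poly [:0, 1:] c) \<in> G'"
      unfolding G'_def using adjoin_poly[of "[:0, 1:]"] by blast
    ultimately show False using assms(3) by auto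
  qed
  have I_comb: "C * B \<in> I" "B + B' \<in> I" if B: "B \<in> I" "B' \<in> I" for B B' C
  proof -
    obtain g g' where g: "(g, B) \<in> adjoin G f" "\<forall>x\<in>S. g x = 0" "(g', B') \<in> adjoin G f" "\<forall>x\<in>S. g' x = 0"
      using B unfolding I_def by blast
    show "B + B' \<in> I" using adjoin_add[OF g(1,3)] g unfolding I_def by auto
    show "C * B \<in> I" using adjoin_mult[OF adjoin_poly[of C] g(1)] g unfolding I_def by auto
  qed
  obtain B where B: "B \<in> I" "B \<noteq> 0" using noroot[of 0] by force
  obtain M where M: "M \<in> I" "M \<noteq> 0" "\<And>B'. B' \<in> I \<Longrightarrow> B' \<noteq> 0 \<Longrightarrow> degree M \<le> degree B'"
    using arg_min_nat_lemma[of "\<lambda>B. B \<in> I \<and> B \<noteq> 0" B degree] B by blast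
  have div: "M dvd B'" if B': "B' \<in> I" for B'
  proof -
    have "B' mod M = B' + (- (B' div M)) * M" by (simp add: minus_div_mult_eq_mod[symmetric])
    then have "B' mod M \<in> I" using I_comb B' M(1) by metis
    then have "B' mod M = 0" using M degree_mod_less'[of M B'] by (metis leD)
    then show ?thesis by auto
  qed
  have "degree M = 0"
  proof (rule ccontr)
    assume "degree M \<noteq> 0"
    then obtain c where "poly M c = 0" using alg unfolding alg_closed_field_def by force
    then show False using noroot[of c] div by (meson poly_eq_0_iff_dvd dvd_trans)
  qed
  then obtain m where m: "M = [:m:]" by (metis degree_eq_zeroE)
  then have "[:inverse m:] * M = 1" using M by simp
  then have "1 \<in> I" using I_comb(1)[OF M(1) M(1), of "[:inverse m:]"] by simp
  then obtain g where g: "(g, 1) \<in> adjoin G f" "\<forall>x\<in>S. g x = 0" unfolding I_def by blast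
  obtain N a where a: "\<forall>i. (a i, coeff 1 i) \<in> G" "\<forall>x. g x = (\<Sum>i\<le>N. a i x * f x ^ i)"
    using adjoin_coeffs[OF g(1)] by blast
  have "coeff 1 i = (if i = 0 then 1 else 0 :: 'k)" for i by simp
  then have "\<forall>i. (a i, if i = 0 then 1 else 0) \<in> G" using a(1) by metis
  moreover have "\<forall>x\<in>S. (\<Sum>i\<le>N. a i x * f x ^ i) = 0" using a(2) g(2) by metis
  ultimately show ?thesis by blast
qed

end

text \<open>The relation \<open>(\<Sum>i\<le>N. a i * f ^ i) = 0\<close> with \<open>a 0\<close> sent to 1 and all other \<open>a i\<close> sent
  to 0 obstructs any finite value at \<open>f\<close>.\<close>

definition obstructed :: "'a set \<Rightarrow> (('a \<Rightarrow> 'k::field_char_0) \<times> 'k) set \<Rightarrow> ('a \<Rightarrow> 'k) \<Rightarrow> nat \<Rightarrow> bool" where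
  "obstructed S G f N \<longleftrightarrow> (\<exists>a. (\<forall>i. (a i, if i = 0 then 1 else 0) \<in> G) \<and>
     (\<forall>x\<in>S. (\<Sum>i\<le>N. a i x * f x ^ i) = 0))"

lemma obstructed_pos: "partial_hom S G \<Longrightarrow> obstructed S G f N \<Longrightarrow> N > 0"
proof (rule ccontr)
  assume G: "partial_hom S G" and o: "obstructed S G f N" and "\<not> N > 0"
  then have "N = 0" by simp
  obtain a where a: "\<And>i. (a i, if i = 0 then 1 else 0) \<in> G"
      "\<And>x. x \<in> S \<Longrightarrow> (\<Sum>i\<le>N. a i x * f x ^ i) = 0"
    using o unfolding obstructed_def by blast
  have "(a 0, 1) \<in> G" using a(1)[of 0] by simp
  then show False using partial_hom_zero[OF G] a(2) \<open>N = 0\<close> by fastforce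
qed

text \<open>Chevalley's descent: the relation for \<open>f\<close> is multiplied by
  \<open>b 0\<close>, and its top term is rewritten with the relation for \<open>1 / f\<close>
  multiplied by \<open>f ^ N\<close>, which is possible as \<open>M \<le> N\<close>.\<close>

lemma obstructed_reduce:
  assumes G: "partial_hom S G" and f: "\<And>x. x \<in> S \<Longrightarrow> f x \<noteq> 0"
    and "obstructed S G f N" "obstructed S G (\<lambda>x. 1 / f x) M" "M \<le> N"
  shows "obstructed S G f (N - 1)"
proof -
  obtain a where a: "\<And>i. (a i, if i = 0 then 1 else 0) \<in> G"
      "\<And>x. x \<in> S \<Longrightarrow> (\<Sum>i\<le>N. a i x * f x ^ i) = 0"
    using assms(3) unfolding obstructed_def by blast
  obtain b where b: "\<And>i. (b i, if i = 0 then 1 else 0) \<in> G"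
      "\<And>x. x \<in> S \<Longrightarrow> (\<Sum>i\<le>M. b i x * (1 / f x) ^ i) = 0"
    using assms(4) unfolding obstructed_def by blast
  have pos: "N > 0" "M > 0" using obstructed_pos[OF G] assms(3,4) by auto
  \<comment> \<open>The coefficients after the rewriting. The subtracted products have value 0
    because \<open>a N\<close> has (\<open>N > 0\<close>), so \<open>c 0\<close> keeps the value
    1.\<close>
  define c where "c i = (\<lambda>x. a i x * b 0 x - (if N - M \<le> i \<and> i < N then a N x * b (N - i) x else 0))" for i
  have "(c i, if i = 0 then 1 else 0) \<in> G" for i
  proof -
    have 1: "((\<lambda>x. a i x * b 0 x), (if i = 0 then 1 else 0) * 1) \<in> G"
      using partial_hom_mult[OF G a(1)[of i] b(1)[of 0]] by simp
    have "((\<lambda>x. if N - M \<le> i \<and> i < N then a N x * b (N - i) x else 0), 0) \<in> G"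
    proof (cases "N - M \<le> i \<and> i < N")
      case True
      then show ?thesis using partial_hom_mult[OF G a(1)[of N] b(1)[of "N - i"]] pos by simp
    next
      case False
      then have "(\<lambda>x. if N - M \<le> i \<and> i < N then a N x * b (N - i) x else 0) = (\<lambda>_. 0)" by auto
      then show ?thesis using partial_hom_const[OF G, of 0] by metis
    qed
    from partial_hom_diff[OF G 1 this] show ?thesis unfolding c_def by simp
  qed
  moreover have "(\<Sum>i\<le>N - 1. c i x * f x ^ i) = 0" if x: "x \<in> S" for x
  proof -
    have split: "{..N} = insert N {..N - 1}" "N \<notin> {..N - 1}" using pos by auto
    have "0 = b 0 x * (\<Sum>i\<le>N. a i x * f x ^ i)" using a(2)[OF x] by simp
    also have "\<dots> = (\<Sum>i\<le>N - 1. a i x * b 0 x * f x ^ i) + a N x * (b 0 x * f x ^ N)"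
      unfolding split(1) using split(2) by (simp add: sum_distrib_left algebra_simps)
    also have "b 0 x * f x ^ N = - (\<Sum>j=1..M. b j x * f x ^ (N - j))"
    proof -
      have "0 = f x ^ N * (\<Sum>i\<le>M. b i x * (1 / f x) ^ i)" using b(2)[OF x] by simp
      also have "\<dots> = (\<Sum>i\<le>M. b i x * f x ^ (N - i))"
        unfolding sum_distrib_left
      proof (rule sum.cong)
        fix i assume "i \<in> {..M}"
        then have "f x ^ N = f x ^ (N - i) * f x ^ i" using assms(5) by (simp flip: power_add)
        then show "f x ^ N * (b i x * (1 / f x) ^ i) = b i x * f x ^ (N - i)"
          using f[OF x] by (simp add: power_one_over)
      qed simp
      also have "{..M} = insert 0 {1..M}" by auto
      finally show ?thesis by (simp add: eq_neg_iff_add_eq_0)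
    qed
    also have "(\<Sum>j=1..M. b j x * f x ^ (N - j)) = (\<Sum>i\<in>{N - M..<N}. b (N - i) x * f x ^ i)"
      by (rule sum.reindex_bij_witness[of _ "\<lambda>i. N - i" "\<lambda>j. N - j"]) (use assms(5) in auto)
    also have "a N x * - (\<Sum>i\<in>{N - M..<N}. b (N - i) x * f x ^ i) =
        - (\<Sum>i\<le>N - 1. (if N - M \<le> i \<and> i < N then a N x * b (N - i) x else 0) * f x ^ i)"
    proof -
      have "(\<Sum>i\<in>{N - M..<N}. a N x * b (N - i) x * f x ^ i) =
          (\<Sum>i\<le>N - 1. (if N - M \<le> i \<and> i < N then a N x * b (N - i) x else 0) * f x ^ i)"
        by (rule sum.mono_neutral_cong_left) (use pos in auto)
      then show ?thesis by (simp add: sum_distrib_left mult.assoc)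
    qed
    also have "(\<Sum>i\<le>N - 1. a i x * b 0 x * f x ^ i) +
        - (\<Sum>i\<le>N - 1. (if N - M \<le> i \<and> i < N then a N x * b (N - i) x else 0) * f x ^ i) =
        (\<Sum>i\<le>N - 1. c i x * f x ^ i)"
      by (simp add: c_def left_diff_distrib sum_subtractf)
    finally show ?thesis by simp
  qed
  ultimately show ?thesis unfolding obstructed_def by blast
qed

text \<open>The longer of the two relations can always be shortened, but neither can reach length
  0.\<close>

lemma obstructed_not_both:
  assumes G: "partial_hom S G" and f: "\<And>x. x \<in> S \<Longrightarrow> f x \<noteq> 0"
    and "obstructed S G f N" "obstructed S G (\<lambda>x. 1 / f x) M"
  shows False
  using assms(3,4)
proof (induction "N + M" arbitrary: N M rule: less_induct)
  case less
  have pos: "N > 0" "M > 0" using obstructed_pos[OF G] less.prems by auto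
  show ?case
  proof (cases "M \<le> N")
    case True
    then show ?thesis
      using less.hyps[of "N - 1" M] obstructed_reduce[OF G f less.prems] pos less.prems by auto
  next
    case False
    have "obstructed S G (\<lambda>x. 1 / (1 / f x)) N" using less.prems(1) by simp
    then have "obstructed S G (\<lambda>x. 1 / f x) (M - 1)"
      using obstructed_reduce[OF G, of "\<lambda>x. 1 / f x" M N] f less.prems(2) False by auto
    then show ?thesis using less.hyps[of N "M - 1"] pos less.prems by auto
  qed
qed

section \<open>Places\<close>

definition ind :: "'a set \<Rightarrow> 'a \<Rightarrow> 'k::field_char_0" where
  "ind N x = (if x \<in> N then 1 else 0)"

text \<open>The sets \<open>N\<close> with \<open>ind N\<close> of value 1 form an ultrafilter
  containing \<open>S\<close>, the functions that have a value play the role of a valuation ring,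
  and the relation is its residue map. The last clause says that a function without zeros on
  \<open>S\<close> is finite or has an infinitesimal reciprocal.\<close>

definition place :: "'a set \<Rightarrow> (('a \<Rightarrow> 'k::field_char_0) \<times> 'k) set \<Rightarrow> bool" where
  "place S G \<longleftrightarrow> partial_hom S G \<and>
     (\<forall>N. (ind N, 0) \<in> G \<or> (ind N, 1) \<in> G) \<and>
     (\<forall>N f. (ind N, 0) \<in> G \<longrightarrow> (\<forall>x\<in>S - N. f x = 0) \<longrightarrow> (f, 0) \<in> G) \<and>
     (\<forall>f. (\<forall>x\<in>S. f x \<noteq> 0) \<longrightarrow> (\<exists>c. (f, c) \<in> G) \<or> ((\<lambda>x. 1 / f x), 0) \<in> G)"

text \<open>A maximal homomorphism has all the properties: whatever has no value is obstructed by a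
  relation, and such a relation either yields a function that is zero on \<open>S\<close> but has
  value 1, or is excluded by the descent for \<open>f\<close> and \<open>1 / f\<close>.\<close>

theorem place_exists:
  fixes A :: "(('a \<Rightarrow> 'k::field_char_0) \<times> 'k) set"
  assumes alg: "alg_closed_field TYPE('k)" and A: "partial_hom S A"
  shows "\<exists>G. place S G \<and> A \<subseteq> G"
proof -
  define \<A> where "\<A> = {G. partial_hom S G \<and> A \<subseteq> G}"
  have "\<exists>G\<in>\<A>. \<forall>X\<in>\<A>. G \<subseteq> X \<longrightarrow> X = G"
  proof (rule subset_Zorn_nonempty)
    show "\<A> \<noteq> {}" using A unfolding \<A>_def by blast
    fix \<C> assume C: "\<C> \<noteq> {}" "subset.chain \<A> \<C>"
    have sub: "\<C> \<subseteq> \<A>" using C(2) by (auto simp: subset.chain_def)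
    have two: "\<exists>X\<in>\<C>. u \<in> X \<and> v \<in> X" if "u \<in> \<Union>\<C>" "v \<in> \<Union>\<C>" for u v
    proof -
      obtain X Y where XY: "X \<in> \<C>" "u \<in> X" "Y \<in> \<C>" "v \<in> Y" using \<open>u \<in> \<Union>\<C>\<close> \<open>v \<in> \<Union>\<C>\<close> by blast
      then have "X \<subseteq> Y \<or> Y \<subseteq> X" using C(2) by (auto simp: subset_chain_def)
      then show ?thesis using XY by blast
    qed
    have "partial_hom S (\<Union>\<C>)"
      unfolding partial_hom_def
    proof (intro conjI allI impI)
      fix c show "((\<lambda>_. c), c) \<in> \<Union>\<C>" using C(1) sub partial_hom_const unfolding \<A>_def by blast
    next
      fix f a g b assume "(f, a) \<in> \<Union>\<C>" "(g, b) \<in> \<Union>\<C>"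
      then obtain X where "X \<in> \<C>" "(f, a) \<in> X" "(g, b) \<in> X" using two by blast
      moreover have "partial_hom S X" using \<open>X \<in> \<C>\<close> sub unfolding \<A>_def by blast
      ultimately show "((\<lambda>x. f x + g x), a + b) \<in> \<Union>\<C>" "((\<lambda>x. f x * g x), a * b) \<in> \<Union>\<C>"
        using partial_hom_add partial_hom_mult by blast+
    next
      fix f a assume "(f, a) \<in> \<Union>\<C>" "\<forall>x\<in>S. f x = 0"
      then show "a = 0" using sub partial_hom_zero unfolding \<A>_def by blast
    qed
    then show "\<Union>\<C> \<in> \<A>" using C(1) sub unfolding \<A>_def by blast
  qed
  then obtain G where GA: "G \<in> \<A>" and max': "\<forall>X\<in>\<A>. G \<subseteq> X \<longrightarrow> X = G" ..
  have G: "partial_hom S G" "A \<subseteq> G" using GA by (simp_all add: \<A>_def)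
  have max: "G' = G" if "partial_hom S G'" "G \<subseteq> G'" for G'
    using max' that G(2) by (simp add: \<A>_def)
  have ext: "(\<exists>c. (f, c) \<in> G) \<or> (\<exists>N. obstructed S G f N)" for f
    using adjoin_extend[OF G(1) alg max, of f] unfolding obstructed_def by blast
  have compl: "((\<lambda>x. 1 - ind N x), 1) \<in> G" if "(ind N, 0) \<in> G" for N
    using partial_hom_diff[OF G(1) partial_hom_const[OF G(1), of 1] that] by simp
  have "(ind N, 0) \<in> G \<or> (ind N, 1) \<in> G" for N
  proof -
    consider c where "(ind N, c) \<in> G" | M where "obstructed S G (ind N) M" using ext by blast
    then show ?thesis
    proof cases
      case 1
      have "c * c = c"
        by (rule partial_hom_unique[OF G(1) partial_hom_mult[OF G(1) 1 1] 1]) (simp add: ind_def)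
      then show ?thesis using 1 by auto
    next
      case 2
      then obtain a where a: "\<And>i. (a i, if i = 0 then 1 else 0) \<in> G"
          "\<And>x. x \<in> S \<Longrightarrow> (\<Sum>i\<le>M. a i x * ind N x ^ i) = 0"
        unfolding obstructed_def by blast
      \<comment> \<open>This product has value 1 and yet vanishes on \<open>S\<close>: on
        \<open>N\<close> the relation says that the sum is zero, off \<open>N\<close> that
        \<open>a 0\<close> is.\<close>
      have "((\<lambda>x. a 0 x * (\<Sum>i\<le>M. a i x)), 1 * (\<Sum>i\<le>M. if i = 0 then 1 else 0)) \<in> G"
        by (intro partial_hom_mult[OF G(1)] partial_hom_sum[OF G(1)]) (use a(1) a(1)[of 0] in auto)
      moreover have "a 0 x * (\<Sum>i\<le>M. a i x) = 0" if x: "x \<in> S" for x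
      proof (cases "x \<in> N")
        case True
        then show ?thesis using a(2)[OF x] by (simp add: ind_def)
      next
        case False
        have "(\<Sum>i\<le>M. a i x * ind N x ^ i) = (\<Sum>i\<le>M. if i = 0 then a 0 x else 0)"
          using False by (intro sum.cong) (auto simp: ind_def)
        then show ?thesis using a(2)[OF x] by simp
      qed
      ultimately have "(1::'k) * (\<Sum>i\<le>M. if i = 0 then 1 else 0) = 0"
        by (rule partial_hom_zero[OF G(1)])
      then show ?thesis by simp
    qed
  qed
  moreover have "(f, 0) \<in> G" if N: "(ind N, 0) \<in> G" "\<forall>x\<in>S - N. f x = 0" for N f
  proof -
    consider c where "(f, c) \<in> G" | M where "obstructed S G f M" using ext by blast
    then show ?thesis
    proof cases
      case 1
      have "c * 1 = 0"
        by (rule partial_hom_zero[OF G(1) partial_hom_mult[OF G(1) 1 compl[OF N(1)]]])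
           (use N(2) in \<open>auto simp: ind_def\<close>)
      then show ?thesis using 1 by simp
    next
      case 2
      then obtain a where a: "\<And>i. (a i, if i = 0 then 1 else 0) \<in> G"
          "\<And>x. x \<in> S \<Longrightarrow> (\<Sum>i\<le>M. a i x * f x ^ i) = 0"
        unfolding obstructed_def by blast
      \<comment> \<open>Off \<open>N\<close> the function \<open>f\<close> is zero and the relation
        reduces to \<open>a 0 x = 0\<close>, so a function of value 1 would vanish on
        \<open>S\<close>.\<close>
      have "((\<lambda>x. a 0 x * (1 - ind N x)), 1 * 1) \<in> G"
        by (rule partial_hom_mult[OF G(1) _ compl[OF N(1)]]) (use a(1)[of 0] in simp)
      moreover have "a 0 x * (1 - ind N x) = 0" if x: "x \<in> S" for x
      proof (cases "x \<in> N")
        case False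
        then have "f x = 0" using N x by blast
        then have "(\<Sum>i\<le>M. a i x * f x ^ i) = (\<Sum>i\<le>M. if i = 0 then a 0 x else 0)"
          by (intro sum.cong) auto
        then show ?thesis using a(2)[OF x] by simp
      qed (simp add: ind_def)
      ultimately have "(1::'k) * 1 = 0" by (rule partial_hom_zero[OF G(1)])
      then show ?thesis by simp
    qed
  qed
  moreover have "(\<exists>c. (f, c) \<in> G) \<or> ((\<lambda>x. 1 / f x), 0) \<in> G" if f: "\<forall>x\<in>S. f x \<noteq> 0" for f
  proof (rule ccontr)
    assume neg: "\<not> ?thesis"
    then obtain N where N: "obstructed S G f N" using ext by blast
    show False
    proof (cases "\<exists>c. ((\<lambda>x. 1 / f x), c) \<in> G")
      case False
      then show False using ext obstructed_not_both[OF G(1) _ N] f by blast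
    next
      case True
      then obtain c where c: "((\<lambda>x. 1 / f x), c) \<in> G" by blast
      with neg have "c \<noteq> 0" by auto
      \<comment> \<open>Normalized to have value 1. Multiplication by \<open>g x ^ N\<close> turns
        the relation for \<open>f\<close> into one between functions that have values, and its value
        is 1.\<close>
      define g where "g x = (1 / c) * (1 / f x)" for x
      have g: "(g, 1) \<in> G"
        unfolding g_def using partial_hom_cmult[OF G(1) c, of "1 / c"] \<open>c \<noteq> 0\<close> by simp
      obtain a where a: "\<And>i. (a i, if i = 0 then 1 else 0) \<in> G"
          "\<And>x. x \<in> S \<Longrightarrow> (\<Sum>i\<le>N. a i x * f x ^ i) = 0"
        using N unfolding obstructed_def by blast
      have gpow: "((\<lambda>x. g x ^ e), 1) \<in> G" for e
      proof (induction e)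
        case 0
        show ?case using partial_hom_const[OF G(1), of 1] by simp
      next
        case (Suc e)
        then show ?case using partial_hom_mult[OF G(1) g Suc] by simp
      qed
      have "((\<lambda>x. \<Sum>i\<le>N. a i x * ((1 / c) ^ i * g x ^ (N - i))),
          \<Sum>i\<le>N. (if i = 0 then 1 else 0) * ((1 / c) ^ i * 1)) \<in> G"
        by (intro partial_hom_sum[OF G(1)] partial_hom_mult[OF G(1) a(1)] partial_hom_cmult[OF G(1) gpow]) simp
      moreover have "(\<Sum>i\<le>N. a i x * ((1 / c) ^ i * g x ^ (N - i))) = 0" if x: "x \<in> S" for x
      proof -
        have "0 = g x ^ N * (\<Sum>i\<le>N. a i x * f x ^ i)" using a(2)[OF x] by simp
        also have "\<dots> = (\<Sum>i\<le>N. a i x * ((1 / c) ^ i * g x ^ (N - i)))"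
          unfolding sum_distrib_left
        proof (rule sum.cong)
          fix i assume "i \<in> {..N}"
          then have "g x ^ N = g x ^ (N - i) * g x ^ i" by (simp flip: power_add)
          moreover have "g x ^ i * f x ^ i = (1 / c) ^ i"
            using f x by (simp add: g_def flip: power_mult_distrib)
          ultimately show "g x ^ N * (a i x * f x ^ i) = a i x * ((1 / c) ^ i * g x ^ (N - i))"
            by (simp add: algebra_simps)
        qed simp
        finally show ?thesis by simp
      qed
      ultimately have "(\<Sum>i\<le>N. (if i = 0 then 1 else 0) * ((1 / c) ^ i * 1)) = 0"
        by (rule partial_hom_zero[OF G(1)])
      moreover have "(\<Sum>i\<le>N. (if i = 0 then 1 else 0) * ((1 / c) ^ i * 1)) = (\<Sum>i\<le>N. if i = 0 then 1 else 0)"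
        by (intro sum.cong) auto
      ultimately show False by simp
    qed
  qed
  ultimately show ?thesis using G unfolding place_def by blast
qed

lemma place_partial_hom: "place S G \<Longrightarrow> partial_hom S G"
  by (simp add: place_def)

lemma place_null: "place S G \<Longrightarrow> (ind N, 0) \<in> G \<Longrightarrow> (\<And>x. x \<in> S - N \<Longrightarrow> f x = 0) \<Longrightarrow> (f, 0) \<in> G"
  by (simp add: place_def)

lemma place_val:
  "place S G \<Longrightarrow> \<forall>x\<in>S. f x \<noteq> 0 \<Longrightarrow> (\<exists>c. (f, c) \<in> G) \<or> ((\<lambda>x. 1 / f x), 0) \<in> G"
  unfolding place_def by (elim conjE) (erule allE[of _ f], erule mp)

lemma place_cong:
  assumes "place S G" "(f, c) \<in> G" "\<And>x. x \<in> S \<Longrightarrow> f x = g x"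
  shows "(g, c) \<in> G"
proof -
  note G = place_partial_hom[OF assms(1)]
  have "(ind {} :: 'a \<Rightarrow> 'b) = (\<lambda>_. 0)" by (simp add: ind_def fun_eq_iff)
  then have "(ind {}, 0) \<in> G" using partial_hom_const[OF G, of 0] by metis
  then have "((\<lambda>x. g x - f x), 0) \<in> G" by (rule place_null[OF assms(1)]) (use assms(3) in auto)
  from partial_hom_add[OF G assms(2) this] show ?thesis by simp
qed

lemma place_nonempty: "place S G \<Longrightarrow> S \<noteq> {}"
  using partial_hom_zero[OF place_partial_hom partial_hom_const[OF place_partial_hom, of S G 1]]
  by fastforce

text \<open>Values are not affected by what happens off a set of value 1, so the relation stays and
  only the domain shrinks. Any condition holding on such a set may henceforth be assumed
  throughout.\<close>

lemma place_restrict: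
  assumes P: "place S G" and N: "(ind N, 1) \<in> G"
  shows "place (S \<inter> N) (G :: (('a \<Rightarrow> 'k::field_char_0) \<times> 'k) set)"
proof -
  note G = place_partial_hom[OF P]
  have "((\<lambda>x. 1 - ind N x), 1 - 1) \<in> G" by (rule partial_hom_diff[OF G partial_hom_const[OF G] N])
  moreover have "(\<lambda>x. 1 - ind N x) = (ind (- N) :: 'a \<Rightarrow> 'k)" by (auto simp: ind_def fun_eq_iff)
  ultimately have N': "(ind (- N), 0) \<in> G" by simp
  have null: "(f, 0) \<in> G" if f: "(ind M, 0) \<in> G" "\<forall>x\<in>S \<inter> N - M. f x = 0" for M and f :: "'a \<Rightarrow> 'k"
  proof -
    have "((\<lambda>x. if x \<in> M then f x else 0), 0) \<in> G" by (rule place_null[OF P f(1)]) auto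
    moreover have "((\<lambda>x. if x \<in> M then 0 else f x), 0) \<in> G"
      by (rule place_null[OF P N']) (use f(2) in auto)
    ultimately have "((\<lambda>x. (if x \<in> M then f x else 0) + (if x \<in> M then 0 else f x)), 0 + 0) \<in> G"
      by (rule partial_hom_add[OF G])
    moreover have "(\<lambda>x. (if x \<in> M then f x else 0) + (if x \<in> M then 0 else f x)) = f" by auto
    ultimately show ?thesis by simp
  qed
  have same: "(f, c) \<in> G" if f: "(g, c) \<in> G" "\<forall>x\<in>S \<inter> N. f x = g x" for f g :: "'a \<Rightarrow> 'k" and c
  proof -
    have "((\<lambda>x. f x - g x), 0) \<in> G"
      by (rule place_null[OF P N']) (use f(2) in auto)
    from partial_hom_add[OF G f(1) this] show ?thesis by simp
  qed
  show ?thesis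
    unfolding place_def
  proof (intro conjI allI impI)
    show "partial_hom (S \<inter> N) G"
      unfolding partial_hom_def
    proof (intro conjI allI impI)
      fix f :: "'a \<Rightarrow> 'k" and a assume f: "(f, a) \<in> G" "\<forall>x\<in>S \<inter> N. f x = 0"
      have "a * 1 = 0"
        by (rule partial_hom_zero[OF G partial_hom_mult[OF G f(1) N]]) (use f in \<open>auto simp: ind_def\<close>)
      then show "a = 0" by simp
    qed (use partial_hom_const[OF G] partial_hom_add[OF G] partial_hom_mult[OF G] in blast)+
  next
    fix M show "(ind M, 0) \<in> G \<or> (ind M, 1) \<in> G" using P by (simp add: place_def)
  next
    fix M and f :: "'a \<Rightarrow> 'k" assume "(ind M, 0) \<in> G" "\<forall>x\<in>S \<inter> N - M. f x = 0"
    then show "(f, 0) \<in> G" by (rule null)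
  next
    fix f :: "'a \<Rightarrow> 'k" assume f: "\<forall>x\<in>S \<inter> N. f x \<noteq> 0"
    define g where "g x = (if x \<in> S \<inter> N then f x else 1)" for x
    have "\<forall>x\<in>S. g x \<noteq> 0" using f by (simp add: g_def)
    then have "(\<exists>c. (g, c) \<in> G) \<or> ((\<lambda>x. 1 / g x), 0) \<in> G"
      by (rule place_val[OF P])
    then show "(\<exists>c. (f, c) \<in> G) \<or> ((\<lambda>x. 1 / f x), 0) \<in> G"
    proof
      assume "\<exists>c. (g, c) \<in> G"
      then obtain c where "(g, c) \<in> G" ..
      then have "(f, c) \<in> G" by (rule same) (simp add: g_def)
      then show ?thesis by blast
    next
      assume "((\<lambda>x. 1 / g x), 0) \<in> G"
      then have "((\<lambda>x. 1 / f x), 0) \<in> G" by (rule same) (simp add: g_def)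
      then show ?thesis by blast
    qed
  qed
qed

lemma place_split:
  assumes P: "place S (G :: (('a \<Rightarrow> 'k::field_char_0) \<times> 'k) set)"
  shows "place (S \<inter> N) G \<or> place (S - N) G"
proof -
  note G = place_partial_hom[OF P]
  have "(ind N, 0) \<in> G \<or> (ind N, 1) \<in> G" using P by (simp add: place_def)
  then show ?thesis
  proof
    assume N: "(ind N, 0) \<in> G"
    have "((\<lambda>x. 1 - ind N x), 1 - 0) \<in> G" by (rule partial_hom_diff[OF G partial_hom_const[OF G] N])
    moreover have "(\<lambda>x. 1 - ind N x) = (ind (- N) :: 'a \<Rightarrow> 'k)" by (auto simp: ind_def fun_eq_iff)
    ultimately have "place (S \<inter> - N) G" using place_restrict[OF P] by simp
    then show ?thesis by (simp add: Diff_eq)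
  qed (use place_restrict[OF P] in auto)
qed

lemma place_inverse:
  assumes P: "place S G" and "(f, a) \<in> G" "a \<noteq> 0" "\<And>x. x \<in> S \<Longrightarrow> f x \<noteq> 0"
  shows "((\<lambda>x. 1 / f x), 1 / a) \<in> G"
proof -
  note G = place_partial_hom[OF P]
  have key: "c = 1 / a" if c: "((\<lambda>x. 1 / f x), c) \<in> G" for c
  proof -
    have "c * a = 1"
      by (rule partial_hom_unique[OF G partial_hom_mult[OF G c assms(2)] partial_hom_const[OF G]])
         (use assms(4) in auto)
    then show ?thesis using assms(3) by (simp add: field_simps)
  qed
  have "\<forall>x\<in>S. 1 / f x \<noteq> 0" using assms(4) by simp
  then have "(\<exists>c. ((\<lambda>x. 1 / f x), c) \<in> G) \<or> ((\<lambda>x. 1 / (1 / f x)), 0) \<in> G"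
    by (rule place_val[OF P])
  then show ?thesis
  proof
    assume "((\<lambda>x. 1 / (1 / f x)), 0) \<in> G"
    then have "(f, 0) \<in> G" by simp
    then have "a = 0" using partial_hom_unique[OF G assms(2)] by blast
    then show ?thesis using assms(3) by simp
  qed (use key in blast)
qed

lemma place_ne_0:
  assumes P: "place S G" and "(f, a) \<in> G" "a \<noteq> 0"
  shows "place (S \<inter> {x. f x \<noteq> 0}) G"
proof -
  have "\<not> place (S - {x. f x \<noteq> 0}) G"
  proof
    assume *: "place (S - {x. f x \<noteq> 0}) G"
    have "a = 0" by (rule partial_hom_zero[OF place_partial_hom[OF *] assms(2)]) auto
    then show False using assms(3) by simp
  qed
  then show ?thesis using place_split[OF P] by blast
qed

text \<open>Properness of projective space: division by a dominant coordinate gives all ratios a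
  limit. The dominant index is found by adding coordinates one at a time and comparing each with the
  current leader.\<close>

lemma place_normalize:
  assumes P: "place S G" and I: "finite I" and v: "\<And>x. x \<in> S \<Longrightarrow> \<exists>i\<in>I. v i x \<noteq> 0"
  shows "\<exists>S'\<subseteq>S. place S' G \<and> (\<exists>k\<in>I. (\<forall>x\<in>S'. v k x \<noteq> 0) \<and> (\<forall>i\<in>I. \<exists>c. ((\<lambda>x. v i x / v k x), c) \<in> G))"
proof -
  have "\<exists>S'\<subseteq>S. place S' G \<and> ((\<forall>i\<in>J. \<forall>x\<in>S'. v i x = 0) \<or>
      (\<exists>k\<in>J. (\<forall>x\<in>S'. v k x \<noteq> 0) \<and> (\<forall>i\<in>J. \<exists>c. ((\<lambda>x. v i x / v k x), c) \<in> G)))"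
    if "finite J" for J
    using that
  proof (induction J)
    case empty
    show ?case using P by auto
  next
    case (insert j J)
    then obtain S' where S': "S' \<subseteq> S" "place S' G" and cases: "(\<forall>i\<in>J. \<forall>x\<in>S'. v i x = 0) \<or>
      (\<exists>k\<in>J. (\<forall>x\<in>S'. v k x \<noteq> 0) \<and> (\<forall>i\<in>J. \<exists>c. ((\<lambda>x. v i x / v k x), c) \<in> G))" by blast
    let ?N = "{x. v j x = 0}"
    have zero: "\<exists>c. (f, c) \<in> G" if "place T G" "\<And>x. x \<in> T \<Longrightarrow> f x = 0" for T f
      using place_cong[OF that(1) partial_hom_const[OF place_partial_hom[OF that(1)], of 0], of f] that(2) by auto
    have one: "\<exists>c. (f, c) \<in> G" if "place T G" "\<And>x. x \<in> T \<Longrightarrow> f x = 1" for T f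
      using place_cong[OF that(1) partial_hom_const[OF place_partial_hom[OF that(1)], of 1], of f] that(2) by auto
    consider (Z) "place (S' \<inter> ?N) G" | (NZ) "place (S' - ?N) G" using place_split[OF S'(2)] by blast
    then show ?case
    proof cases
      case Z
      have "\<exists>c. ((\<lambda>x. v j x / v k x), c) \<in> G" for k by (rule zero[OF Z]) auto
      then show ?thesis using cases Z S'
        by (intro exI[of _ "S' \<inter> ?N"]) (auto; blast)
    next
      case NZ
      from cases show ?thesis
      proof
        assume 0: "\<forall>i\<in>J. \<forall>x\<in>S'. v i x = 0"
        have "\<exists>c. ((\<lambda>x. v i x / v j x), c) \<in> G" if "i \<in> insert j J" for i
        proof (cases "i = j")
          case True
          show ?thesis by (rule one[OF NZ]) (use True in auto)
        next
          case False
          show ?thesis by (rule zero[OF NZ]) (use False that 0 in auto)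
        qed
        moreover have "\<forall>x\<in>S' - ?N. v j x \<noteq> 0" "S' - ?N \<subseteq> S" using S' by auto
        ultimately show ?thesis using NZ by blast
      next
        assume "\<exists>k\<in>J. (\<forall>x\<in>S'. v k x \<noteq> 0) \<and> (\<forall>i\<in>J. \<exists>c. ((\<lambda>x. v i x / v k x), c) \<in> G)"
        then obtain k where k: "k \<in> J" "\<forall>x\<in>S'. v k x \<noteq> 0" "\<forall>i\<in>J. \<exists>c. ((\<lambda>x. v i x / v k x), c) \<in> G"
          by blast
        have "\<forall>x\<in>S' - ?N. v j x / v k x \<noteq> 0" using k(2) by simp
        then have "(\<exists>c. ((\<lambda>x. v j x / v k x), c) \<in> G) \<or> ((\<lambda>x. 1 / (v j x / v k x)), 0) \<in> G"
          by (rule place_val[OF NZ])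
        then show ?thesis
        proof
          assume "\<exists>c. ((\<lambda>x. v j x / v k x), c) \<in> G"
          then have "\<forall>i\<in>insert j J. \<exists>c. ((\<lambda>x. v i x / v k x), c) \<in> G" using k(3) by blast
          moreover have "\<forall>x\<in>S' - ?N. v k x \<noteq> 0" "S' - ?N \<subseteq> S" using k(2) S' by auto
          ultimately show ?thesis using NZ k(1) by blast
        next
          assume jk: "((\<lambda>x. 1 / (v j x / v k x)), 0) \<in> G"
          have "\<exists>c. ((\<lambda>x. v i x / v j x), c) \<in> G" if "i \<in> insert j J" for i
          proof (cases "i = j")
            case True
            show ?thesis by (rule one[OF NZ]) (use True in auto)
          next
            case False
            then obtain c where c: "((\<lambda>x. v i x / v k x), c) \<in> G" using k \<open>i \<in> insert j J\<close> by blast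
            have "((\<lambda>x. v i x / v j x), c * 0) \<in> G"
              by (rule place_cong[OF NZ partial_hom_mult[OF place_partial_hom[OF NZ] c jk]]) (use k(2) in simp)
            then show ?thesis by blast
          qed
          moreover have "\<forall>x\<in>S' - ?N. v j x \<noteq> 0" "S' - ?N \<subseteq> S" using S' by auto
          ultimately show ?thesis using NZ by blast
        qed
      qed
    qed
  qed
  from this[OF I] obtain S' where S': "S' \<subseteq> S" "place S' G" and cases: "(\<forall>i\<in>I. \<forall>x\<in>S'. v i x = 0) \<or>
      (\<exists>k\<in>I. (\<forall>x\<in>S'. v k x \<noteq> 0) \<and> (\<forall>i\<in>I. \<exists>c. ((\<lambda>x. v i x / v k x), c) \<in> G))" by blast
  obtain x where "x \<in> S'" using place_nonempty[OF S'(2)] by blast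
  then have "\<not> (\<forall>i\<in>I. \<forall>x\<in>S'. v i x = 0)" using v[of x] S'(1) by blast
  then show ?thesis using cases S' by blast
qed

text \<open>The limit of the equation is \<open>a * t ^ 2 = 0\<close>; a root without a finite value
  is excluded by dividing the equation by \<open>t ^ 2\<close>.\<close>

lemma place_quadratic_root:
  assumes P: "place S G" and lims: "(\<alpha>, a) \<in> G" "a \<noteq> 0" "(\<beta>, 0) \<in> G" "(\<gamma>, 0) \<in> G"
    and root: "\<And>x. x \<in> S \<Longrightarrow> \<alpha> x * t x ^ 2 + \<beta> x * t x + \<gamma> x = 0"
  shows "(t, 0) \<in> G"
proof -
  consider "place (S \<inter> {x. t x = 0}) G" | "place (S - {x. t x = 0}) G" using place_split[OF P] by blast
  then show ?thesis
  proof cases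
    case 1
    show ?thesis
      by (rule place_cong[OF 1 partial_hom_const[OF place_partial_hom[OF 1]]]) auto
  next
    case 2
    note G = place_partial_hom[OF 2]
    have "(\<exists>c. (t, c) \<in> G) \<or> ((\<lambda>x. 1 / t x), 0) \<in> G"
      by (rule place_val[OF 2]) simp
    then show ?thesis
    proof
      assume "\<exists>c. (t, c) \<in> G"
      then obtain c where c: "(t, c) \<in> G" ..
      have "((\<lambda>x. \<alpha> x * (t x * t x) + \<beta> x * t x + \<gamma> x), a * (c * c) + 0 * c + 0) \<in> G"
        by (intro partial_hom_add[OF G] partial_hom_mult[OF G] lims c)
      then have "a * (c * c) + 0 * c + 0 = 0"
        by (rule partial_hom_zero[OF G]) (use root in \<open>auto simp: power2_eq_square\<close>)
      then show ?thesis using c lims by simp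
    next
      assume t: "((\<lambda>x. 1 / t x), 0) \<in> G"
      have "((\<lambda>x. \<alpha> x + \<beta> x * (1 / t x) + \<gamma> x * ((1 / t x) * (1 / t x))), a + 0 * 0 + 0 * (0 * 0)) \<in> G"
        by (intro partial_hom_add[OF G] partial_hom_mult[OF G] lims t)
      then have "a + 0 * 0 + 0 * (0 * 0) = 0"
      proof (rule partial_hom_zero[OF G])
        fix x assume x: "x \<in> S - {x. t x = 0}"
        have "\<alpha> x + \<beta> x * (1 / t x) + \<gamma> x * ((1 / t x) * (1 / t x)) =
            (\<alpha> x * t x ^ 2 + \<beta> x * t x + \<gamma> x) / t x ^ 2"
          using x by (simp add: field_simps power2_eq_square)
        then show "\<alpha> x + \<beta> x * (1 / t x) + \<gamma> x * ((1 / t x) * (1 / t x)) = 0" using root x by simp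
      qed
      then show ?thesis using lims by simp
    qed
  qed
qed

lemma polyfun_lim:
  assumes G: "partial_hom S G" and v: "\<And>i. i \<le> n \<Longrightarrow> ((\<lambda>x. v x i), w i) \<in> G"
  shows "polyfun n f \<Longrightarrow> ((\<lambda>x. f (v x)), f w) \<in> G"
  by (induction rule: polyfun.induct)
     (auto intro: partial_hom_const[OF G] partial_hom_add[OF G] partial_hom_mult[OF G] v)

text \<open>The remainder \<open>R\<close> is required to have a value, so that for infinitesimal
  \<epsilon> it disappears in the limit after one division by \<epsilon>.\<close>

lemma polyfun_lim_first_order:
  assumes G: "partial_hom S G" and v: "\<And>i. i \<le> n \<Longrightarrow> ((\<lambda>x. v x i), w i) \<in> G" and e: "(\<epsilon>, \<epsilon>0) \<in> G"
  shows "polyfun n f \<Longrightarrow> ((\<lambda>x. dd (v x) f p), dd w f p) \<in> G \<and>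
    (\<exists>R r. (R, r) \<in> G \<and> (\<forall>x. f (p + \<epsilon> x \<cdot> v x) = f p + \<epsilon> x * dd (v x) f p + \<epsilon> x ^ 2 * R x))"
proof (induction rule: polyfun.induct)
  case (const c)
  show ?case using partial_hom_const[OF G, of 0] by (auto intro!: exI[of _ "\<lambda>_. 0"])
next
  case (coord i)
  then show ?case using partial_hom_const[OF G, of 0] v by (auto intro!: exI[of _ "\<lambda>_. 0"])
next
  case (add f g)
  then obtain R r R' r' where R: "(R, r) \<in> G" "\<And>x. f (p + \<epsilon> x \<cdot> v x) = f p + \<epsilon> x * dd (v x) f p + \<epsilon> x ^ 2 * R x"
    "(R', r') \<in> G" "\<And>x. g (p + \<epsilon> x \<cdot> v x) = g p + \<epsilon> x * dd (v x) g p + \<epsilon> x ^ 2 * R' x" by blast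
  have "f (p + \<epsilon> x \<cdot> v x) + g (p + \<epsilon> x \<cdot> v x) =
      f p + g p + \<epsilon> x * dd (v x) (\<lambda>x. f x + g x) p + \<epsilon> x ^ 2 * (R x + R' x)" for x
    unfolding R dd_add[OF add(1,2)] by (simp add: algebra_simps)
  moreover have "((\<lambda>x. dd (v x) (\<lambda>x. f x + g x) p), dd w (\<lambda>x. f x + g x) p) \<in> G"
    using add.IH by (auto simp: dd_add[OF add(1,2)] intro!: partial_hom_add[OF G])
  ultimately show ?case using partial_hom_add[OF G R(1,3)] by blast
next
  case (mult f g)
  then obtain R r R' r' where R: "(R, r) \<in> G" "\<And>x. f (p + \<epsilon> x \<cdot> v x) = f p + \<epsilon> x * dd (v x) f p + \<epsilon> x ^ 2 * R x"
    "(R', r') \<in> G" "\<And>x. g (p + \<epsilon> x \<cdot> v x) = g p + \<epsilon> x * dd (v x) g p + \<epsilon> x ^ 2 * R' x" by blast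
  have d: "((\<lambda>x. dd (v x) f p), dd w f p) \<in> G" "((\<lambda>x. dd (v x) g p), dd w g p) \<in> G" using mult.IH by auto
  define Q where "Q x = f p * R' x + dd (v x) f p * dd (v x) g p + R x * g p +
    \<epsilon> x * (dd (v x) f p * R' x + R x * dd (v x) g p) + \<epsilon> x * \<epsilon> x * (R x * R' x)" for x
  have "f (p + \<epsilon> x \<cdot> v x) * g (p + \<epsilon> x \<cdot> v x) =
      f p * g p + \<epsilon> x * dd (v x) (\<lambda>x. f x * g x) p + \<epsilon> x ^ 2 * Q x" for x
    unfolding R dd_mult[OF mult(1,2)] Q_def by (simp add: algebra_simps power2_eq_square)
  moreover have "((\<lambda>x. dd (v x) (\<lambda>x. f x * g x) p), dd w (\<lambda>x. f x * g x) p) \<in> G"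
    unfolding dd_mult[OF mult(1,2)]
    by (intro partial_hom_add[OF G] partial_hom_mult[OF G] d partial_hom_const[OF G])
  moreover have "(Q, f p * r' + dd w f p * dd w g p + r * g p +
      \<epsilon>0 * (dd w f p * r' + r * dd w g p) + \<epsilon>0 * \<epsilon>0 * (r * r')) \<in> G"
    unfolding Q_def[abs_def]
    by (intro partial_hom_add[OF G] partial_hom_mult[OF G] d R(1,3) e partial_hom_const[OF G])
  ultimately show ?case by blast
qed

section \<open>Subspaces of the coordinate space\<close>

interpretation fv: vector_space "scl :: 'k::field_char_0 \<Rightarrow> _"
  by unfold_locales (auto simp: fun_eq_iff algebra_simps)

definition vecs :: "nat \<Rightarrow> (nat \<Rightarrow> 'k::field_char_0) set" where
  "vecs n = {v. vec_in n v}"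

definition unit_vec :: "nat \<Rightarrow> nat \<Rightarrow> 'k::field_char_0" where
  "unit_vec i = (\<lambda>j. if j = i then 1 else 0)"

lemma subspace_vecs: "fv.subspace (vecs n)"
  by (auto simp: fv.subspace_def vecs_def vec_in_def)

lemma sum_fun_apply: "(\<Sum>i\<in>A. f i) x = (\<Sum>i\<in>A. (f i x :: 'k::field_char_0))"
  by (induction A rule: infinite_finite_induct) auto

lemma vecs_expand: "v \<in> vecs n \<Longrightarrow> v = (\<Sum>i\<le>n. v i \<cdot> unit_vec i)"
proof
  fix j assume v: "v \<in> vecs n"
  have "(\<Sum>i\<le>n. v i \<cdot> unit_vec i) j = (\<Sum>i\<le>n. if j = i then v i else 0)"
    unfolding sum_fun_apply by (intro sum.cong) (auto simp: unit_vec_def)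
  then show "v j = (\<Sum>i\<le>n. v i \<cdot> unit_vec i) j"
    using v by (auto simp: vecs_def vec_in_def)
qed

lemma vecs_span: "vecs n \<subseteq> fv.span (unit_vec ` {..n})"
proof
  fix v assume "v \<in> vecs n"
  then have "v = (\<Sum>i\<le>n. v i \<cdot> unit_vec i)" by (rule vecs_expand)
  also have "\<dots> \<in> fv.span (unit_vec ` {..n})"
    by (intro fv.span_sum fv.span_scale fv.span_base) auto
  finally show "v \<in> fv.span (unit_vec ` {..n})" .
qed

lemma independent_vecs_finite: "fv.independent B \<Longrightarrow> B \<subseteq> vecs n \<Longrightarrow> finite B"
  using fv.independent_span_bound[of "unit_vec ` {..n}" B] vecs_span[of n] by auto

lemma unit_vec_inj: "inj (unit_vec :: nat \<Rightarrow> nat \<Rightarrow> 'k::field_char_0)"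
  by (auto simp: inj_def unit_vec_def fun_eq_iff split: if_splits)

lemma dim_vecs: "fv.dim (vecs n :: (nat \<Rightarrow> 'k::field_char_0) set) = Suc n"
proof (rule fv.dim_unique)
  show "unit_vec ` {..n} \<subseteq> (vecs n :: (nat \<Rightarrow> 'k) set)" by (auto simp: vecs_def vec_in_def unit_vec_def)
  show "vecs n \<subseteq> fv.span (unit_vec ` {..n} :: (nat \<Rightarrow> 'k) set)" by (rule vecs_span)
  show "card (unit_vec ` {..n} :: (nat \<Rightarrow> 'k) set) = Suc n"
    by (subst card_image) (auto intro: inj_on_subset[OF unit_vec_inj])
  show "fv.independent (unit_vec ` {..n} :: (nat \<Rightarrow> 'k) set)"
  proof (rule fv.independent_if_scalars_zero)
    fix f :: "(nat \<Rightarrow> 'k) \<Rightarrow> 'k" and x :: "nat \<Rightarrow> 'k"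
    assume 0: "(\<Sum>x\<in>unit_vec ` {..n}. f x \<cdot> x) = 0" and "x \<in> unit_vec ` {..n}"
    then obtain j where j: "j \<le> n" "x = unit_vec j" by auto
    have "(\<Sum>x\<in>unit_vec ` {..n}. f x \<cdot> x) j = (\<Sum>i\<le>n. f (unit_vec i) * unit_vec i j)"
      unfolding sum_fun_apply
      by (subst sum.reindex) (auto intro: inj_on_subset[OF unit_vec_inj])
    also have "\<dots> = (\<Sum>i\<le>n. if j = i then f (unit_vec i) else 0)"
      by (intro sum.cong) (auto simp: unit_vec_def)
    also have "\<dots> = f x" using j by simp
    finally show "f x = 0" using 0 by simp
  qed simp
qed

lemma dim_mono_vecs:
  assumes "W1 \<subseteq> W2" "W2 \<subseteq> vecs n"
  shows "fv.dim W1 \<le> fv.dim W2"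
proof -
  obtain B1 where B1: "B1 \<subseteq> W1" "fv.independent B1" "card B1 = fv.dim W1" using fv.basis_exists by metis
  obtain B2 where B2: "B2 \<subseteq> W2" "fv.independent B2" "W2 \<subseteq> fv.span B2" "card B2 = fv.dim W2"
    using fv.basis_exists by metis
  have "finite B2" using independent_vecs_finite B2 assms by blast
  then have "card B1 \<le> card B2" using fv.independent_span_bound[of B2 B1] B1 B2 assms by blast
  then show ?thesis using B1 B2 by simp
qed

lemma subspace_eq_vecs:
  assumes "fv.subspace W1" "W1 \<subseteq> W2" "W2 \<subseteq> vecs n" "fv.dim W2 \<le> fv.dim W1"
  shows "W1 = W2"
proof (rule ccontr)
  assume "W1 \<noteq> W2"
  then obtain x where x: "x \<in> W2" "x \<notin> W1" using assms by blast
  obtain B where B: "B \<subseteq> W1" "fv.independent B" "W1 \<subseteq> fv.span B" "card B = fv.dim W1"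
    using fv.basis_exists by metis
  have fin: "finite B" using independent_vecs_finite B assms by blast
  have "fv.span B \<subseteq> W1" using B(1) assms(1) by (rule fv.span_minimal)
  then have "x \<notin> fv.span B" using x by blast
  then have "fv.independent (insert x B)" "x \<notin> B" using B fv.independent_insertI fv.span_base by blast+
  then have "fv.dim (insert x B) = Suc (fv.dim W1)"
    using fin B fv.dim_eq_card_independent by fastforce
  moreover have "fv.dim (insert x B) \<le> fv.dim W2"
    by (rule dim_mono_vecs[of _ _ n]) (use x B assms in auto)
  ultimately show False using assms by simp
qed

section \<open>Linear forms and their kernels\<close>

lemma lin_form_add: "lin_form n a (u + v) = lin_form n a u + lin_form n a v"
  by (simp add: lin_form_def algebra_simps sum.distrib)

lemma lin_form_scl: "lin_form n a (c \<cdot> v) = c * lin_form n a v"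
  by (simp add: lin_form_def algebra_simps sum_distrib_left)

lemma lin_form_0: "lin_form n a 0 = 0"
  by (simp add: lin_form_def)

lemma lin_form_diff: "lin_form n a (u - v) = lin_form n a u - lin_form n a v"
  by (simp add: lin_form_def algebra_simps sum_subtractf)

lemma polyfun_lin_form: "polyfun n (lin_form n a)"
  unfolding lin_form_def[abs_def] by (intro polyfun_sum polyfun.mult polyfun.const polyfun.coord) auto

lemma subspace_ker: "fv.subspace W \<Longrightarrow> fv.subspace (W \<inter> {v. lin_form n a v = 0})"
  by (auto simp: fv.subspace_def lin_form_add lin_form_scl lin_form_0)

lemma dim_ker:
  assumes W: "fv.subspace W" "W \<subseteq> vecs m" and x: "x \<in> W" "lin_form n a x \<noteq> 0"
  shows "Suc (fv.dim (W \<inter> {v. lin_form n a v = 0})) = fv.dim W"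
proof -
  let ?K = "W \<inter> {v. lin_form n a v = 0}"
  obtain B where B: "B \<subseteq> ?K" "fv.independent B" "?K \<subseteq> fv.span B" "card B = fv.dim ?K"
    using fv.basis_exists by metis
  have fin: "finite B" using independent_vecs_finite B W by blast
  have "fv.span B \<subseteq> ?K" using B(1) subspace_ker[OF W(1)] by (rule fv.span_minimal)
  then have "x \<notin> fv.span B" using x by blast
  then have ind: "fv.independent (insert x B)" "x \<notin> B" using B fv.independent_insertI fv.span_base by blast+
  have "fv.dim W = card (insert x B)"
  proof (rule fv.dim_unique[OF _ _ ind(1) refl])
    show "insert x B \<subseteq> W" using x B by auto
    show "W \<subseteq> fv.span (insert x B)"
    proof
      fix w assume w: "w \<in> W"
      let ?c = "lin_form n a w / lin_form n a x"
      have "w - ?c \<cdot> x \<in> ?K"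
        using w x W(1) by (auto simp: lin_form_diff lin_form_scl intro: fv.subspace_diff fv.subspace_scale)
      then have "w - ?c \<cdot> x \<in> fv.span (insert x B)" using B(3) fv.span_mono[of B "insert x B"] by blast
      moreover have "?c \<cdot> x \<in> fv.span (insert x B)" by (intro fv.span_scale fv.span_base) auto
      ultimately have "(w - ?c \<cdot> x) + ?c \<cdot> x \<in> fv.span (insert x B)" by (rule fv.span_add)
      then show "w \<in> fv.span (insert x B)" by simp
    qed
  qed
  then show ?thesis using fin ind(2) B(4) by simp
qed

lemma separating_form:
  fixes x :: "nat \<Rightarrow> 'k::field_char_0"
  assumes W: "fv.subspace W" and x: "x \<in> vecs n" "x \<notin> W" "W \<subseteq> vecs n"
  shows "\<exists>a. (\<forall>w\<in>W. lin_form n a w = 0) \<and> lin_form n a x = 1"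
proof -
  have pair: "vector_space_pair (scl :: 'k \<Rightarrow> _) ((*) :: 'k \<Rightarrow> 'k \<Rightarrow> 'k)"
    by unfold_locales (auto simp: algebra_simps)
  obtain B where B: "B \<subseteq> W" "fv.independent B" "W \<subseteq> fv.span B" using fv.basis_exists by metis
  have "fv.span B \<subseteq> W" using B(1) W by (rule fv.span_minimal)
  then have ind: "fv.independent (insert x B)" "x \<notin> B"
    using x B fv.independent_insertI fv.span_base by blast+
  then obtain g where g: "Vector_Spaces.linear scl (*) g" "\<forall>v\<in>insert x B. g v = (if v = x then 1 else 0)"
    using vector_space_pair.linear_independent_extend[OF pair, of "insert x B" "\<lambda>v. if v = x then 1 else 0"] by blast
  interpret g: Vector_Spaces.linear scl "(*)" g by (rule g(1))
  define a where "a i = g (unit_vec i)" for i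
  have form: "lin_form n a v = g v" if "v \<in> vecs n" for v
  proof -
    have "g v = (\<Sum>i\<le>n. v i * g (unit_vec i))"
      by (subst vecs_expand[OF that]) (simp add: g.sum g.scale)
    then show ?thesis by (simp add: lin_form_def a_def mult.commute)
  qed
  have "g w = 0" if "w \<in> W" for w
  proof (rule g.eq_0_on_span[of B])
    show "g v = 0" if "v \<in> B" for v using g(2) ind(2) that by auto
    show "w \<in> fv.span B" using B that by blast
  qed
  then show ?thesis using form x g(2) by (intro exI[of _ a]) auto
qed

lemma lincomb_sum: "lincomb r c v = (\<Sum>j\<le>r. c j \<cdot> (v j :: nat \<Rightarrow> 'k::field_char_0))"
  by (rule ext) (simp add: lincomb_def sum_fun_apply)

lemma subspace_of_frame:
  fixes v :: "nat \<Rightarrow> nat \<Rightarrow> 'k::field_char_0"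
  assumes v: "lin_frame n r v"
  shows "fv.subspace {q. in_span r v q}" "{q. in_span r v q} \<subseteq> vecs n" "fv.dim {q. in_span r v q} = Suc r"
proof -
  have vec: "v j \<in> vecs n" if "j \<le> r" for j using v that by (simp add: lin_frame_def vecs_def)
  have indep: "c j = 0" if "(\<Sum>j\<le>r. c j \<cdot> v j) = 0" "j \<le> r" for c j
    using v that by (auto simp: lin_frame_def lincomb_sum zero_fun_def)
  have inj: "inj_on v {..r}"
  proof (rule inj_onI)
    fix i j assume ij: "i \<in> {..r}" "j \<in> {..r}" "v i = v j"
    show "i = j"
    proof (rule ccontr)
      assume "i \<noteq> j"
      let ?c = "\<lambda>k. if k = i then 1 else if k = j then - 1 else (0::'k)"
      have "(\<Sum>k\<le>r. ?c k \<cdot> v k) = (\<Sum>k\<in>{i, j}. ?c k \<cdot> v k)"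
        by (rule sum.mono_neutral_right) (use ij in \<open>auto simp: fun_eq_iff\<close>)
      also have "\<dots> = 0" using \<open>i \<noteq> j\<close> ij by (simp add: fun_eq_iff)
      finally have "?c i = 0" by (rule indep) (use ij in auto)
      then show False by simp
    qed
  qed
  let ?B = "v ` {..r}"
  have "fv.independent ?B"
  proof (rule fv.independent_if_scalars_zero)
    fix f x assume "(\<Sum>x\<in>?B. f x \<cdot> x) = 0" "x \<in> ?B"
    then show "f x = 0" using indep[of "\<lambda>j. f (v j)"] inj by (auto simp: sum.reindex)
  qed simp
  moreover have span: "{q. in_span r v q} = fv.span ?B"
  proof -
    have "\<exists>c. (\<Sum>x\<in>?B. u x \<cdot> x) = lincomb r c v" for u
      using inj by (intro exI[of _ "\<lambda>j. u (v j)"]) (simp add: lincomb_sum sum.reindex)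
    moreover have "lincomb r c v \<in> fv.span ?B" for c
      unfolding lincomb_sum by (intro fv.span_sum fv.span_scale fv.span_base) auto
    ultimately show ?thesis unfolding in_span_def using fv.span_finite[of ?B] by (auto; blast)
  qed
  moreover have "card ?B = Suc r" using inj by (simp add: card_image)
  ultimately show "fv.dim {q. in_span r v q} = Suc r" using fv.dim_span_eq_card_independent by metis
  show "fv.subspace {q. in_span r v q}" unfolding span by (rule fv.subspace_span)
  show "{q. in_span r v q} \<subseteq> vecs n"
    unfolding span by (rule fv.span_minimal) (use vec subspace_vecs in auto)
qed

section \<open>Limits of linear subspaces\<close>

text \<open>Stands for a limit of the subspaces \<open>V x\<close> in a Grassmannian:
  \<open>m\<close> vectors \<open>w j x\<close> over a smaller set \<open>S'\<close> whose limits
  \<open>w0 j\<close> remain linearly independent.\<close>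

definition limit_frame where
  "limit_frame G n m S V S' w w0 \<longleftrightarrow> S' \<subseteq> S \<and> place S' G \<and> (\<forall>j<m. \<forall>x\<in>S'. w j x \<in> V x) \<and>
    (\<forall>j<m. \<forall>i. ((\<lambda>x. w j x i), w0 j i) \<in> G) \<and> (\<forall>j<m. w0 j \<in> vecs n) \<and>
    (\<forall>c. (\<forall>i. (\<Sum>j<m. c j * w0 j i) = 0) \<longrightarrow> (\<forall>j<m. c j = 0))"

text \<open>Properness of the Grassmannian, by echelon form. One vector of \<open>V x\<close> is
  scaled to have coordinate 1 at a dominant index \<open>k\<close>; the others are taken in the part
  of \<open>V x\<close> where that coordinate is zero, so the limits stay independent.\<close>

lemma place_limit_subspace:
  fixes G :: "(('a \<Rightarrow> 'k::field_char_0) \<times> 'k) set"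
  assumes "place S G" "\<And>x. x \<in> S \<Longrightarrow> fv.subspace (V x) \<and> V x \<subseteq> vecs n \<and> fv.dim (V x) = m"
  shows "\<exists>S' w w0. limit_frame G n m S V S' w w0"
  using assms
proof (induction m arbitrary: S V)
  case 0
  then show ?case by (intro exI[of _ S]) (auto simp: limit_frame_def)
next
  case (Suc m)
  note V = Suc.prems(2)
  have "\<exists>v\<in>V x. v \<noteq> 0" if x: "x \<in> S" for x
  proof (rule ccontr)
    assume "\<not> (\<exists>v\<in>V x. v \<noteq> 0)"
    then have "V x \<subseteq> fv.span {}" by auto
    then have "fv.dim (V x) \<le> 0" using fv.dim_le_card[of "V x" "{}"] by simp
    then show False using V[OF x] by simp
  qed
  then obtain v where v: "\<And>x. x \<in> S \<Longrightarrow> v x \<in> V x" "\<And>x. x \<in> S \<Longrightarrow> v x \<noteq> 0" by metis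
  have "\<exists>i\<in>{..n}. v x i \<noteq> 0" if "x \<in> S" for x
  proof (rule ccontr)
    assume "\<not> (\<exists>i\<in>{..n}. v x i \<noteq> 0)"
    moreover have "vec_in n (v x)" using v(1)[OF that] V[OF that] by (auto simp: vecs_def)
    ultimately have "v x i = 0" for i by (cases "i \<le> n") (auto simp: vec_in_def)
    then show False using v(2)[OF that] by (simp add: fun_eq_iff)
  qed
  then obtain S1 k where S1: "S1 \<subseteq> S" "place S1 G"
    and k: "k \<le> n" "\<And>x. x \<in> S1 \<Longrightarrow> v x k \<noteq> 0"
      "\<And>i. i \<le> n \<Longrightarrow> \<exists>c. ((\<lambda>x. v x i / v x k), c) \<in> G"
    using place_normalize[of S G "{..n}" "\<lambda>i x. v x i"] Suc.prems(1) by auto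
  define V' where "V' x = V x \<inter> {y. lin_form n (unit_vec k) y = 0}" for x
  have form: "lin_form n (unit_vec k) y = y k" for y
  proof -
    have "lin_form n (unit_vec k) y = (\<Sum>i\<le>n. if i = k then y i else 0)"
      unfolding lin_form_def by (intro sum.cong) (auto simp: unit_vec_def)
    then show ?thesis using k(1) by simp
  qed
  have "fv.subspace (V' x) \<and> V' x \<subseteq> vecs n \<and> fv.dim (V' x) = m" if "x \<in> S1" for x
  proof -
    have x: "x \<in> S" using that S1 by blast
    note Vx = V[OF x, THEN conjunct1] V[OF x, THEN conjunct2, THEN conjunct1]
      V[OF x, THEN conjunct2, THEN conjunct2]
    have "Suc (fv.dim (V' x)) = fv.dim (V x)"
      unfolding V'_def using k(2)[OF that] by (intro dim_ker[OF Vx(1,2) v(1)[OF x]]) (simp only: form not_False_eq_True)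
    moreover have "fv.subspace (V' x)" unfolding V'_def by (rule subspace_ker[OF Vx(1)])
    moreover have "V' x \<subseteq> vecs n" using Vx(2) unfolding V'_def by blast
    ultimately show ?thesis using Vx(3) by simp
  qed
  note V' = this
  have "\<exists>S' w w0. limit_frame G n m S1 V' S' w w0" by (rule Suc.IH[OF S1(2)]) (rule V')
  then obtain S' w w0 where S': "S' \<subseteq> S1" "place S' G"
    and w: "\<forall>j<m. \<forall>x\<in>S'. w j x \<in> V' x" "\<forall>j<m. \<forall>i. ((\<lambda>x. w j x i), w0 j i) \<in> G" "\<forall>j<m. w0 j \<in> vecs n"
    and ind: "\<forall>c. (\<forall>i. (\<Sum>j<m. c j * w0 j i) = 0) \<longrightarrow> (\<forall>j<m. c j = 0)"
    unfolding limit_frame_def by (elim exE conjE) (rule that)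
  note G' = place_partial_hom[OF S'(2)]
  have "\<exists>c. ((\<lambda>x. v x i / v x k), c) \<in> G \<and> (i > n \<longrightarrow> c = 0)" for i
  proof (cases "i \<le> n")
    case False
    have "((\<lambda>x. v x i / v x k), 0) \<in> G"
    proof (rule place_cong[OF S'(2) partial_hom_const[OF G']])
      fix x assume "x \<in> S'"
      then have "v x \<in> vecs n" using v V S' S1 by blast
      then show "0 = v x i / v x k" using False by (simp add: vecs_def vec_in_def)
    qed
    then show ?thesis by blast
  qed (use k(3) in auto)
  then obtain y where y: "\<And>i. ((\<lambda>x. v x i / v x k), y i) \<in> G" "\<And>i. i > n \<Longrightarrow> y i = 0" by metis
  have yk: "y k = 1"
    by (rule partial_hom_unique[OF G' y(1)[of k] partial_hom_const[OF G', of 1]]) (use k(2) S' in auto)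
  have w0k: "w0 j k = 0" if "j < m" for j
    by (rule partial_hom_zero[OF G', of "\<lambda>x. w j x k"]) (use w that in \<open>auto simp: V'_def form\<close>)
  define u where "u j x = (case j of 0 \<Rightarrow> (1 / v x k) \<cdot> v x | Suc j \<Rightarrow> w j x)" for j x
  define u0 where "u0 j = (case j of 0 \<Rightarrow> y | Suc j \<Rightarrow> w0 j)" for j
  show ?case
  proof (intro exI[of _ S'] exI[of _ u] exI[of _ u0], unfold limit_frame_def, intro conjI allI impI ballI)
    show "S' \<subseteq> S" using S' S1 by blast
    show "place S' G" by (rule S'(2))
  next
    fix j x assume "j < Suc m" "x \<in> S'"
    moreover from this have "x \<in> S" using S' S1 by blast
    ultimately show "u j x \<in> V x"
    proof (cases j)
      case 0
      have "(1 / v x k) \<cdot> v x \<in> V x"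
        by (rule fv.subspace_scale[OF V[OF \<open>x \<in> S\<close>, THEN conjunct1] v(1)[OF \<open>x \<in> S\<close>]])
      then show ?thesis by (simp only: u_def 0 nat.case)
    next
      case (Suc i)
      then show ?thesis using w(1) \<open>j < Suc m\<close> \<open>x \<in> S'\<close> by (auto simp: u_def V'_def)
    qed
  next
    fix j i assume "j < Suc m"
    then show "((\<lambda>x. u j x i), u0 j i) \<in> G"
      using w y(1)[of i] by (auto simp: u_def u0_def split: nat.split)
  next
    fix j assume "j < Suc m"
    then show "u0 j \<in> vecs n" using w y(2) by (auto simp: u0_def vecs_def vec_in_def split: nat.split)
  next
    fix c :: "nat \<Rightarrow> 'k" and j
    assume 0: "\<forall>i. (\<Sum>j<Suc m. c j * u0 j i) = 0" and j: "j < Suc m"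
    have sum: "(\<Sum>j<Suc m. c j * u0 j i) = c 0 * y i + (\<Sum>j<m. c (Suc j) * w0 j i)" for i
      by (simp add: sum.lessThan_Suc_shift u0_def del: sum.lessThan_Suc)
    have "c 0 = 0" using 0[rule_format, of k] w0k by (simp add: sum yk del: sum.lessThan_Suc)
    then have "\<forall>i. (\<Sum>j<m. c (Suc j) * w0 j i) = 0" using 0 by (simp add: sum del: sum.lessThan_Suc)
    then have "\<forall>j<m. c (Suc j) = 0" using ind[rule_format, of "\<lambda>j. c (Suc j)"] by blast
    then show "c j = 0" using \<open>c 0 = 0\<close> j by (cases j) auto
  qed
qed

section \<open>Generic points of a hypersurface\<close>

text \<open>What the geometry needs of an irreducible form of degree \<open>d\<close>: divisibility
  by \<open>F\<close> can be tested on its zeros in \<open>vecs n\<close>, and the set of these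
  zeros is irreducible.\<close>

locale hypersurface =
  fixes n d :: nat and F :: "(nat \<Rightarrow> 'k::field_char_0) \<Rightarrow> 'k"
  assumes alg: "alg_closed_field TYPE('k)"
    and polyfun_F: "polyfun n F" and homog_F: "homog d F" and d_ge: "d \<ge> 2"
    and F_nonzero: "\<exists>x. F x \<noteq> 0"
    and nullstellensatz: "\<And>P. polyfun n P \<Longrightarrow> (\<And>x. x \<in> vecs n \<Longrightarrow> F x = 0 \<Longrightarrow> P x = 0) \<Longrightarrow>
      \<exists>Q. polyfun n Q \<and> (\<forall>x. P x = F x * Q x)"
    and prime: "\<And>P Q. polyfun n P \<Longrightarrow> polyfun n Q \<Longrightarrow>
      (\<And>x. x \<in> vecs n \<Longrightarrow> F x = 0 \<Longrightarrow> P x * Q x = 0) \<Longrightarrow>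
      (\<forall>x\<in>vecs n. F x = 0 \<longrightarrow> P x = 0) \<or> (\<forall>x\<in>vecs n. F x = 0 \<longrightarrow> Q x = 0)"
begin

definition X :: "(nat \<Rightarrow> 'k) set" where
  "X = {x \<in> vecs n. F x = 0}"

text \<open>The general point of the cone \<open>X\<close>: the filter of sets that contain a
  nonempty Zariski open subset of \<open>X\<close>; \<open>frequently\<close> means on a dense set.
  Closure under intersection is the irreducibility of \<open>X\<close>.\<close>

definition gen :: "(nat \<Rightarrow> 'k) filter" where
  "gen = Abs_filter (\<lambda>\<phi>. \<exists>P. polyfun n P \<and> (\<exists>x\<in>X. P x \<noteq> 0) \<and> (\<forall>x\<in>X. P x \<noteq> 0 \<longrightarrow> \<phi> x))"

lemma F_0: "F 0 = 0"
proof -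
  have "0 \<cdot> (0 :: nat \<Rightarrow> 'k) = 0" by (simp add: fun_eq_iff)
  then have "F 0 = 0 ^ d * F 0" using homog_F unfolding homog_def by metis
  then show ?thesis using d_ge by (simp add: power_0_left)
qed

lemma zero_in_X: "0 \<in> X"
  using F_0 by (simp add: X_def vecs_def vec_in_def)

lemma eventually_gen:
  "eventually \<phi> gen \<longleftrightarrow> (\<exists>P. polyfun n P \<and> (\<exists>x\<in>X. P x \<noteq> 0) \<and> (\<forall>x\<in>X. P x \<noteq> 0 \<longrightarrow> \<phi> x))"
  unfolding gen_def
proof (rule eventually_Abs_filter, rule is_filter.intro)
  show "\<exists>P. polyfun n P \<and> (\<exists>x\<in>X. P x \<noteq> 0) \<and> (\<forall>x\<in>X. P x \<noteq> 0 \<longrightarrow> True)"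
    by (rule exI[of _ "\<lambda>_. 1"]) (use zero_in_X in auto)
next
  fix \<phi> \<psi>
  assume "\<exists>P. polyfun n P \<and> (\<exists>x\<in>X. P x \<noteq> 0) \<and> (\<forall>x\<in>X. P x \<noteq> 0 \<longrightarrow> \<phi> x)"
    "\<exists>P. polyfun n P \<and> (\<exists>x\<in>X. P x \<noteq> 0) \<and> (\<forall>x\<in>X. P x \<noteq> 0 \<longrightarrow> \<psi> x)"
  then obtain P Q where PQ: "polyfun n P" "\<exists>x\<in>X. P x \<noteq> 0" "\<forall>x\<in>X. P x \<noteq> 0 \<longrightarrow> \<phi> x"
    "polyfun n Q" "\<exists>x\<in>X. Q x \<noteq> 0" "\<forall>x\<in>X. Q x \<noteq> 0 \<longrightarrow> \<psi> x" by blast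
  have "\<exists>x\<in>X. P x * Q x \<noteq> 0" using prime[OF PQ(1,4)] PQ(2,5) by (auto simp: X_def)
  then show "\<exists>P. polyfun n P \<and> (\<exists>x\<in>X. P x \<noteq> 0) \<and> (\<forall>x\<in>X. P x \<noteq> 0 \<longrightarrow> \<phi> x \<and> \<psi> x)"
    using PQ by (intro exI[of _ "\<lambda>x. P x * Q x"]) auto
next
  fix \<phi> \<psi> :: "(nat \<Rightarrow> 'k) \<Rightarrow> bool"
  assume "\<forall>x. \<phi> x \<longrightarrow> \<psi> x" "\<exists>P. polyfun n P \<and> (\<exists>x\<in>X. P x \<noteq> 0) \<and> (\<forall>x\<in>X. P x \<noteq> 0 \<longrightarrow> \<phi> x)"
  then show "\<exists>P. polyfun n P \<and> (\<exists>x\<in>X. P x \<noteq> 0) \<and> (\<forall>x\<in>X. P x \<noteq> 0 \<longrightarrow> \<psi> x)" by blast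
qed

lemma gen_neq_bot: "gen \<noteq> bot"
  unfolding trivial_limit_def eventually_gen by blast

lemma eventually_gen_X: "eventually (\<lambda>x. x \<in> X) gen"
  unfolding eventually_gen by (rule exI[of _ "\<lambda>_. 1"]) (use zero_in_X in auto)

lemma eventually_gen_polyfun: "polyfun n P \<Longrightarrow> x \<in> X \<Longrightarrow> P x \<noteq> 0 \<Longrightarrow> eventually (\<lambda>x. P x \<noteq> 0) gen"
  unfolding eventually_gen by blast

lemma vanishes_if_frequently_0:
  assumes "polyfun n P" "frequently (\<lambda>x. P x = 0) gen" "x \<in> X"
  shows "P x = 0"
  using eventually_gen_polyfun[OF assms(1,3)] assms(2) by (auto simp: frequently_def)

text \<open>Vanishing on a dense subset of \<open>X\<close> means vanishing on \<open>X\<close>,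
  hence divisibility by \<open>F\<close>, and below degree \<open>d\<close> this leaves only
  zero.\<close>

lemma low_degree_eq_0:
  assumes "polyfun n f" "homog m f" "m < d" "frequently (\<lambda>x. f x = 0) gen"
  shows "f x = 0"
proof -
  obtain Q where "polyfun n Q" "\<forall>x. f x = F x * Q x"
    using nullstellensatz[OF assms(1)] vanishes_if_frequently_0[OF assms(1,4)] by (auto simp: X_def)
  then show ?thesis
    using homog_multiple_eq_0[OF assms(1,2) polyfun_F homog_F _ assms(3)] by blast
qed

lemma low_degree_eventually:
  assumes "polyfun n f" "homog m f" "m < d" "f x \<noteq> 0"
  shows "eventually (\<lambda>x. f x \<noteq> 0) gen"
  using low_degree_eq_0[OF assms(1-3), of x] assms(4) by (auto simp: frequently_def)

text \<open>Evaluation at \<open>p\<close> is well defined on polynomial functions restricted to a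
  dense subset of \<open>X\<close>, because such a function is zero on \<open>X\<close> once it is
  zero there. Extending it to a place lets the points satisfying \<open>\<phi>\<close> specialize to
  \<open>p\<close>.\<close>

lemma generic_place:
  assumes "frequently \<phi> gen" "p \<in> X"
  shows "\<exists>G. place {x \<in> X. \<phi> x} G \<and> (\<forall>f. polyfun n f \<longrightarrow> (f, f p) \<in> G)"
proof -
  define A where "A = {(f, f p) |f. polyfun n f}"
  have "partial_hom {x \<in> X. \<phi> x} A"
    unfolding partial_hom_def
  proof (intro conjI allI impI)
    fix f a assume f: "(f, a) \<in> A" "\<forall>x\<in>{x \<in> X. \<phi> x}. f x = 0"
    have "f p = 0"
    proof (rule ccontr)
      assume "f p \<noteq> 0"
      then have "eventually (\<lambda>x. f x \<noteq> 0) gen"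
        using f(1) assms(2) eventually_gen_polyfun unfolding A_def by blast
      with eventually_gen_X have "eventually (\<lambda>x. \<not> \<phi> x) gen"
        by eventually_elim (use f(2) in auto)
      then show False using assms(1) by (simp add: frequently_def)
    qed
    then show "a = 0" using f(1) unfolding A_def by blast
  qed (auto simp: A_def)
  then obtain G where "place {x \<in> X. \<phi> x} G" "A \<subseteq> G" using place_exists[OF alg] by blast
  then show ?thesis unfolding A_def by blast
qed

section \<open>Specialization of linear divisors\<close>

text \<open>Dimensions are those of vector spaces: \<open>n - 1\<close> is projective dimension
  \<open>n - 2\<close>, one less than that of the hypersurface.\<close>

definition covered :: "(nat \<Rightarrow> 'k) \<Rightarrow> bool" where
  "covered p \<longleftrightarrow> (\<exists>W. fv.subspace W \<and> W \<subseteq> vecs n \<and> fv.dim W = n - 1 \<and> p \<in> W \<and> (\<forall>q\<in>W. F q = 0))"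

text \<open>Each divisor near \<open>p\<close> is spanned by its point \<open>x\<close> and its
  intersection with a coordinate hyperplane that avoids \<open>p\<close>. Limits of these
  intersections along a place, together with \<open>p\<close>, span the divisor wanted;
  \<open>p\<close> is independent of them since only it has a nonzero coordinate at
  \<open>k\<close>.\<close>

lemma covered_closed:
  assumes ev: "eventually covered gen" and n: "n \<ge> 2" and p: "p \<in> X" "p \<noteq> 0"
  shows "\<exists>v. lin_frame n (n - 2) v \<and> in_span (n - 2) v p \<and> (\<forall>q. in_span (n - 2) v q \<longrightarrow> F q = 0)"
proof -
  have "frequently covered gen" using ev gen_neq_bot by (simp add: eventually_frequently)
  then obtain G where G: "place {x \<in> X. covered x} G" "\<And>f. polyfun n f \<Longrightarrow> (f, f p) \<in> G"
    using generic_place p(1) by blast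
  obtain k where k: "k \<le> n" "p k \<noteq> 0"
  proof -
    obtain k where "p k \<noteq> 0" using p(2) by (auto simp: fun_eq_iff)
    moreover from this have "k \<le> n" using p(1) by (auto simp: X_def vecs_def vec_in_def not_less[symmetric])
    ultimately show ?thesis using that by blast
  qed
  define S where "S = {x \<in> X. covered x} \<inter> {x. x k \<noteq> 0}"
  have S: "place S G"
    unfolding S_def by (rule place_ne_0[OF G(1) G(2)]) (use k in auto)
  have "\<exists>W. fv.subspace W \<and> W \<subseteq> vecs n \<and> fv.dim W = n - 1 \<and> x \<in> W \<and> (\<forall>q\<in>W. F q = 0)" if "x \<in> S" for x
    using that unfolding S_def covered_def by blast
  then obtain W where W: "\<And>x. x \<in> S \<Longrightarrow> fv.subspace (W x)" "\<And>x. x \<in> S \<Longrightarrow> W x \<subseteq> vecs n"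
    "\<And>x. x \<in> S \<Longrightarrow> fv.dim (W x) = n - 1" "\<And>x. x \<in> S \<Longrightarrow> x \<in> W x" "\<And>x q. x \<in> S \<Longrightarrow> q \<in> W x \<Longrightarrow> F q = 0"
    by metis
  define V where "V x = W x \<inter> {y. lin_form n (unit_vec k) y = 0}" for x
  have form: "lin_form n (unit_vec k) y = y k" for y
  proof -
    have "lin_form n (unit_vec k) y = (\<Sum>i\<le>n. if i = k then y i else 0)"
      unfolding lin_form_def by (intro sum.cong) (auto simp: unit_vec_def)
    then show ?thesis using k(1) by simp
  qed
  have V: "fv.subspace (V x) \<and> V x \<subseteq> vecs n \<and> fv.dim (V x) = n - 2" if x: "x \<in> S" for x
  proof -
    have "x k \<noteq> 0" using x by (simp add: S_def)
    then have "Suc (fv.dim (V x)) = n - 1"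
      using dim_ker[OF W(1,2)[OF x] W(4)[OF x], of n "unit_vec k"] W(3)[OF x] by (simp add: V_def form)
    moreover have "fv.subspace (V x)" unfolding V_def by (rule subspace_ker[OF W(1)[OF x]])
    moreover have "V x \<subseteq> vecs n" using W(2)[OF x] unfolding V_def by blast
    ultimately show ?thesis by linarith
  qed
  have "\<exists>S' w w0. limit_frame G n (n - 2) S V S' w w0" by (rule place_limit_subspace[OF S]) (rule V)
  then obtain S' w w0 where S': "S' \<subseteq> S" "place S' G" and w: "\<forall>j<n-2. \<forall>x\<in>S'. w j x \<in> V x"
    "\<forall>j<n-2. \<forall>i. ((\<lambda>x. w j x i), w0 j i) \<in> G" "\<forall>j<n-2. w0 j \<in> vecs n"
    and ind: "\<forall>c. (\<forall>i. (\<Sum>j<n-2. c j * w0 j i) = 0) \<longrightarrow> (\<forall>j<n-2. c j = 0)"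
    unfolding limit_frame_def by (elim exE conjE) (rule that)
  note G' = place_partial_hom[OF S'(2)]
  define v where "v j = (case j of 0 \<Rightarrow> p | Suc j \<Rightarrow> w0 j)" for j
  have comb: "lincomb (n - 2) c v i = c 0 * p i + (\<Sum>j<n-2. c (Suc j) * w0 j i)" for c i
    unfolding lincomb_def by (simp add: sum.atMost_shift v_def)
  have w0k: "w0 j k = 0" if "j < n - 2" for j
    by (rule partial_hom_zero[OF G', of "\<lambda>x. w j x k"]) (use w that in \<open>auto simp: V_def form\<close>)
  have "lin_frame n (n - 2) v"
    unfolding lin_frame_def
  proof (intro conjI allI impI)
    fix j assume "j \<le> n - 2"
    then show "vec_in n (v j)" using w(3) p(1) by (auto simp: v_def X_def vecs_def split: nat.split)
  next
    fix c j assume 0: "lincomb (n - 2) c v = (\<lambda>_. 0)" and j: "j \<le> n - 2"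
    have "c 0 = 0" using fun_cong[OF 0, of k] w0k k by (simp add: comb)
    then have "\<forall>i. (\<Sum>j<n-2. c (Suc j) * w0 j i) = 0" using 0 by (auto simp: fun_eq_iff comb)
    then have "\<forall>j<n-2. c (Suc j) = 0" using ind[rule_format, of "\<lambda>j. c (Suc j)"] by blast
    then show "c j = 0" using \<open>c 0 = 0\<close> j by (cases j) auto
  qed
  moreover have "in_span (n - 2) v p"
    unfolding in_span_def by (rule exI[of _ "\<lambda>j. if j = 0 then 1 else 0"]) (simp add: fun_eq_iff comb)
  moreover have "F q = 0" if q: "in_span (n - 2) v q" for q
  proof -
    obtain c where c: "q = lincomb (n - 2) c v" using q unfolding in_span_def by blast
    define u where "u x = c 0 \<cdot> x + (\<Sum>j<n-2. c (Suc j) \<cdot> w j x)" for x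
    have "((\<lambda>x. F (u x)), F q) \<in> G"
    proof (rule polyfun_lim[OF G' _ polyfun_F])
      fix i assume i: "i \<le> n"
      have "((\<lambda>x. c 0 * x i + (\<Sum>j<n-2. c (Suc j) * w j x i)), c 0 * p i + (\<Sum>j<n-2. c (Suc j) * w0 j i)) \<in> G"
        by (intro partial_hom_add[OF G'] partial_hom_sum[OF G'] partial_hom_cmult[OF G'])
           (use w(2) G(2)[OF polyfun.coord[OF i]] in auto)
      then show "((\<lambda>x. u x i), q i) \<in> G" by (simp add: u_def c comb sum_fun_apply)
    qed
    then show ?thesis
    proof (rule partial_hom_zero[OF G'])
      fix x assume x: "x \<in> S'"
      then have xS: "x \<in> S" using S' by blast
      have "u x \<in> W x"
        unfolding u_def using W(1,4)[OF xS] w(1) x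
        by (intro fv.subspace_add fv.subspace_sum fv.subspace_scale) (auto simp: V_def)
      then show "F (u x) = 0" using W(5)[OF xS] by blast
    qed
  qed
  ultimately show ?thesis by blast
qed

end

section \<open>The second fundamental form\<close>

text \<open>The extra factor \<open>f x\<close> avoids the exponent \<open>b - 1\<close>.\<close>

lemma dd_power_times:
  fixes f :: "(nat \<Rightarrow> 'k::field_char_0) \<Rightarrow> 'k"
  assumes "polyfun n f"
  shows "f x * dd w (\<lambda>x. f x ^ b) x = of_nat b * f x ^ b * dd w f x"
proof (induction b)
  case (Suc b)
  have pf: "polyfun n (\<lambda>x. f x ^ b)" using assms by (rule polyfun_power)
  have expand: "dd w (\<lambda>x. f x * f x ^ b) x = dd w f x * f x ^ b + f x * dd w (\<lambda>x. f x ^ b) x"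
    using fun_cong[OF dd_mult[OF assms pf, of w], of x] .
  have "f x * dd w (\<lambda>x. f x * f x ^ b) x = f x * f x ^ b * dd w f x + f x * (of_nat b * f x ^ b * dd w f x)"
    unfolding expand distrib_left Suc by (simp add: algebra_simps)
  also have "\<dots> = of_nat (Suc b) * (f x * f x ^ b) * dd w f x"
    by (simp add: algebra_simps)
  finally show ?case by (simp only: power_Suc)
qed simp

lemma polyfun_nonzero_nearby:
  assumes "polyfun n f" "f x \<noteq> 0"
  shows "\<exists>t. t \<noteq> 0 \<and> f (x + t \<cdot> y) \<noteq> 0"
proof -
  have "coeff (tay f x y) 0 \<noteq> 0" using coeff_0_tay[OF assms(1)] assms(2) by simp
  then have "tay f x y \<noteq> 0" by force
  then have "[:0, 1:] * tay f x y \<noteq> 0" by simp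
  then obtain t where "poly ([:0, 1:] * tay f x y) t \<noteq> 0" using poly_all_0_iff_0 by blast
  then show ?thesis using poly_tay[OF assms(1)] by auto
qed

lemma subspace_Un_cases:
  assumes "fv.subspace V" "fv.subspace M1" "fv.subspace M2" "V \<subseteq> M1 \<union> M2"
  shows "V \<subseteq> M1 \<or> V \<subseteq> M2"
proof (rule ccontr)
  assume "\<not> (V \<subseteq> M1 \<or> V \<subseteq> M2)"
  then obtain v w where vw: "v \<in> V" "v \<notin> M1" "w \<in> V" "w \<notin> M2" by blast
  then have M: "v \<in> M2" "w \<in> M1" using assms(4) by auto
  have "v + w \<in> V" using vw assms(1) by (simp add: fv.subspace_add)
  then consider "v + w \<in> M1" | "v + w \<in> M2" using assms(4) by blast
  then show False
  proof cases
    case 1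
    then have "(v + w) - w \<in> M1" using M assms(2) by (intro fv.subspace_diff)
    then show False using vw by simp
  next
    case 2
    then have "(v + w) - v \<in> M2" using M assms(3) by (intro fv.subspace_diff)
    then show False using vw by simp
  qed
qed

lemma outside_span:
  fixes W :: "(nat \<Rightarrow> 'k::field_char_0) set"
  assumes "finite A" "card A < fv.dim W"
  shows "\<exists>x\<in>W. x \<notin> fv.span A"
proof (rule ccontr)
  assume "\<not> (\<exists>x\<in>W. x \<notin> fv.span A)"
  then have "fv.dim W \<le> card A" using assms(1) by (intro fv.dim_le_card) auto
  then show False using assms(2) by simp
qed

context hypersurface
begin

section \<open>Gradient, Hessian and tangent hyperplane\<close>

definition g :: "(nat \<Rightarrow> 'k) \<Rightarrow> (nat \<Rightarrow> 'k) \<Rightarrow> 'k" where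
  "g p v = dd v F p"

definition H :: "(nat \<Rightarrow> 'k) \<Rightarrow> (nat \<Rightarrow> 'k) \<Rightarrow> (nat \<Rightarrow> 'k) \<Rightarrow> 'k" where
  "H p u v = dd u (dd v F) p"

definition T :: "(nat \<Rightarrow> 'k) \<Rightarrow> (nat \<Rightarrow> 'k) set" where
  "T p = {v \<in> vecs n. g p v = 0}"

definition smooth :: "(nat \<Rightarrow> 'k) \<Rightarrow> bool" where
  "smooth p \<longleftrightarrow> p \<in> X \<and> (\<exists>v\<in>vecs n. g p v \<noteq> 0)"

lemma g_form: "g p v = lin_form n (\<lambda>i. g p (unit_vec i)) v"
  unfolding g_def lin_form_def unit_vec_def by (subst dd_expand[OF polyfun_F]) (simp add: mult.commute)

lemma H_form: "H p v u = lin_form n (\<lambda>i. H p (unit_vec i) u) v"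
  unfolding H_def lin_form_def unit_vec_def
  by (subst dd_expand[OF polyfun_dd[OF polyfun_F]]) (simp add: mult.commute)

lemma g_linear: "g p (u + v) = g p u + g p v" "g p (u - v) = g p u - g p v" "g p (c \<cdot> v) = c * g p v"
  unfolding g_form[of p "u + v"] g_form[of p "u - v"] g_form[of p "c \<cdot> v"]
    g_form[of p u] g_form[of p v] by (simp_all only: lin_form_add lin_form_diff lin_form_scl)

lemma H_sym: "H p u v = H p v u"
  unfolding H_def using dd_commute[OF polyfun_F] by metis

lemma H_left: "H p (u + v) w = H p u w + H p v w" "H p (u - v) w = H p u w - H p v w"
    "H p (c \<cdot> v) w = c * H p v w"
  unfolding H_form[of p "u + v"] H_form[of p "u - v"] H_form[of p "c \<cdot> v"]
    H_form[of p u] H_form[of p v] by (simp_all only: lin_form_add lin_form_diff lin_form_scl)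

lemma H_right: "H p w (u + v) = H p w u + H p w v" "H p w (u - v) = H p w u - H p w v"
    "H p w (c \<cdot> v) = c * H p w v"
  using H_left[of p] H_sym[of p] by metis+

lemma T_eq: "T p = vecs n \<inter> {v. lin_form n (\<lambda>i. g p (unit_vec i)) v = 0}"
  unfolding T_def by (auto simp flip: g_form)

lemma subspace_T: "fv.subspace (T p)"
  unfolding T_eq by (rule subspace_ker[OF subspace_vecs])

lemma T_vecs: "T p \<subseteq> vecs n"
  by (auto simp: T_def)

lemma dim_T: "smooth p \<Longrightarrow> fv.dim (T p) = n"
proof -
  assume "smooth p"
  then obtain v where v: "v \<in> vecs n" "g p v \<noteq> 0" unfolding smooth_def by blast
  have "Suc (fv.dim (T p)) = fv.dim (vecs n :: (nat \<Rightarrow> 'k) set)"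
    unfolding T_eq by (rule dim_ker[OF subspace_vecs subset_refl v(1)]) (simp add: v(2) flip: g_form)
  then show ?thesis by (simp add: dim_vecs)
qed

lemma homog_g: "homog (d - 1) (\<lambda>x. g x v)"
  unfolding g_def using homog_dd[OF polyfun_F, of "d - 1" v] homog_F d_ge by simp

lemma polyfun_g: "polyfun n (\<lambda>x. g x v)"
  unfolding g_def by (rule polyfun_dd[OF polyfun_F])

lemma polyfun_H: "polyfun n (\<lambda>x. H x u v)"
  unfolding H_def by (intro polyfun_dd polyfun_F)

lemma g_self: "g p p = of_nat d * F p"
  unfolding g_def by (rule euler[OF polyfun_F homog_F])

lemma g_self_0: "p \<in> X \<Longrightarrow> g p p = 0"
  by (simp add: g_self X_def)

text \<open>Euler's relation for the derivatives of \<open>F\<close>. It puts \<open>p\<close> into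
  the radical of \<open>H p\<close> on \<open>T p\<close>, so that the form really lives on the
  quotient by \<open>p\<close>.\<close>

lemma H_self: "H p p v = of_nat (d - 1) * g p v"
  using euler[OF polyfun_g homog_g, of p v] unfolding H_def g_def by simp

lemma self_T: "p \<in> X \<Longrightarrow> p \<in> T p"
  by (simp add: T_def X_def g_self)

lemma H_self_T: "v \<in> T p \<Longrightarrow> H p p v = 0" "v \<in> T p \<Longrightarrow> H p v p = 0"
  using H_self H_sym by (auto simp: T_def)

lemma smooth_nonzero: "smooth p \<Longrightarrow> p \<noteq> 0"
proof
  assume "smooth p" "p = 0"
  then obtain v where v: "g 0 v \<noteq> 0" unfolding smooth_def by blast
  have "0 \<cdot> (0 :: nat \<Rightarrow> 'k) = 0" by (simp add: fun_eq_iff)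
  then have "g 0 v = 0 ^ (d - 1) * g 0 v" using homog_g[of v] unfolding homog_def by metis
  then show False using v d_ge by (simp add: power_0_left)
qed

lemma nonzero_point: "\<exists>x\<in>vecs n. F x \<noteq> 0"
proof -
  obtain x where x: "F x \<noteq> 0" using F_nonzero by blast
  have "F (\<lambda>i. if i \<le> n then x i else 0) = F x"
    by (rule polyfun_cong[OF polyfun_F]) simp
  then show ?thesis using x by (intro bexI[of _ "\<lambda>i. if i \<le> n then x i else 0"]) (auto simp: vecs_def vec_in_def)
qed

text \<open>The derivative in direction \<open>e\<close> is a form of degree \<open>d - 1\<close> in
  \<open>x\<close>, nonzero because at \<open>e\<close> itself it equals
  \<open>d * F e\<close>.\<close>

lemma gradient_eventually:
  assumes "F e \<noteq> 0"
  shows "eventually (\<lambda>x. g x e \<noteq> 0) gen"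
  by (rule low_degree_eventually[OF polyfun_g homog_g, of e e]) (use d_ge assms g_self in auto)

lemma smooth_eventually: "eventually smooth gen"
proof -
  obtain e where e: "e \<in> vecs n" "F e \<noteq> 0" using nonzero_point by blast
  show ?thesis
    using gradient_eventually[OF e(2)] eventually_gen_X
    by eventually_elim (use e in \<open>auto simp: smooth_def\<close>)
qed

lemma contained_subspace:
  assumes "fv.subspace V" "p \<in> V" "\<And>q. q \<in> V \<Longrightarrow> F q = 0" "v \<in> V"
  shows "g p v = 0" "H p v v = 0"
proof -
  have "F (p + t \<cdot> v) = 0" for t
    using assms by (intro assms(3) fv.subspace_add fv.subspace_scale)
  from dd_eq_0_of_line[OF polyfun_F this] show "g p v = 0" "H p v v = 0"
    by (simp_all add: g_def H_def)
qed

text \<open>An irreducible form of degree at least two has no linear factor \<open>l\<close>. By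
  degree, \<open>l\<close> does not vanish on \<open>X\<close>; so in \<open>F = l * Q\<close> the
  factor \<open>Q\<close> does, which gives \<open>Q = F * Q2\<close> and \<open>l * Q2 = 1\<close>.
  Along a ray this is a polynomial identity, and it fails at the origin.\<close>

lemma not_vanishing_on_hyperplane:
  assumes e: "e \<in> vecs n" "lin_form n a e \<noteq> 0" and 0: "\<And>x. x \<in> vecs n \<Longrightarrow> lin_form n a x = 0 \<Longrightarrow> F x = 0"
  shows False
proof -
  let ?l = "lin_form n a"
  define e' where "e' = (1 / ?l e) \<cdot> e"
  have e': "e' \<in> vecs n" "?l e' = 1"
    using e by (auto simp: e'_def lin_form_scl intro: fv.subspace_scale[OF subspace_vecs])
  obtain Q where Q: "polyfun n Q" "\<And>x. F x - F (x - ?l x \<cdot> e') = ?l x * Q x"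
    using polyfun_divide_linear[OF polyfun_F polyfun_lin_form] by metis
  have FQ: "F x = ?l x * Q x" if "x \<in> vecs n" for x
  proof -
    have "F (x - ?l x \<cdot> e') = 0"
      using that e' by (intro 0 fv.subspace_diff fv.subspace_scale subspace_vecs)
        (simp_all add: lin_form_diff lin_form_scl)
    then show ?thesis using Q(2)[of x] by simp
  qed
  have "\<not> (\<forall>x\<in>vecs n. F x = 0 \<longrightarrow> ?l x = 0)"
  proof
    assume "\<forall>x\<in>vecs n. F x = 0 \<longrightarrow> ?l x = 0"
    moreover have "eventually (\<lambda>x. ?l x \<noteq> 0) gen"
    proof (rule low_degree_eventually[OF polyfun_lin_form _ _ e(2)])
      show "homog 1 ?l" by (simp add: homog_def lin_form_scl)
    qed (use d_ge in simp)
    then have "eventually (\<lambda>x. \<exists>y. y \<in> X \<and> ?l y \<noteq> 0) gen"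
      using eventually_gen_X by eventually_elim blast
    then have "\<exists>y. y \<in> X \<and> ?l y \<noteq> 0" using gen_neq_bot by simp
    ultimately show False by (auto simp: X_def)
  qed
  then have "\<forall>x\<in>vecs n. F x = 0 \<longrightarrow> Q x = 0"
    using prime[OF polyfun_lin_form[of n a] Q(1)] FQ by auto
  then obtain Q2 where Q2: "polyfun n Q2" "\<And>x. Q x = F x * Q2 x"
    using nullstellensatz[OF Q(1)] by blast
  obtain x where x: "x \<in> vecs n" "F x \<noteq> 0" using nonzero_point by blast
  define P where "P = [:0, ?l x:] * tay Q2 0 x - 1"
  have "poly ([:0, 1:] * P) t = 0" for t
  proof (cases "t = 0")
    case False
    have "F (t \<cdot> x) = t ^ d * F x" using homog_F by (simp add: homog_def)
    then have nz: "F (t \<cdot> x) \<noteq> 0" using False x by simp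
    have "F (t \<cdot> x) = ?l (t \<cdot> x) * Q (t \<cdot> x)"
      by (rule FQ[OF fv.subspace_scale[OF subspace_vecs x(1)]])
    then have "F (t \<cdot> x) = F (t \<cdot> x) * (t * ?l x * Q2 (t \<cdot> x))"
      by (simp only: Q2(2) lin_form_scl ac_simps)
    then have "t * ?l x * Q2 (t \<cdot> x) = 1" using nz mult_cancel_left1[of "F (t \<cdot> x)"] by blast
    then show ?thesis by (simp add: P_def poly_tay[OF Q2(1)] mult.assoc)
  qed simp
  then have "[:0, 1:] * P = 0" using poly_all_0_iff_0 by blast
  then have "P = 0" by simp
  then have "poly P 0 = 0" by simp
  then show False by (simp add: P_def)
qed

text \<open>If \<open>H p\<close> vanished on \<open>T p\<close> at the general point, then the ideal \<open>(F, D\<^sub>w F)\<close> would be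
  stable under \<open>D\<^sub>w\<close> after inverting \<open>D\<^sub>e F\<close>, so every line through \<open>p\<close> in the tangent
  hyperplane would lie on the hypersurface.\<close>

lemma second_form_nonzero: "eventually (\<lambda>p. \<exists>u\<in>T p. H p u u \<noteq> 0) gen"
proof (rule ccontr)
  assume "\<not> eventually (\<lambda>p. \<exists>u\<in>T p. H p u u \<noteq> 0) gen"
  then have freq: "frequently (\<lambda>p. \<forall>u\<in>T p. H p u u = 0) gen" by (simp add: frequently_def)
  obtain e where e: "e \<in> vecs n" "F e \<noteq> 0" using nonzero_point by blast
  define G where "G x = g x e" for x
  have pG: "polyfun n G" unfolding G_def[abs_def] by (rule polyfun_g)
  obtain p where p: "p \<in> X" "G p \<noteq> 0"
  proof -
    have "eventually (\<lambda>x. \<exists>y. y \<in> X \<and> G y \<noteq> 0) gen"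
      using gradient_eventually[OF e(2)] eventually_gen_X
      by eventually_elim (auto simp: G_def)
    then have "\<exists>y. y \<in> X \<and> G y \<noteq> 0" using gen_neq_bot by simp
    then show ?thesis using that by blast
  qed
  have line: "F (p + t \<cdot> w) = 0" if w: "w \<in> T p" for w t
  proof -
    let ?Dw = "dd w F"
    \<comment> \<open>With denominators cleared, this is \<open>H x u u\<close> for the projection
      \<open>u\<close> of \<open>w\<close> into \<open>T x\<close> along \<open>e\<close>.\<close>
    define \<Psi> where "\<Psi> x = G x * G x * H x w w - 2 * G x * ?Dw x * H x w e + ?Dw x * ?Dw x * H x e e" for x
    have p\<Psi>: "polyfun n \<Psi>"
      unfolding \<Psi>_def[abs_def] by (intro polyfun_diff polyfun.add polyfun.mult pG polyfun_H polyfun_dd polyfun_F polyfun.const)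
    have wv: "w \<in> vecs n" using w by (simp add: T_def)
    have "frequently (\<lambda>x. \<Psi> x = 0) gen"
      using freq
    proof (rule frequently_elim1)
      fix x assume x: "\<forall>u\<in>T x. H x u u = 0"
      let ?u = "G x \<cdot> w - ?Dw x \<cdot> e"
      have "g x ?u = 0" by (simp only: g_linear) (simp add: G_def g_def)
      moreover have "?u \<in> vecs n"
        using wv e by (intro fv.subspace_diff fv.subspace_scale subspace_vecs)
      ultimately have "H x ?u ?u = 0" using x by (simp add: T_def)
      moreover have "H x ?u ?u = \<Psi> x"
        by (simp only: H_left H_right H_sym[of x e w] \<Psi>_def) (simp add: algebra_simps)
      ultimately show "\<Psi> x = 0" by simp
    qed
    then have "\<And>x. x \<in> vecs n \<Longrightarrow> F x = 0 \<Longrightarrow> \<Psi> x = 0"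
      using vanishes_if_frequently_0[OF p\<Psi>] by (auto simp: X_def)
    then obtain Q where Q: "polyfun n Q" "\<And>x. \<Psi> x = F x * Q x" using nullstellensatz[OF p\<Psi>] by blast
    have "\<exists>b U V. polyfun n U \<and> polyfun n V \<and> (\<forall>x. G x ^ b * (dd w ^^ j) F x = U x * F x + V x * ?Dw x)" for j
    proof (induction j)
      case 0
      show ?case by (intro exI[of _ 0] exI[of _ "\<lambda>_. 1"] exI[of _ "\<lambda>_. 0"]) auto
    next
      case (Suc j)
      then obtain b U V where UV: "polyfun n U" "polyfun n V"
        "\<And>x. G x ^ b * (dd w ^^ j) F x = U x * F x + V x * ?Dw x" by blast
      let ?E = "(dd w ^^ j) F"
      have pE: "polyfun n ?E" by (induction j) (use polyfun_F in auto)
      have "dd w (\<lambda>x. G x ^ b * ?E x) = dd w (\<lambda>x. U x * F x + V x * ?Dw x)"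
        using UV(3) by presburger
      then have D: "dd w (\<lambda>x. G x ^ b) x * ?E x + G x ^ b * dd w ?E x =
          dd w U x * F x + U x * ?Dw x + (dd w V x * ?Dw x + V x * H x w w)" for x
        using pE UV(1,2) pG polyfun_F
        by (simp add: dd_mult[of n] dd_add[of n] polyfun_power polyfun_dd polyfun.mult H_def fun_eq_iff)
      \<comment> \<open>Differentiate the relation for \<open>j\<close> in direction
        \<open>w\<close>, multiply by \<open>G x * G x\<close>, and replace
        \<open>G x * G x * H x w w\<close> by means of \<open>\<Psi> x = F x * Q x\<close>.\<close>
      define U' where "U' x = G x * G x * dd w U x + V x * Q x - of_nat b * dd w G x * G x * U x" for x
      define V' where "V' x = G x * G x * (U x + dd w V x) +
        V x * (2 * G x * H x w e - ?Dw x * H x e e) - of_nat b * dd w G x * G x * V x" for x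
      have "polyfun n U'" "polyfun n V'"
        unfolding U'_def[abs_def] V'_def[abs_def]
        by (intro polyfun_diff polyfun.add polyfun.mult pG polyfun_H polyfun_dd polyfun_F polyfun.const UV(1,2) Q(1))+
      moreover have "G x ^ (b + 2) * (dd w ^^ Suc j) F x = U' x * F x + V' x * ?Dw x" for x
      proof -
        have pw: "G x * dd w (\<lambda>x. G x ^ b) x = of_nat b * G x ^ b * dd w G x"
          by (rule dd_power_times[OF pG])
        have "G x ^ (b + 2) * (dd w ^^ Suc j) F x = G x * G x * (G x ^ b * dd w ?E x)"
          by (simp add: power2_eq_square power_add)
        also have "\<dots> = G x * G x * (dd w U x * F x + U x * ?Dw x + (dd w V x * ?Dw x + V x * H x w w))
            - G x * (G x * dd w (\<lambda>x. G x ^ b) x) * ?E x"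
          unfolding D[of x, symmetric] by (simp add: algebra_simps)
        also have "G x * (G x * dd w (\<lambda>x. G x ^ b) x) * ?E x = of_nat b * dd w G x * G x * (G x ^ b * ?E x)"
          unfolding pw by (simp only: ac_simps)
        also have "\<dots> = of_nat b * dd w G x * G x * (U x * F x + V x * ?Dw x)"
          unfolding UV(3) ..
        also have "G x * G x * (dd w U x * F x + U x * ?Dw x + (dd w V x * ?Dw x + V x * H x w w)) =
            G x * G x * (dd w U x * F x + (U x + dd w V x) * ?Dw x) + V x * (G x * G x * H x w w)"
          by (simp add: algebra_simps)
        also have "G x * G x * H x w w = F x * Q x + (2 * G x * H x w e - ?Dw x * H x e e) * ?Dw x"
          unfolding Q(2)[symmetric] \<Psi>_def by (simp add: algebra_simps)
        finally show ?thesis unfolding U'_def V'_def by (simp add: algebra_simps)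
      qed
      ultimately show ?case by blast
    qed
    note ideal = this
    have "(dd w ^^ j) F p = 0" for j
    proof -
      obtain b U V where "\<And>x. G x ^ b * (dd w ^^ j) F x = U x * F x + V x * ?Dw x"
        using ideal by blast
      moreover have "F p = 0" "?Dw p = 0" using p w by (auto simp: X_def T_def g_def)
      ultimately have "G p ^ b * (dd w ^^ j) F p = 0" by simp
      then show ?thesis using p by simp
    qed
    then show ?thesis by (rule polyfun_eq_0_on_line[OF polyfun_F])
  qed
  show False
  proof (rule not_vanishing_on_hyperplane)
    show "e \<in> vecs n" by (rule e(1))
    show "lin_form n (\<lambda>i. g p (unit_vec i)) e \<noteq> 0"
      using p(2) g_form[of p e] unfolding G_def by simp
    fix x assume "x \<in> vecs n" "lin_form n (\<lambda>i. g p (unit_vec i)) x = 0"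
    then have "x \<in> T p" unfolding T_eq by blast
    then have "x - p \<in> T p" using self_T[OF p(1)] subspace_T fv.subspace_diff by blast
    then have "F (p + 1 \<cdot> (x - p)) = 0" by (rule line)
    moreover have "p + 1 \<cdot> (x - p) = x" by (simp add: fun_eq_iff)
    ultimately show "F x = 0" by simp
  qed
qed

section \<open>Rank of the second fundamental form\<close>

definition rank3 :: "(nat \<Rightarrow> 'k) \<Rightarrow> bool" where
  "rank3 p \<longleftrightarrow> (\<exists>u1\<in>T p. \<exists>u2\<in>T p. \<exists>u3\<in>T p. H p u1 u2 = 0 \<and> H p u1 u3 = 0 \<and> H p u2 u3 = 0 \<and>
    H p u1 u1 \<noteq> 0 \<and> H p u2 u2 \<noteq> 0 \<and> H p u3 u3 \<noteq> 0)"

text \<open>If the form vanished on the kernel of \<open>b\<close> in the span, \<open>b\<close>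
  would be nonzero at all three vectors. Scaled to \<open>b\<close>-value 1, their differences lie
  in the kernel, so the values of \<open>H p\<close> on them are pairwise opposite, which is
  impossible for three nonzero values.\<close>

lemma anisotropic_in_kernel:
  assumes o: "H p u1 u2 = 0" "H p u1 u3 = 0" "H p u2 u3 = 0"
    "H p u1 u1 \<noteq> 0" "H p u2 u2 \<noteq> 0" "H p u3 u3 \<noteq> 0"
  shows "\<exists>x\<in>fv.span {u1, u2, u3}. lin_form n b x = 0 \<and> H p x x \<noteq> 0"
proof (rule ccontr)
  assume neg: "\<not> ?thesis"
  let ?b = "lin_form n b"
  have span: "u1 \<in> fv.span {u1, u2, u3}" "u2 \<in> fv.span {u1, u2, u3}" "u3 \<in> fv.span {u1, u2, u3}"
    by (auto intro: fv.span_base)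
  have nz: "?b u1 \<noteq> 0" "?b u2 \<noteq> 0" "?b u3 \<noteq> 0" using neg span o by blast+
  have pair: "H p u u / (?b u * ?b u) + H p v v / (?b v * ?b v) = 0"
    if uv: "u \<in> fv.span {u1, u2, u3}" "v \<in> fv.span {u1, u2, u3}" "H p u v = 0" "?b u \<noteq> 0" "?b v \<noteq> 0" for u v
  proof -
    let ?x = "(1 / ?b u) \<cdot> u - (1 / ?b v) \<cdot> v"
    have "?x \<in> fv.span {u1, u2, u3}" using uv by (intro fv.span_diff fv.span_scale)
    moreover have "?b ?x = 0" using uv by (simp add: lin_form_diff lin_form_scl)
    ultimately have "H p ?x ?x = 0" using neg by blast
    moreover have "H p ?x ?x = H p u u / (?b u * ?b u) + H p v v / (?b v * ?b v)"
      using uv(3) H_sym[of p v u] by (simp only: H_left H_right) simp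
    ultimately show ?thesis by simp
  qed
  have "H p u1 u1 / (?b u1 * ?b u1) + H p u2 u2 / (?b u2 * ?b u2) = 0"
    "H p u1 u1 / (?b u1 * ?b u1) + H p u3 u3 / (?b u3 * ?b u3) = 0"
    "H p u2 u2 / (?b u2 * ?b u2) + H p u3 u3 / (?b u3 * ?b u3) = 0"
    using pair span o nz by blast+
  then have "2 * (H p u3 u3 / (?b u3 * ?b u3)) = 0" by algebra
  then show False using nz o by simp
qed

end

locale covered_sections = hypersurface +
  assumes n_ge: "n \<ge> 4"
    and sections: "\<And>a p. hyperplane_coeffs n a \<Longrightarrow> p \<in> X \<Longrightarrow> p \<noteq> 0 \<Longrightarrow> lin_form n a p = 0 \<Longrightarrow>
      \<exists>V. fv.subspace V \<and> V \<subseteq> vecs n \<and> fv.dim V = n - 2 \<and> p \<in> V \<and> (\<forall>q\<in>V. lin_form n a q = 0 \<and> F q = 0)"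
begin

text \<open>A linear subspace of \<open>X\<close> through \<open>p\<close> consists of tangent
  vectors. The condition on \<open>x\<close> makes the hyperplane different from \<open>T p\<close>,
  so \<open>V\<close> has codimension one in their intersection.\<close>

lemma tangent_section:
  assumes p: "smooth p" and a: "lin_form n a p = 0" "x \<in> T p" "lin_form n a x \<noteq> 0"
  shows "\<exists>V. fv.subspace V \<and> V \<subseteq> T p \<inter> {v. lin_form n a v = 0} \<and> fv.dim V = n - 2 \<and> p \<in> V \<and> (\<forall>q\<in>V. F q = 0)"
proof -
  have "hyperplane_coeffs n a"
  proof (rule ccontr)
    assume "\<not> hyperplane_coeffs n a"
    then have "lin_form n a x = 0"
      unfolding hyperplane_coeffs_def lin_form_def by (intro sum.neutral) auto
    then show False using a(3) by simp
  qed
  then obtain V where V: "fv.subspace V" "V \<subseteq> vecs n" "fv.dim V = n - 2" "p \<in> V"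
    "\<forall>q\<in>V. lin_form n a q = 0 \<and> F q = 0"
    using sections[of a p] p smooth_nonzero[OF p] a(1) unfolding smooth_def by blast
  have "V \<subseteq> T p"
    using contained_subspace(1)[OF V(1,4)] V unfolding T_def by blast
  then show ?thesis using V by blast
qed

lemma dim_tangent_section:
  assumes p: "smooth p" and a: "x \<in> T p" "lin_form n a x \<noteq> 0"
  shows "fv.dim (T p \<inter> {v. lin_form n a v = 0}) = n - 1"
  using dim_ker[OF subspace_T T_vecs a] dim_T[OF p] by simp

text \<open>For \<open>n \<ge> 5\<close> there is room for a hyperplane of \<open>T p\<close>
  through \<open>p\<close>, \<open>u1\<close>, \<open>u2\<close> and \<open>u3\<close>. The divisor
  \<open>V\<close> has codimension one in it, so it contains the kernel of a linear form on the span
  of the three vectors, where an anisotropic vector exists; but \<open>V\<close> is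
  isotropic.\<close>

lemma rank3_n_eq_4:
  assumes p: "smooth p" "rank3 p"
  shows "n = 4"
proof (rule ccontr)
  assume "n \<noteq> 4"
  then have n: "n \<ge> 5" using n_ge by simp
  obtain u1 u2 u3 where u: "u1 \<in> T p" "u2 \<in> T p" "u3 \<in> T p" and
    o: "H p u1 u2 = 0" "H p u1 u3 = 0" "H p u2 u3 = 0"
    "H p u1 u1 \<noteq> 0" "H p u2 u2 \<noteq> 0" "H p u3 u3 \<noteq> 0" using p(2) unfolding rank3_def by blast
  have "card {p, u1, u2, u3} \<le> 4" by (simp add: card_insert_if)
  then obtain x where x: "x \<in> T p" "x \<notin> fv.span {p, u1, u2, u3}"
    using outside_span[of "{p, u1, u2, u3}" "T p"] dim_T[OF p(1)] n by auto
  have "fv.span {p, u1, u2, u3} \<subseteq> T p"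
    using u self_T p(1) subspace_T by (intro fv.span_minimal) (auto simp: smooth_def)
  then obtain a where a: "\<forall>w\<in>fv.span {p, u1, u2, u3}. lin_form n a w = 0" "lin_form n a x = 1"
    using separating_form[OF fv.subspace_span, of x n] x T_vecs by blast
  let ?K = "T p \<inter> {v. lin_form n a v = 0}"
  have pa: "lin_form n a p = 0" using a(1) fv.span_base[of p] by blast
  obtain V where V: "fv.subspace V" "V \<subseteq> ?K" "fv.dim V = n - 2" "p \<in> V" "\<forall>q\<in>V. F q = 0"
    using tangent_section[OF p(1) pa x(1)] a(2) by auto
  have K: "fv.subspace ?K" "?K \<subseteq> vecs n" "fv.dim ?K = n - 1"
    using subspace_ker[OF subspace_T] T_vecs[of p] dim_tangent_section[OF p(1) x(1), of a] a(2) by auto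
  have "V \<noteq> ?K" using V(3) K(3) n by auto
  then obtain y where y: "y \<in> ?K" "y \<notin> V" using V(2) by blast
  then obtain b where b: "\<forall>w\<in>V. lin_form n b w = 0" "lin_form n b y = 1"
    using separating_form[OF V(1), of y n] V(2) K(2) by blast
  have "V = ?K \<inter> {v. lin_form n b v = 0}"
  proof (rule subspace_eq_vecs[where n = n, OF V(1)])
    show "fv.dim (?K \<inter> {v. lin_form n b v = 0}) \<le> fv.dim V"
      using dim_ker[OF K(1,2) y(1), of n b] b(2) K(3) V(3) by simp
  qed (use V(2) K(2) b in auto)
  moreover obtain v where v: "v \<in> fv.span {u1, u2, u3}" "lin_form n b v = 0" "H p v v \<noteq> 0"
    using anisotropic_in_kernel[OF o] by blast
  moreover have "v \<in> ?K"
    using v(1) a(1) u subspace_T fv.span_mono[of "{u1, u2, u3}" "{p, u1, u2, u3}"]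
      fv.span_minimal[of "{u1, u2, u3}" "T p"] by blast
  ultimately have "v \<in> V" by blast
  then show False using contained_subspace(2)[OF V(1,4)] V(5) v(3) by blast
qed

text \<open>Diagonalized, the form is \<open>h * x ^ 2\<close> or
  \<open>h * x ^ 2 + k * y ^ 2\<close>. With \<open>s ^ 2 = - h / k\<close> the sum of squares
  becomes a difference of squares and factors.\<close>

lemma split_form:
  assumes p: "smooth p" and r: "\<not> rank3 p" and u: "u \<in> T p" "H p u u \<noteq> 0"
  shows "\<exists>u'\<in>T p. \<exists>u''\<in>T p. H p u u' \<noteq> 0 \<and> H p u u'' \<noteq> 0 \<and> (\<forall>v\<in>T p. H p v v = H p v u' * H p v u'')"
proof (cases "\<forall>w\<in>T p. H p w u = 0 \<longrightarrow> H p w w = 0")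
  case True
  let ?h = "H p u u"
  have "H p v v = H p v u * H p v ((1 / ?h) \<cdot> u)" if v: "v \<in> T p" for v
  proof -
    let ?w = "v - (H p v u / ?h) \<cdot> u"
    have "?w \<in> T p" using v u subspace_T by (intro fv.subspace_diff fv.subspace_scale)
    moreover have "H p ?w u = 0" using u by (simp only: H_left) simp
    ultimately have "H p ?w ?w = 0" using True by blast
    then have "H p v v - H p v u * H p v u / ?h = 0"
      using u H_sym[of p u v] by (simp only: H_left H_right) (simp add: field_simps)
    then show ?thesis by (simp only: H_right) simp
  qed
  moreover have "(1 / ?h) \<cdot> u \<in> T p" using u subspace_T by (intro fv.subspace_scale)
  moreover have "H p u ((1 / ?h) \<cdot> u) \<noteq> 0" using u by (simp only: H_right) simp
  ultimately show ?thesis using u by blast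
next
  case False
  then obtain w where w: "w \<in> T p" "H p w u = 0" "H p w w \<noteq> 0" by blast
  let ?h = "H p u u" and ?k = "H p w w"
  have "degree [:?h / ?k, 0, 1:] \<ge> 1" by simp
  then obtain s where "poly [:?h / ?k, 0, 1:] s = 0" using alg unfolding alg_closed_field_def by blast
  then have "s * s = - (?h / ?k)" by (simp add: eq_neg_iff_add_eq_0 add.commute)
  then have s: "s * s * ?k = - ?h" using w by simp
  define u' where "u' = u - s \<cdot> w"
  define u'' where "u'' = (1 / ?h) \<cdot> (u + s \<cdot> w)"
  have T: "u' \<in> T p" "u'' \<in> T p"
    using u w subspace_T unfolding u'_def u''_def by (auto intro!: fv.subspace_diff fv.subspace_add fv.subspace_scale)
  have uw: "H p u w = 0" using w(2) H_sym by metis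
  have "H p u u' \<noteq> 0" unfolding u'_def using u by (simp only: H_right) (simp add: uw)
  moreover have "H p u u'' \<noteq> 0" unfolding u''_def using u by (simp only: H_right) (simp add: uw)
  moreover have "H p v v = H p v u' * H p v u''" if v: "v \<in> T p" for v
  proof -
    let ?y = "v - (H p v u / ?h) \<cdot> u - (H p v w / ?k) \<cdot> w"
    have y: "?y \<in> T p" using v u w subspace_T by (intro fv.subspace_diff fv.subspace_scale)
    have yu: "H p u ?y = 0" using u uw H_sym[of p u v] by (simp only: H_right) simp
    have yw: "H p w ?y = 0" using w H_sym[of p w v] by (simp only: H_right) simp
    have "H p ?y ?y = 0"
      using r u w y uw yu yw unfolding rank3_def by blast
    moreover have "H p ?y ?y = H p v ?y"
      by (simp only: H_left[of p _ _ ?y] yu yw) simp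
    moreover have "H p v ?y = H p v v - H p v u * H p v u / ?h - H p v w * H p v w / ?k"
      by (simp only: H_right) simp
    ultimately have "H p v v - H p v u * H p v u / ?h - H p v w * H p v w / ?k = 0" by metis
    then have "H p v v = H p v u * H p v u / ?h + H p v w * H p v w / ?k" by (simp add: diff_diff_eq)
    also have "\<dots> = (H p v u * H p v u - s * s * (H p v w * H p v w)) / ?h"
      using s u w by (simp add: field_simps) algebra
    also have "\<dots> = H p v u' * H p v u''"
      unfolding u'_def u''_def by (simp only: H_right) (simp add: field_simps)
    finally show ?thesis .
  qed
  ultimately show ?thesis using T by blast
qed

text \<open>Isotropic subspaces of \<open>T p\<close> lie in one of the kernels \<open>M u'\<close>,
  \<open>M u''\<close> of the two factors. If neither were contained in \<open>X\<close>, take a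
  hyperplane through \<open>p\<close> and a point off \<open>X\<close> on each of them. Its divisor
  \<open>V\<close> is isotropic, hence for dimension reasons equal to the intersection of one kernel
  with the hyperplane, and so it contains a chosen point.\<close>

lemma low_rank_covered:
  assumes p: "smooth p" "\<not> rank3 p" "\<exists>u\<in>T p. H p u u \<noteq> 0"
  shows "covered p"
proof -
  obtain u where u: "u \<in> T p" "H p u u \<noteq> 0" using p(3) by blast
  obtain u' u'' where u': "u' \<in> T p" "u'' \<in> T p" "H p u u' \<noteq> 0" "H p u u'' \<noteq> 0"
    and split: "\<And>v. v \<in> T p \<Longrightarrow> H p v v = H p v u' * H p v u''"
    using split_form[OF p(1,2) u] by blast
  define M where "M w = T p \<inter> {v. lin_form n (\<lambda>i. H p (unit_vec i) w) v = 0}" for w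
  have M_iff: "v \<in> M w \<longleftrightarrow> v \<in> T p \<and> H p v w = 0" for v w
    unfolding M_def using H_form[of p v w] by auto
  have pX: "p \<in> X" using p(1) by (simp add: smooth_def)
  have M: "fv.subspace (M w)" "M w \<subseteq> vecs n" for w
    unfolding M_def using subspace_ker[OF subspace_T] T_vecs[of p] by auto
  have dimM: "fv.dim (M w) = n - 1" if "H p u w \<noteq> 0" for w
    unfolding M_def using that H_form[of p u w] by (intro dim_tangent_section[OF p(1) u(1)]) auto
  have pM: "p \<in> M w" if "w \<in> T p" for w using M_iff self_T[OF pX] H_self_T[OF that] by simp
  show ?thesis
  proof (rule ccontr)
    assume neg: "\<not> covered p"
    obtain x1 where x1: "x1 \<in> M u'" "F x1 \<noteq> 0"
      using neg M[of u'] dimM[OF u'(3)] pM[OF u'(1)] unfolding covered_def by blast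
    obtain x2 where x2: "x2 \<in> M u''" "F x2 \<noteq> 0"
      using neg M[of u''] dimM[OF u'(4)] pM[OF u'(2)] unfolding covered_def by blast
    show False
    proof (cases "M u' = M u''")
      case True
      define A where "A = {p, x1}"
      have "card A \<le> 2" unfolding A_def by (simp add: card_insert_if)
      then have "card A < fv.dim (M u')" using dimM[OF u'(3)] n_ge by linarith
      moreover have "finite A" by (simp add: A_def)
      ultimately obtain y where y: "y \<in> M u'" "y \<notin> fv.span A"
        using outside_span[of A "M u'"] by blast
      obtain a where a: "\<forall>w\<in>fv.span A. lin_form n a w = 0" "lin_form n a y = 1"
        using separating_form[OF fv.subspace_span, of y n A] y M fv.span_minimal[of A "vecs n"]
          x1(1) pM[OF u'(1)] subspace_vecs unfolding A_def by blast
      have 0: "lin_form n a p = 0" "lin_form n a x1 = 0" using a(1) fv.span_base[of _ A] unfolding A_def by auto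
      obtain V where V: "fv.subspace V" "V \<subseteq> T p \<inter> {v. lin_form n a v = 0}" "fv.dim V = n - 2"
          "p \<in> V" "\<forall>q\<in>V. F q = 0"
        using tangent_section[OF p(1) 0(1), of y] y a(2) M_iff by auto
      have "V \<subseteq> M u'"
      proof
        fix v assume v: "v \<in> V"
        then have "H p v v = 0" using contained_subspace(2)[OF V(1,4)] V(5) by blast
        then have "v \<in> M u' \<or> v \<in> M u''" using split[of v] v V(2) M_iff by auto
        then show "v \<in> M u'" using True by blast
      qed
      have "V = M u' \<inter> {v. lin_form n a v = 0}"
      proof (rule subspace_eq_vecs[where n = n, OF V(1)])
        show "fv.dim (M u' \<inter> {v. lin_form n a v = 0}) \<le> fv.dim V"
          using dim_ker[OF M y(1), of n a] a(2) dimM[OF u'(3)] V(3) by simp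
      qed (use V M \<open>V \<subseteq> M u'\<close> in auto)
      then show False using x1 0 V(5) by blast
    next
      case False
      have sub: "\<not> M u' \<subseteq> M u''" "\<not> M u'' \<subseteq> M u'"
        using subspace_eq_vecs[OF M(1) _ M(2)] False dimM u' by (metis order_refl)+
      \<comment> \<open>A point off \<open>X\<close> can be moved out of the other kernel: on a
        line, \<open>F\<close> stays nonzero for some nonzero parameter.\<close>
      have adjust: "\<exists>x\<in>M w. x \<notin> M w' \<and> F x \<noteq> 0" if x: "x \<in> M w" "F x \<noteq> 0" "\<not> M w \<subseteq> M w'" for x w w'
      proof (cases "x \<in> M w'")
        case True
        obtain y where y: "y \<in> M w" "y \<notin> M w'" using x by blast
        obtain t where t: "t \<noteq> 0" "F (x + t \<cdot> y) \<noteq> 0" using polyfun_nonzero_nearby[OF polyfun_F x(2)] by blast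
        have "x + t \<cdot> y \<in> M w" using x y M by (intro fv.subspace_add fv.subspace_scale)
        moreover have "x + t \<cdot> y \<notin> M w'"
        proof
          assume "x + t \<cdot> y \<in> M w'"
          then have "(1 / t) \<cdot> ((x + t \<cdot> y) - x) \<in> M w'"
            using True M by (intro fv.subspace_diff fv.subspace_scale)
          moreover have "(1 / t) \<cdot> ((x + t \<cdot> y) - x) = y" using t by (simp add: fun_eq_iff)
          ultimately show False using y by simp
        qed
        ultimately show ?thesis using t by blast
      qed (use x in blast)
      obtain z1 where z1: "z1 \<in> M u'" "z1 \<notin> M u''" "F z1 \<noteq> 0" using adjust[OF x1 sub(1)] by blast
      obtain z2 where z2: "z2 \<in> M u''" "z2 \<notin> M u'" "F z2 \<noteq> 0" using adjust[OF x2 sub(2)] by blast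
      define A where "A = {p, z1, z2}"
      have "card A \<le> 3" unfolding A_def by (simp add: card_insert_if)
      then have "card A < fv.dim (T p)" using dim_T[OF p(1)] n_ge by linarith
      moreover have "finite A" by (simp add: A_def)
      ultimately obtain y where y: "y \<in> T p" "y \<notin> fv.span A"
        using outside_span[of A "T p"] by blast
      have "fv.span A \<subseteq> T p"
        using z1 z2 M_iff self_T[OF pX] subspace_T unfolding A_def by (intro fv.span_minimal) auto
      then obtain a where a: "\<forall>w\<in>fv.span A. lin_form n a w = 0" "lin_form n a y = 1"
        using separating_form[OF fv.subspace_span, of y n A] y T_vecs by blast
      have 0: "lin_form n a p = 0" "lin_form n a z1 = 0" "lin_form n a z2 = 0"
        using a(1) fv.span_base[of _ A] unfolding A_def by auto
      let ?K = "T p \<inter> {v. lin_form n a v = 0}"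
      have K: "?K \<subseteq> vecs n" "fv.dim ?K = n - 1"
        using T_vecs[of p] dim_tangent_section[OF p(1) y(1), of a] a(2) by auto
      \<comment> \<open>The chosen point on the other kernel keeps \<open>M w\<close> from
        coinciding with the section of \<open>T p\<close>.\<close>
      have not_sub: "\<not> M w \<subseteq> ?K" if "fv.dim (M w) = n - 1" "z \<in> ?K" "z \<notin> M w" for w z
        using subspace_eq_vecs[OF M(1) _ K(1), of w] that K(2) by auto
      have zT: "z1 \<in> ?K" "z2 \<in> ?K" using z1 z2 0 M_iff by auto
      obtain V where V: "fv.subspace V" "V \<subseteq> ?K" "fv.dim V = n - 2" "p \<in> V" "\<forall>q\<in>V. F q = 0"
        using tangent_section[OF p(1) 0(1) y(1)] a(2) by auto
      have "V \<subseteq> M u' \<union> M u''"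
      proof
        fix v assume v: "v \<in> V"
        then have "H p v v = 0" using contained_subspace(2)[OF V(1,4)] V(5) by blast
        then show "v \<in> M u' \<union> M u''" using split[of v] v V(2) M_iff by auto
      qed
      then have "V \<subseteq> M u' \<or> V \<subseteq> M u''" using subspace_Un_cases[OF V(1) M(1) M(1)] by blast
      moreover have "V = M w \<inter> {v. lin_form n a v = 0}"
        if w: "V \<subseteq> M w" "\<not> M w \<subseteq> ?K" "fv.dim (M w) = n - 1" for w
      proof (rule subspace_eq_vecs[where n = n, OF V(1)])
        obtain y where "y \<in> M w" "lin_form n a y \<noteq> 0" using w(2) M_iff by auto
        then show "fv.dim (M w \<inter> {v. lin_form n a v = 0}) \<le> fv.dim V"
          using dim_ker[OF M] w(3) V(3) by fastforce
      qed (use w(1) V(2) M(2)[of w] in auto)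
      ultimately have "z1 \<in> V \<or> z2 \<in> V"
        using not_sub[OF dimM[OF u'(3)] zT(2) z2(2)] not_sub[OF dimM[OF u'(4)] zT(1) z1(2)]
          dimM u' z1(1) z2(1) 0 by blast
      then show False using V(5) z1 z2 by blast
    qed
  qed
qed

end

section \<open>Threefolds with nondegenerate second fundamental form\<close>

text \<open>Normal form modulo \<open>x 1 * x 3 - x 2 * x 2\<close>, which is up to sign a monic
  quadratic in \<open>x 2\<close>: the remainder is linear in \<open>x 2\<close>, with coefficients
  independent of it.\<close>

definition conic_remainder where
  "conic_remainder f \<alpha> \<beta> G \<longleftrightarrow> polyfun 3 \<alpha> \<and> polyfun 3 \<beta> \<and> polyfun 3 G \<and>
    (\<forall>x t. \<alpha> (x(2 := t)) = \<alpha> x) \<and> (\<forall>x t. \<beta> (x(2 := t)) = \<beta> x) \<and>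
    (\<forall>x. f x = \<alpha> x + x 2 * \<beta> x + (x 1 * x 3 - x 2 * x 2) * G x)"

lemma conic_remainder_exists:
  assumes "polyfun 3 f"
  shows "\<exists>\<alpha> \<beta> G. conic_remainder f \<alpha> \<beta> G"
  using assms
proof (induction rule: polyfun.induct)
  case (const c)
  show ?case by (intro exI[of _ "\<lambda>_. c"] exI[of _ "\<lambda>_. 0"]) (auto simp: conic_remainder_def)
next
  case (coord i)
  show ?case
  proof (cases "i = 2")
    case True
    then show ?thesis
      by (intro exI[of _ "\<lambda>_. 0"] exI[of _ "\<lambda>_. 1"]) (auto intro!: exI[of _ "\<lambda>_. 0"] simp: conic_remainder_def)
  next
    case False
    then show ?thesis using coord
      by (intro exI[of _ "\<lambda>x. x i"] exI[of _ "\<lambda>_. 0"]) (auto simp: conic_remainder_def)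
  qed
next
  case (add f g)
  from add.IH obtain \<alpha> \<beta> G \<alpha>' \<beta>' G' where r: "conic_remainder f \<alpha> \<beta> G" "conic_remainder g \<alpha>' \<beta>' G'"
    by (elim exE)
  note 1 = r[unfolded conic_remainder_def, THEN conjunct1]
    r[unfolded conic_remainder_def, THEN conjunct2, THEN conjunct1]
    r[unfolded conic_remainder_def, THEN conjunct2, THEN conjunct2, THEN conjunct1]
  note inv0 = r[unfolded conic_remainder_def, THEN conjunct2, THEN conjunct2, THEN conjunct2, THEN conjunct1, rule_format]
    r[unfolded conic_remainder_def, THEN conjunct2, THEN conjunct2, THEN conjunct2, THEN conjunct2, THEN conjunct1, rule_format]
  note 2 = r[unfolded conic_remainder_def, THEN conjunct2, THEN conjunct2, THEN conjunct2, THEN conjunct2, THEN conjunct2, rule_format]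
  define A where "A x = \<alpha> x + \<alpha>' x" for x
  define B where "B x = \<beta> x + \<beta>' x" for x
  define C where "C x = G x + G' x" for x
  have eq: "f x + g x = A x + x 2 * B x + (x 1 * x 3 - x 2 * x 2) * C x" for x
    unfolding 2 A_def B_def C_def by (simp add: algebra_simps)
  have pf: "polyfun 3 A" "polyfun 3 B" "polyfun 3 C"
    unfolding A_def[abs_def] B_def[abs_def] C_def[abs_def] by (intro polyfun.add 1)+
  have inv: "A (x(2 := t)) = A x" "B (x(2 := t)) = B x" for x t
    unfolding A_def B_def inv0 by simp_all
  show ?case
  proof (rule exI[of _ A], rule exI[of _ B], rule exI[of _ C], unfold conic_remainder_def, intro conjI allI)
    fix x :: "nat \<Rightarrow> 'a" and t
    show "polyfun 3 A" "polyfun 3 B" "polyfun 3 C" by (rule pf)+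
    show "A (x(2 := t)) = A x" "B (x(2 := t)) = B x" by (rule inv)+
    show "f x + g x = A x + x 2 * B x + (x 1 * x 3 - x 2 * x 2) * C x" by (rule eq)
  qed
next
  case (mult f g)
  from mult.IH obtain \<alpha> \<beta> G \<alpha>' \<beta>' G' where r: "conic_remainder f \<alpha> \<beta> G" "conic_remainder g \<alpha>' \<beta>' G'"
    by (elim exE)
  note 1 = r[unfolded conic_remainder_def, THEN conjunct1]
    r[unfolded conic_remainder_def, THEN conjunct2, THEN conjunct1]
    r[unfolded conic_remainder_def, THEN conjunct2, THEN conjunct2, THEN conjunct1]
  note inv0 = r[unfolded conic_remainder_def, THEN conjunct2, THEN conjunct2, THEN conjunct2, THEN conjunct1, rule_format]
    r[unfolded conic_remainder_def, THEN conjunct2, THEN conjunct2, THEN conjunct2, THEN conjunct2, THEN conjunct1, rule_format]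
  note 2 = r[unfolded conic_remainder_def, THEN conjunct2, THEN conjunct2, THEN conjunct2, THEN conjunct2, THEN conjunct2, rule_format]
  define A where "A x = \<alpha> x * \<alpha>' x + x 1 * x 3 * (\<beta> x * \<beta>' x)" for x
  define B where "B x = \<alpha> x * \<beta>' x + \<alpha>' x * \<beta> x" for x
  define C where "C x = (\<alpha> x + x 2 * \<beta> x) * G' x + G x * (\<alpha>' x + x 2 * \<beta>' x) - \<beta> x * \<beta>' x +
    (x 1 * x 3 - x 2 * x 2) * (G x * G' x)" for x
  have eq: "f x * g x = A x + x 2 * B x + (x 1 * x 3 - x 2 * x 2) * C x" for x
    unfolding 2 A_def B_def C_def by (simp add: algebra_simps)
  have pf: "polyfun 3 A" "polyfun 3 B" "polyfun 3 C"
    unfolding A_def[abs_def] B_def[abs_def] C_def[abs_def]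
    by (intro polyfun_diff polyfun.add polyfun.mult polyfun.coord 1; simp)+
  have inv: "A (x(2 := t)) = A x" "B (x(2 := t)) = B x" for x t
    unfolding A_def B_def inv0 by simp_all
  show ?case
  proof (rule exI[of _ A], rule exI[of _ B], rule exI[of _ C], unfold conic_remainder_def, intro conjI allI)
    fix x :: "nat \<Rightarrow> 'a" and t
    show "polyfun 3 A" "polyfun 3 B" "polyfun 3 C" by (rule pf)+
    show "A (x(2 := t)) = A x" "B (x(2 := t)) = B x" by (rule inv)+
    show "f x * g x = A x + x 2 * B x + (x 1 * x 3 - x 2 * x 2) * C x" by (rule eq)
  qed
qed

lemma alg_closed_sqrt:
  assumes "alg_closed_field TYPE('k::field_char_0)"
  shows "\<exists>s::'k. s * s = c"
proof -
  have "degree [:- c, 0, 1:] \<ge> 1" by simp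
  then obtain s where "poly [:- c, 0, 1:] s = 0" using assms unfolding alg_closed_field_def by blast
  then show ?thesis by auto
qed

text \<open>Both square roots of \<open>x 1 * x 3\<close> may be put for \<open>x 2\<close>, so the
  remainder \<open>\<alpha> + x 2 * \<beta>\<close> vanishes for both signs. Hence \<alpha> and
  \<open>x 1 * x 3 * \<beta>\<close> are zero, and \<beta> is zero since there are no zero
  divisors.\<close>

lemma conic_division:
  fixes f :: "(nat \<Rightarrow> 'k::field_char_0) \<Rightarrow> 'k"
  assumes alg: "alg_closed_field TYPE('k)" and f: "polyfun 3 f"
    and 0: "\<And>x. x 1 * x 3 = x 2 * x 2 \<Longrightarrow> f x = 0"
  shows "\<exists>G. polyfun 3 G \<and> (\<forall>x. f x = (x 1 * x 3 - x 2 * x 2) * G x)"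
proof -
  obtain \<alpha> \<beta> G where r: "conic_remainder f \<alpha> \<beta> G"
    using conic_remainder_exists[OF f] by (elim exE)
  have *: "polyfun 3 \<alpha>" "polyfun 3 \<beta>" "polyfun 3 G"
    "\<And>x t. \<alpha> (x(2 := t)) = \<alpha> x" "\<And>x t. \<beta> (x(2 := t)) = \<beta> x"
    using r unfolding conic_remainder_def by simp_all
  note eq = r[unfolded conic_remainder_def, THEN conjunct2, THEN conjunct2, THEN conjunct2, THEN conjunct2,
      THEN conjunct2, rule_format]
  have ab: "\<alpha> x = 0 \<and> x 1 * x 3 * \<beta> x = 0" for x
  proof -
    obtain s t where st: "s * s = x 1" "t * t = x 3" using alg_closed_sqrt[OF alg] by metis
    have val: "\<alpha> x + r * \<beta> x = 0" if "r * r = x 1 * x 3" for r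
    proof -
      have "f (x(2 := r)) = \<alpha> x + r * \<beta> x"
        unfolding eq[of "x(2 := r)"] *(4,5) using that by simp
      moreover have "f (x(2 := r)) = 0" by (rule 0) (use that in simp)
      ultimately show ?thesis by simp
    qed
    have sq: "(s * t) * (s * t) = x 1 * x 3" using st by (simp add: algebra_simps flip: st)
    have 1: "\<alpha> x + (s * t) * \<beta> x = 0" by (rule val[OF sq])
    have 2: "\<alpha> x + - (s * t) * \<beta> x = 0" by (rule val) (use sq in simp)
    have "2 * \<alpha> x = 0" using 1 2 by (simp add: algebra_simps)
    then have a: "\<alpha> x = 0" by simp
    then have "(s * t) * \<beta> x = 0" using 1 by simp
    then have "(s * t) * (s * t) * \<beta> x = 0" by (simp add: mult.assoc)
    then show ?thesis using a sq by simp
  qed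
  have "polyfun 3 (\<lambda>x::nat \<Rightarrow> 'k. x 1 * x 3)" by (intro polyfun.mult polyfun.coord) auto
  from polyfun_mult_eq_0[OF this *(2)] ab
  have "(\<forall>x::nat \<Rightarrow> 'k. x 1 * x 3 = 0) \<or> (\<forall>x. \<beta> x = 0)" by blast
  moreover have "\<not> (\<forall>x::nat \<Rightarrow> 'k. x 1 * x 3 = 0)"
    by (auto intro!: exI[of _ "\<lambda>_. 1"])
  ultimately show ?thesis using ab eq *(3) by auto
qed

text \<open>After removal of its components along \<open>f1\<close> and \<open>f2\<close>, the rest
  of \<open>v\<close> lies in both hyperplanes; by polarization it is orthogonal to
  \<open>f1\<close>, \<open>f2\<close> and itself, and only the mixed term survives.\<close>

lemma bilinear_two_hyperplanes:
  fixes D :: "(nat \<Rightarrow> 'k::field_char_0) \<Rightarrow> (nat \<Rightarrow> 'k) \<Rightarrow> 'k"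
  assumes D: "\<And>u v w. D (u + v) w = D u w + D v w" "\<And>c u w. D (c \<cdot> u) w = c * D u w"
      "\<And>u v. D u v = D v u"
    and W: "fv.subspace W"
    and l: "\<And>u v. l1 (u + v) = l1 u + l1 v" "\<And>c u. l1 (c \<cdot> u) = c * l1 u"
      "\<And>u v. l2 (u + v) = l2 u + l2 v" "\<And>c u. l2 (c \<cdot> u) = c * (l2 u :: 'k)"
    and f: "f1 \<in> W" "l1 f1 = 1" "l2 f1 = 0" "f2 \<in> W" "l1 f2 = 0" "l2 f2 = 1"
    and 0: "\<And>w. w \<in> W \<Longrightarrow> l1 w = 0 \<Longrightarrow> D w w = 0" "\<And>w. w \<in> W \<Longrightarrow> l2 w = 0 \<Longrightarrow> D w w = 0"
    and v: "v \<in> W"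
  shows "D v v = 2 * D f1 f2 * (l1 v * l2 v)"
proof -
  have Dr: "D w (u + v) = D w u + D w v" "D w (c \<cdot> u) = c * D w u" for u v w c using D by metis+
  define v0 where "v0 = v + (- l1 v) \<cdot> f1 + (- l2 v) \<cdot> f2"
  have v0: "v0 \<in> W"
    unfolding v0_def by (intro fv.subspace_add[OF W] fv.subspace_scale[OF W] v f)
  have l0: "l1 v0 = 0" "l2 v0 = 0"
    unfolding v0_def by (simp_all only: l f) simp_all
  have veq: "v = v0 + (l1 v \<cdot> f1 + l2 v \<cdot> f2)" by (simp add: v0_def fun_eq_iff)
  have pol: "D a b = 0" if "\<And>c. D (a + c \<cdot> b) (a + c \<cdot> b) = 0" "D a a = 0" "D b b = 0" for a b
  proof -
    have "D (a + 1 \<cdot> b) (a + 1 \<cdot> b) = D a a + 2 * D a b + D b b"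
      by (simp only: D(1,2) Dr D(3)[of b a]) simp
    then show ?thesis using that(1)[of 1] that(2,3) by simp
  qed
  have comb: "v0 + c \<cdot> f1 \<in> W" "v0 + c \<cdot> f2 \<in> W" "l2 (v0 + c \<cdot> f1) = 0" "l1 (v0 + c \<cdot> f2) = 0" for c
    using fv.subspace_add[OF W v0 fv.subspace_scale[OF W]] f l0 by (simp_all only: l) simp_all
  have 1: "D v0 f1 = 0" by (rule pol) (use 0 comb v0 l0 f in blast)+
  have 2: "D v0 f2 = 0" by (rule pol) (use 0 comb v0 l0 f in blast)+
  have 3: "D v0 v0 = 0" "D f1 f1 = 0" "D f2 f2 = 0" using 0 v0 l0 f by auto
  have "D v v = D (v0 + (l1 v \<cdot> f1 + l2 v \<cdot> f2)) (v0 + (l1 v \<cdot> f1 + l2 v \<cdot> f2))" using veq by simp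
  also have "\<dots> = 2 * D f1 f2 * (l1 v * l2 v)"
    by (simp only: D(1,2) Dr D(3)[of f1 v0] D(3)[of f2 v0] D(3)[of f2 f1] 1 2 3) (simp add: algebra_simps)
  finally show ?thesis .
qed

locale covered_threefold = covered_sections +
  assumes n_eq: "n = 4" and d_ge3: "d \<ge> 3"
begin

section \<open>Normal form of the tangent cone and its parametrization\<close>

text \<open>Coordinates \<open>x\<close>, \<open>z\<close>, \<open>y\<close> along \<open>a\<close>,
  \<open>b\<close>, \<open>m\<close> turn \<open>H p\<close> into \<open>x * z - y ^ 2\<close>,
  whose zeros are parametrized by \<open>(s ^ 2, t ^ 2, s * t)\<close>; hence the values 1/2 and
  -1.\<close>

definition normal_frame :: "(nat \<Rightarrow> 'a) \<Rightarrow> (nat \<Rightarrow> 'a) \<Rightarrow> (nat \<Rightarrow> 'a) \<Rightarrow> (nat \<Rightarrow> 'a) \<Rightarrow> bool" where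
  "normal_frame p a b m \<longleftrightarrow> a \<in> T p \<and> b \<in> T p \<and> m \<in> T p \<and> H p a a = 0 \<and> H p b b = 0 \<and> H p m m = - 1 \<and>
    H p a b = 1 / 2 \<and> H p b a = 1 / 2 \<and> H p a m = 0 \<and> H p m a = 0 \<and> H p b m = 0 \<and> H p m b = 0"

text \<open>From orthonormal vectors: \<open>w1\<close> plus or minus \<open>i\<close> times
  \<open>w2\<close>, halved, are isotropic, and \<open>i\<close> times \<open>w3\<close> has value
  -1.\<close>

lemma normal_frame_exists:
  assumes "rank3 p"
  shows "\<exists>a b m. normal_frame p a b m"
proof -
  obtain u1 u2 u3 where u: "u1 \<in> T p" "u2 \<in> T p" "u3 \<in> T p" and
    o: "H p u1 u2 = 0" "H p u1 u3 = 0" "H p u2 u3 = 0"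
    "H p u1 u1 \<noteq> 0" "H p u2 u2 \<noteq> 0" "H p u3 u3 \<noteq> 0" using assms unfolding rank3_def by blast
  have o': "H p u2 u1 = 0" "H p u3 u1 = 0" "H p u3 u2 = 0" using o H_sym by metis+
  obtain r1 r2 r3 i where r: "r1 * r1 = H p u1 u1" "r2 * r2 = H p u2 u2" "r3 * r3 = H p u3 u3" "i * i = (- 1 :: 'a)"
    using alg_closed_sqrt[OF alg] by metis
  have rn: "r1 \<noteq> 0" "r2 \<noteq> 0" "r3 \<noteq> 0" using r o by auto
  define w1 where "w1 = (1 / r1) \<cdot> u1"
  define w2 where "w2 = (1 / r2) \<cdot> u2"
  define w3 where "w3 = (1 / r3) \<cdot> u3"
  have wT: "w1 \<in> T p" "w2 \<in> T p" "w3 \<in> T p"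
    using u subspace_T unfolding w1_def w2_def w3_def by (auto intro: fv.subspace_scale)
  have ww: "H p w1 w1 = 1" "H p w2 w2 = 1" "H p w3 w3 = 1" "H p w1 w2 = 0" "H p w2 w1 = 0"
    "H p w1 w3 = 0" "H p w3 w1 = 0" "H p w2 w3 = 0" "H p w3 w2 = 0"
    unfolding w1_def w2_def w3_def using rn r(1-3) o o'
    by (simp_all only: H_left H_right) (simp_all flip: r(1-3))
  define a where "a = (1 / 2) \<cdot> (w1 + i \<cdot> w2)"
  define b where "b = (1 / 2) \<cdot> (w1 - i \<cdot> w2)"
  define m where "m = i \<cdot> w3"
  have "a \<in> T p" "b \<in> T p" "m \<in> T p"
    using wT subspace_T unfolding a_def b_def m_def
    by (auto intro!: fv.subspace_scale fv.subspace_add fv.subspace_diff)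
  moreover have "H p a a = 0" "H p b b = 0" "H p m m = - 1" "H p a b = 1 / 2" "H p b a = 1 / 2"
     "H p a m = 0" "H p m a = 0" "H p b m = 0" "H p m b = 0"
    unfolding a_def b_def m_def by (simp_all only: H_left H_right ww) (simp_all add: r(4))
  ultimately show ?thesis unfolding normal_frame_def by blast
qed

lemma H_frame_comb:
  assumes "normal_frame p a b m"
  shows "H p (x \<cdot> a + z \<cdot> b + y \<cdot> m) (x' \<cdot> a + z' \<cdot> b + y' \<cdot> m) = (x * z' + x' * z) / 2 - y * y'"
  using assms unfolding normal_frame_def by (simp only: H_left H_right) (simp add: field_simps)

lemma span_singleton_of_dim_1:
  assumes "fv.subspace W" "W \<subseteq> vecs n" "fv.dim W = 1" "p \<in> W" "p \<noteq> 0" "w \<in> W"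
  shows "\<exists>c. w = c \<cdot> p"
proof -
  have "fv.span {p} = W"
  proof (rule subspace_eq_vecs[where n = n, OF fv.subspace_span _ assms(2)])
    show "fv.span {p} \<subseteq> W" using assms by (intro fv.span_minimal) auto
    have "fv.independent {p}" using assms(5) by simp
    then have "fv.dim (fv.span {p}) = 1" using fv.dim_span_eq_card_independent by fastforce
    then show "fv.dim W \<le> fv.dim (fv.span {p})" using assms(3) by simp
  qed
  then show ?thesis using assms(6) by (auto simp: fv.span_singleton)
qed

lemma dim_ker_H:
  assumes "fv.subspace W" "W \<subseteq> vecs n" "x \<in> W" "H p x w \<noteq> 0"
  shows "fv.subspace (W \<inter> {v. H p v w = 0})" "W \<inter> {v. H p v w = 0} \<subseteq> vecs n"
    "Suc (fv.dim (W \<inter> {v. H p v w = 0})) = fv.dim W"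
proof -
  have eq: "{v. H p v w = 0} = {v. lin_form n (\<lambda>i. H p (unit_vec i) w) v = 0}"
    by (simp flip: H_form)
  show "fv.subspace (W \<inter> {v. H p v w = 0})" unfolding eq by (rule subspace_ker[OF assms(1)])
  show "W \<inter> {v. H p v w = 0} \<subseteq> vecs n" using assms(2) by blast
  show "Suc (fv.dim (W \<inter> {v. H p v w = 0})) = fv.dim W"
    unfolding eq by (rule dim_ker[OF assms(1,2,3)]) (simp add: assms(4) flip: H_form)
qed

text \<open>With \<open>n = 4\<close>, the vectors of \<open>T p\<close> orthogonal to
  \<open>a\<close>, \<open>b\<close> and \<open>m\<close> form a line, which is spanned by
  \<open>p\<close>.\<close>

lemma frame_decomposition:
  assumes p: "smooth p" and f: "normal_frame p a b m" and v: "v \<in> T p"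
  shows "\<exists>c. v = c \<cdot> p + ((2 * H p v b) \<cdot> a + (2 * H p v a) \<cdot> b + (- H p v m) \<cdot> m)"
proof -
  note F = f[unfolded normal_frame_def]
  have pX: "p \<in> X" using p by (simp add: smooth_def)
  let ?K1 = "T p \<inter> {v. H p v b = 0}"
  let ?K2 = "?K1 \<inter> {v. H p v a = 0}"
  let ?K3 = "?K2 \<inter> {v. H p v m = 0}"
  have nz: "H p a b \<noteq> 0" "H p b a \<noteq> 0" "H p m m \<noteq> 0"
  proof -
    have e: "H p a b = 1 / 2" "H p b a = 1 / 2" "H p m m = - 1" using F by blast+
    show "H p a b \<noteq> 0" "H p b a \<noteq> 0" "H p m m \<noteq> 0" unfolding e by simp_all
  qed
  have mem: "a \<in> T p" "b \<in> ?K1" "m \<in> ?K2" using F by simp_all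
  note 1 = dim_ker_H[OF subspace_T T_vecs mem(1) nz(1)]
  note 2 = dim_ker_H[OF 1(1,2) mem(2) nz(2)]
  note 3 = dim_ker_H[OF 2(1,2) mem(3) nz(3)]
  have dim: "fv.dim ?K3 = 1" using 1(3) 2(3) 3(3) dim_T[OF p] n_eq by simp
  define w where "w = (2 * H p v b) \<cdot> a + (2 * H p v a) \<cdot> b + (- H p v m) \<cdot> m"
  have wT: "w \<in> T p"
    unfolding w_def using F subspace_T by (intro fv.subspace_add fv.subspace_scale) auto
  have "v - w \<in> T p" using v wT subspace_T by (intro fv.subspace_diff)
  moreover have "H p (v - w) a = 0" "H p (v - w) b = 0" "H p (v - w) m = 0"
    unfolding w_def using F by (simp_all only: H_left) simp_all
  ultimately have "v - w \<in> ?K3" by blast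
  moreover have "p \<in> ?K3" using self_T[OF pX] H_self_T F by auto
  ultimately obtain c where "v - w = c \<cdot> p"
    using span_singleton_of_dim_1[OF 3(1,2) dim _ smooth_nonzero[OF p]] by blast
  then have "v = c \<cdot> p + w" by (metis diff_add_cancel)
  then show ?thesis unfolding w_def by blast
qed

definition conic_point :: "(nat \<Rightarrow> 'a) \<Rightarrow> (nat \<Rightarrow> 'a) \<Rightarrow> (nat \<Rightarrow> 'a) \<Rightarrow> 'a \<Rightarrow> 'a \<Rightarrow> (nat \<Rightarrow> 'a)" where
  "conic_point a b m s t = (s * s) \<cdot> a + (t * t) \<cdot> b + (s * t) \<cdot> m"

lemma conic_point_T:
  "normal_frame p a b m \<Longrightarrow> conic_point a b m s t \<in> T p"
  unfolding conic_point_def normal_frame_def using subspace_T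
  by (intro fv.subspace_add fv.subspace_scale) auto

lemma H_conic_points:
  assumes "normal_frame p a b m"
  shows "H p (conic_point a b m s t) (conic_point a b m s' t') = (s * t' - s' * t) * (s * t' - s' * t) / 2"
  unfolding conic_point_def H_frame_comb[OF assms] by (simp add: field_simps)

text \<open>Take square roots of the two outer coordinates and, if necessary, change the sign of
  one.\<close>

lemma null_vector_conic:
  assumes p: "smooth p" and f: "normal_frame p a b m" and v: "v \<in> T p" "H p v v = 0"
  shows "\<exists>c s t. v = c \<cdot> p + conic_point a b m s t"
proof -
  obtain c where c: "v = c \<cdot> p + ((2 * H p v b) \<cdot> a + (2 * H p v a) \<cdot> b + (- H p v m) \<cdot> m)"
    using frame_decomposition[OF p f v(1)] by blast
  define x z y where "x = 2 * H p v b" and "z = 2 * H p v a" and "y = - H p v m"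
  define w where "w = x \<cdot> a + z \<cdot> b + y \<cdot> m"
  have vw: "v = c \<cdot> p + w" using c unfolding w_def x_def y_def z_def .
  have wT: "w \<in> T p"
    unfolding w_def using f subspace_T unfolding normal_frame_def by (intro fv.subspace_add fv.subspace_scale) auto
  have pT: "p \<in> T p" using p self_T by (simp add: smooth_def)
  have "H p v v = H p w w"
    unfolding vw by (simp only: H_left H_right H_self_T[OF wT] H_self_T[OF pT]) simp
  also have "\<dots> = x * z - y * y" unfolding w_def H_frame_comb[OF f] by simp
  finally have xz: "x * z = y * y" using v(2) by simp
  obtain s t where st: "s * s = x" "t * t = z"
    using alg_closed_sqrt[OF alg, of x] alg_closed_sqrt[OF alg, of z] by blast
  have "(s * t) * (s * t) = x * z" unfolding st[symmetric] by (simp only: ac_simps)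
  moreover have "(s * t - y) * (s * t + y) = (s * t) * (s * t) - y * y" by (simp add: algebra_simps)
  ultimately have "(s * t - y) * (s * t + y) = 0" using xz by simp
  then consider "y = s * t" | "y = s * (- t)" by (auto simp: eq_neg_iff_add_eq_0 add.commute)
  then have "\<exists>t'. t' * t' = z \<and> y = s * t'"
  proof cases
    case 1
    then show ?thesis using st by blast
  next
    case 2
    then show ?thesis using st by (intro exI[of _ "- t"]) simp
  qed
  then obtain t' where "t' * t' = z" "y = s * t'" by blast
  then have "w = conic_point a b m s t'" unfolding conic_point_def w_def using st by simp
  then show ?thesis using vw by blast
qed

lemma polyfun_conic_point:
  assumes "polyfun k s" "polyfun k t"
  shows "polyfun k (\<lambda>x. conic_point a b m (s x) (t x) i)"
  unfolding conic_point_def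
  by (simp only: plus_fun_apply scl_apply) (intro polyfun.add polyfun.mult assms polyfun.const)

text \<open>On a hyperplane of \<open>T p\<close> through \<open>p\<close> and the two points, the
  form is modulo \<open>p\<close> a hyperbolic plane whose isotropic lines are those of the two
  points. The divisor of the section is isotropic of dimension one modulo \<open>p\<close>, hence
  spanned by \<open>p\<close> and one of them.\<close>

lemma conic_pair_in_X:
  assumes p: "smooth p" and f: "normal_frame p a b m" and st: "s * t' - s' * t \<noteq> 0"
  shows "F (c \<cdot> p + conic_point a b m s t) = 0 \<or> F (c \<cdot> p + conic_point a b m s' t') = 0"
proof -
  let ?u = "conic_point a b m s t" and ?v = "conic_point a b m s' t'"
  have uv: "?u \<in> T p" "?v \<in> T p" using conic_point_T[OF f] by auto
  have pX: "p \<in> X" using p by (simp add: smooth_def)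
  note pT = self_T[OF pX]
  have Huu: "H p ?u ?u = 0" "H p ?v ?v = 0" unfolding H_conic_points[OF f] by simp_all
  have "H p ?u ?v \<noteq> 0" unfolding H_conic_points[OF f] using st by simp
  then have Huv: "H p ?u ?v \<noteq> 0" "H p ?v ?u = H p ?u ?v" using H_sym by simp_all
  let ?A = "{p, ?u, ?v}"
  have "card ?A \<le> 3" by (simp add: card_insert_if)
  then have "card ?A < fv.dim (T p)" using dim_T[OF p] n_eq by simp
  then obtain x where x: "x \<in> T p" "x \<notin> fv.span ?A" using outside_span[of ?A "T p"] by blast
  have sub: "fv.span ?A \<subseteq> T p" using uv pT subspace_T by (intro fv.span_minimal) auto
  obtain l where l: "\<forall>w\<in>fv.span ?A. lin_form n l w = 0" "lin_form n l x = 1"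
    using separating_form[OF fv.subspace_span, of x n ?A] x T_vecs sub by blast
  have l0: "lin_form n l p = 0" "lin_form n l ?u = 0" "lin_form n l ?v = 0"
    using l(1) fv.span_base[of _ ?A] by auto
  let ?K = "T p \<inter> {v. lin_form n l v = 0}"
  obtain V where V: "fv.subspace V" "V \<subseteq> ?K" "fv.dim V = n - 2" "p \<in> V" "\<forall>q\<in>V. F q = 0"
    using tangent_section[OF p l0(1) x(1)] l(2) by auto
  have K: "fv.subspace ?K" "?K \<subseteq> vecs n" "fv.dim ?K = 3"
    using subspace_ker[OF subspace_T] T_vecs[of p] dim_tangent_section[OF p x(1), of l] l(2) n_eq by auto
  let ?K1 = "?K \<inter> {w. H p w ?v = 0}"
  let ?K2 = "?K1 \<inter> {w. H p w ?u = 0}"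
  have mem: "?u \<in> ?K" "?v \<in> ?K1" using uv l0 Huu by simp_all
  note 1 = dim_ker_H[OF K(1,2) mem(1) Huv(1)]
  note 2 = dim_ker_H[OF 1(1,2) mem(2) Huv(1)[folded Huv(2)]]
  have dim: "fv.dim ?K2 = 1" using 1(3) 2(3) K(3) by simp
  have "card {p} < fv.dim V" using V(3) n_eq by simp
  then obtain w where w: "w \<in> V" "w \<notin> fv.span {p}" using outside_span[of "{p}" V] by blast
  define \<beta> where "\<beta> = H p w ?v / H p ?u ?v"
  define \<gamma> where "\<gamma> = H p w ?u / H p ?u ?v"
  define y where "y = w - (\<beta> \<cdot> ?u + \<gamma> \<cdot> ?v)"
  have wK: "w \<in> ?K" using w V by blast
  have "y \<in> ?K"
    unfolding y_def using wK uv l0 K(1)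
    by (intro fv.subspace_diff[OF K(1)] fv.subspace_add[OF K(1)] fv.subspace_scale[OF K(1)]) auto
  moreover have "H p y ?v = 0" "H p y ?u = 0"
    unfolding y_def \<beta>_def \<gamma>_def using Huv Huu by (simp_all only: H_left) simp_all
  ultimately have "y \<in> ?K2" by blast
  moreover have "p \<in> ?K2" using pT l0 H_self_T uv by auto
  ultimately obtain c0 where c0: "y = c0 \<cdot> p"
    using span_singleton_of_dim_1[OF 2(1,2) dim _ smooth_nonzero[OF p]] by blast
  have weq: "w = c0 \<cdot> p + (\<beta> \<cdot> ?u + \<gamma> \<cdot> ?v)" using c0 unfolding y_def by (metis diff_add_cancel)
  have "0 = H p w w" using contained_subspace(2)[OF V(1,4)] V(5) w(1) by metis
  also have "\<dots> = 2 * \<beta> * \<gamma> * H p ?u ?v"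
    unfolding weq
    by (simp only: H_left H_right H_self_T[OF uv(1)] H_self_T[OF uv(2)] H_self_T[OF pT] Huu Huv(2))
       (simp add: algebra_simps)
  finally have "\<beta> = 0 \<or> \<gamma> = 0" using Huv(1) by simp
  moreover have "F (c \<cdot> p + z) = 0" if z: "w = c0 \<cdot> p + r \<cdot> z" for z r
  proof -
    have "r \<noteq> 0"
    proof
      assume "r = 0"
      then have "w = c0 \<cdot> p" using z by (simp add: fun_eq_iff)
      then show False using w(2) by (simp add: fv.span_base fv.span_scale)
    qed
    then have "c \<cdot> p + z = c \<cdot> p + (1 / r) \<cdot> (w - c0 \<cdot> p)" unfolding z by (simp add: fun_eq_iff)
    also have "\<dots> \<in> V"
      using w V by (intro fv.subspace_add fv.subspace_scale fv.subspace_diff) auto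
    finally show ?thesis using V(5) by blast
  qed
  ultimately show ?thesis
  proof (elim disjE)
    assume "\<beta> = 0"
    then have "w = c0 \<cdot> p + \<gamma> \<cdot> ?v" unfolding weq by (simp add: fun_eq_iff)
    then show ?thesis using \<open>\<And>z r. w = c0 \<cdot> p + r \<cdot> z \<Longrightarrow> F (c \<cdot> p + z) = 0\<close> by blast
  next
    assume "\<gamma> = 0"
    then have "w = c0 \<cdot> p + \<beta> \<cdot> ?u" unfolding weq by (simp add: fun_eq_iff)
    then show ?thesis using \<open>\<And>z r. w = c0 \<cdot> p + r \<cdot> z \<Longrightarrow> F (c \<cdot> p + z) = 0\<close> by blast
  qed
qed

text \<open>For two variable points, the product of both values of \<open>F\<close> and the
  determinant is identically zero in four parameters. As there are no zero divisors,
  \<open>F\<close> vanishes on the whole conic.\<close>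

lemma conic_in_X:
  assumes p: "smooth p" and f: "normal_frame p a b m"
  shows "F (c \<cdot> p + conic_point a b m s t) = 0"
proof -
  define \<phi> where "\<phi> i j x = F (c \<cdot> p + conic_point a b m (x i) (x j))" for i j :: nat and x :: "nat \<Rightarrow> 'a"
  have \<phi>: "polyfun 3 (\<phi> i j)" if "i \<le> 3" "j \<le> 3" for i j
    unfolding \<phi>_def[abs_def]
    by (rule polyfun_comp[OF polyfun_F])
       (simp only: plus_fun_apply scl_apply, intro polyfun.add polyfun.const polyfun_conic_point polyfun.coord that)
  define \<delta> :: "(nat \<Rightarrow> 'a) \<Rightarrow> 'a" where "\<delta> x = x 0 * x 3 - x 2 * x 1" for x
  have \<delta>: "polyfun 3 \<delta>"
    unfolding \<delta>_def[abs_def] by (intro polyfun_diff polyfun.mult polyfun.coord) auto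
  have "\<phi> 0 1 x * (\<phi> 2 3 x * \<delta> x) = 0" for x
    using conic_pair_in_X[OF p f, of "x 0" "x 3" "x 2" "x 1" c] by (auto simp: \<phi>_def \<delta>_def)
  then have "(\<forall>x. \<phi> 0 1 x = 0) \<or> (\<forall>x. \<phi> 2 3 x * \<delta> x = 0)"
    using polyfun_mult_eq_0[OF \<phi>[of 0 1] polyfun.mult[OF \<phi>[of 2 3] \<delta>]] by simp
  then consider "\<forall>x. \<phi> 0 1 x = 0" | "\<forall>x. \<phi> 2 3 x = 0" | "\<forall>x. \<delta> x = 0"
    using polyfun_mult_eq_0[OF \<phi>[of 2 3] \<delta>] by auto
  then show ?thesis
  proof cases
    case 1
    then have "\<phi> 0 1 (\<lambda>i. if i = 0 then s else t) = 0" by blast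
    then show ?thesis by (simp add: \<phi>_def)
  next
    case 2
    then have "\<phi> 2 3 (\<lambda>i. if i = 2 then s else t) = 0" by blast
    then show ?thesis by (simp add: \<phi>_def)
  next
    case 3
    then have "\<delta> (\<lambda>i. if i = 0 \<or> i = 3 then 1 else 0) = 0" by blast
    then show ?thesis by (simp add: \<delta>_def)
  qed
qed

lemma polyfun_H_arg: "polyfun n (\<lambda>v. H p v w)"
  by (subst H_form) (rule polyfun_lin_form)

lemma polyfun_H_args:
  assumes "\<And>i. i \<le> n \<Longrightarrow> polyfun n (\<lambda>x. L x i)" "\<And>i. i \<le> n \<Longrightarrow> polyfun n (\<lambda>x. M x i)"
  shows "polyfun n (\<lambda>x. H p (L x) (M x))"
proof -
  have e: "H p u w = (\<Sum>i\<le>n. H p (unit_vec i) w * u i)" for u w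
    by (subst H_form) (simp add: lin_form_def)
  have "H p (L x) (M x) = (\<Sum>i\<le>n. H p (M x) (unit_vec i) * L x i)" for x
    by (subst e) (simp only: H_sym[of p "unit_vec _" "M x"])
  then have "H p (L x) (M x) = (\<Sum>i\<le>n. (\<Sum>j\<le>n. H p (unit_vec j) (unit_vec i) * M x j) * L x i)" for x
    using e[of "M x" "unit_vec _"] by presburger
  moreover have "polyfun n (\<lambda>x. \<Sum>i\<le>n. (\<Sum>j\<le>n. H p (unit_vec j) (unit_vec i) * M x j) * L x i)"
    by (intro polyfun_sum polyfun.mult polyfun.const assms) auto
  ultimately show ?thesis by simp
qed

lemma nonzero_coordinate:
  assumes "p \<in> X" "p \<noteq> 0"
  shows "\<exists>k\<le>n. p k \<noteq> 0"
proof -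
  obtain k where "p k \<noteq> 0" using assms(2) by (auto simp: fun_eq_iff)
  moreover from this have "k \<le> n" using assms(1) by (auto simp: X_def vecs_def vec_in_def not_less[symmetric])
  ultimately show ?thesis by blast
qed

text \<open>In coordinates adapted to a normal frame, \<open>F\<close> vanishes on the cone
  \<open>x 1 * x 3 = x 2 * x 2\<close> and is divisible by its equation. The quotient is nonzero at
  \<open>p\<close> because the quadratic term of \<open>F\<close> there is half of
  \<open>H p\<close>.\<close>

lemma quotient_by_second_form:
  assumes p: "smooth p" "rank3 p"
  shows "\<exists>G. polyfun n G \<and> G p \<noteq> 0 \<and> (\<forall>v\<in>T p. F v = H p v v * G v)"
proof -
  obtain a b m where f: "normal_frame p a b m" using normal_frame_exists[OF p(2)] by blast
  note FR = f[unfolded normal_frame_def]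
  have pX: "p \<in> X" using p by (simp add: smooth_def)
  note pT = self_T[OF pX]
  obtain k where k: "k \<le> n" "p k \<noteq> 0" using nonzero_coordinate[OF pX smooth_nonzero[OF p(1)]] by blast
  define L where "L x = x 0 \<cdot> p + (x 1 \<cdot> a + x 3 \<cdot> b + x 2 \<cdot> m)" for x :: "nat \<Rightarrow> 'a"
  have LT: "L x \<in> T p" for x
    unfolding L_def using FR pT subspace_T by (intro fv.subspace_add fv.subspace_scale) auto
  have HL: "H p (L x) (L x) = x 1 * x 3 - x 2 * x 2" for x
  proof -
    let ?w = "x 1 \<cdot> a + x 3 \<cdot> b + x 2 \<cdot> m"
    have w: "?w \<in> T p" using FR subspace_T by (intro fv.subspace_add fv.subspace_scale) auto
    have "H p (L x) (L x) = H p ?w ?w"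
      unfolding L_def H_left(1)[of p "x 0 \<cdot> p"] H_right(1)[of p _ "x 0 \<cdot> p"] H_left(3) H_right(3)
        H_self_T[OF w] H_self_T[OF pT] by simp
    also have "\<dots> = x 1 * x 3 - x 2 * x 2" unfolding H_frame_comb[OF f] by simp
    finally show ?thesis .
  qed
  have "polyfun 3 (\<lambda>x. F (L x))"
    unfolding L_def
    by (rule polyfun_comp[OF polyfun_F], simp only: plus_fun_apply scl_apply,
        intro polyfun.add polyfun.mult polyfun.const polyfun.coord) auto
  moreover have "F (L x) = 0" if "x 1 * x 3 = x 2 * x 2" for x
    using null_vector_conic[OF p(1) f LT[of x]] that conic_in_X[OF p(1) f] by (auto simp: HL)
  ultimately obtain G3 where G3: "polyfun 3 G3" "\<And>x. F (L x) = (x 1 * x 3 - x 2 * x 2) * G3 x"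
    using conic_division[OF alg, of "\<lambda>x. F (L x)"] by blast
  define \<kappa> :: "(nat \<Rightarrow> 'a) \<Rightarrow> nat \<Rightarrow> 'a" where "\<kappa> v i = (if i = 0 then (1 / p k) * (v k - (2 * H p v b * a k + 2 * H p v a * b k + - H p v m * m k))
    else if i = 1 then 2 * H p v b else if i = 2 then - H p v m else 2 * H p v a)" for v i
  have \<kappa>: "L (\<kappa> v) = v" if v: "v \<in> T p" for v
  proof -
    obtain c where c: "v = c \<cdot> p + ((2 * H p v b) \<cdot> a + (2 * H p v a) \<cdot> b + (- H p v m) \<cdot> m)"
      using frame_decomposition[OF p(1) f v] by blast
    have "v k = c * p k + (2 * H p v b * a k + 2 * H p v a * b k + - H p v m * m k)"
      using fun_cong[OF c, of k] by simp
    then have k0: "\<kappa> v 0 = c" using k(2) by (simp add: \<kappa>_def)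
    have k1: "\<kappa> v 1 = 2 * H p v b" "\<kappa> v 2 = - H p v m" "\<kappa> v 3 = 2 * H p v a"
      by (simp_all add: \<kappa>_def)
    show ?thesis unfolding L_def k0 k1 by (rule c[symmetric])
  qed
  define G where "G v = G3 (\<kappa> v)" for v
  have "polyfun n G"
    unfolding G_def[abs_def]
  proof (rule polyfun_comp[OF G3(1)])
    fix i :: nat assume "i \<le> 3"
    then consider "i = 0" | "i = 1" | "i = 2" | "i = 3" by linarith
    moreover have "polyfun n (\<lambda>x. \<kappa> x 0)" unfolding \<kappa>_def
      by (simp only: simp_thms if_True)
         (intro polyfun.add polyfun_diff polyfun_uminus polyfun.mult polyfun.const polyfun_H_arg polyfun.coord k(1))
    moreover have "(\<lambda>x. \<kappa> x 1) = (\<lambda>x. 2 * H p x b)" "(\<lambda>x. \<kappa> x 2) = (\<lambda>x. - H p x m)"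
      "(\<lambda>x. \<kappa> x 3) = (\<lambda>x. 2 * H p x a)"
      by (simp_all add: \<kappa>_def)
    moreover have "polyfun n (\<lambda>x. 2 * H p x b)" "polyfun n (\<lambda>x. - H p x m)" "polyfun n (\<lambda>x. 2 * H p x a)"
      by (intro polyfun.mult polyfun.const polyfun_H_arg polyfun_uminus)+
    ultimately show "polyfun n (\<lambda>x. \<kappa> x i)" by cases metis+
  qed
  moreover have FG: "F v = H p v v * G v" if v: "v \<in> T p" for v
    using G3(2)[of "\<kappa> v"] HL[of "\<kappa> v"] \<kappa>[OF v] by (simp add: G_def)
  moreover have "G p \<noteq> 0"
  proof -
    \<comment> \<open>In direction \<open>m\<close> from \<open>p\<close>, the form
      \<open>H p\<close> is \<open>- (t * t)\<close>; comparing second coefficients gives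
      \<open>G p\<close>.\<close>
    have "tay F p m = [:0, 0, - 1:] * tay G p m"
    proof (rule tay_eqI)
      fix t
      have "p + t \<cdot> m \<in> T p" using pT FR subspace_T by (intro fv.subspace_add fv.subspace_scale) auto
      moreover have "H p (p + t \<cdot> m) (p + t \<cdot> m) = - (t * t)"
        using FR H_self_T[of m p] H_self_T[OF pT] by (simp only: H_left H_right) simp
      ultimately show "poly ([:0, 0, - 1:] * tay G p m) t = F (p + t \<cdot> m)"
        using FG poly_tay[OF \<open>polyfun n G\<close>] by simp
    qed
    then have "coeff (tay F p m) 2 = - coeff (tay G p m) 0"
      by (simp add: numeral_2_eq_2 coeff_pCons)
    then have Gp: "G p = 1 / 2"
      using coeff_2_tay[OF polyfun_F, of p m] coeff_0_tay[OF \<open>polyfun n G\<close>, of p m] FR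
      by (simp add: H_def)
    show ?thesis unfolding Gp by simp
  qed
  ultimately show ?thesis by blast
qed

section \<open>Comparison of two tangent hyperplanes\<close>

text \<open>Since \<open>y\<close> is in the radical of \<open>H y\<close>, frame vectors may be
  moved along \<open>y\<close>; as \<open>y\<close> is not tangent at \<open>p\<close>, this takes
  them into \<open>T p\<close>.\<close>

lemma normal_frame_transverse:
  assumes y: "smooth y" "rank3 y" and py: "g p y \<noteq> 0"
  shows "\<exists>a b m. normal_frame y a b m \<and> a \<in> T p \<and> b \<in> T p \<and> m \<in> T p"
proof -
  obtain a b m where f: "normal_frame y a b m" using normal_frame_exists[OF y(2)] by blast
  note FR = f[unfolded normal_frame_def]
  have yT: "y \<in> T y" using y self_T by (simp add: smooth_def)
  define \<pi> where "\<pi> v = v - (g p v / g p y) \<cdot> y" for v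
  have \<pi>T: "\<pi> v \<in> T y" "\<pi> v \<in> T p" if v: "v \<in> T y" for v
  proof -
    show *: "\<pi> v \<in> T y" unfolding \<pi>_def using v yT subspace_T by (intro fv.subspace_diff fv.subspace_scale)
    have "g p (\<pi> v) = 0" unfolding \<pi>_def using py by (simp only: g_linear) simp
    then show "\<pi> v \<in> T p" using * by (simp add: T_def)
  qed
  have H\<pi>: "H y (\<pi> u) (\<pi> v) = H y u v" if "u \<in> T y" "v \<in> T y" for u v
    unfolding \<pi>_def by (simp only: H_left H_right H_self_T[OF that(1)] H_self_T[OF that(2)] H_self_T[OF yT]) simp
  have "normal_frame y (\<pi> a) (\<pi> b) (\<pi> m)"
    using FR \<pi>T(1) H\<pi> unfolding normal_frame_def by metis
  then show ?thesis using \<pi>T(2) FR by blast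
qed

lemma decomposition_transverse:
  assumes y: "smooth y" and py: "g p y \<noteq> 0" and f: "normal_frame y a b m"
    and T: "a \<in> T p" "b \<in> T p" "m \<in> T p" and v: "v \<in> T p" "v \<in> T y"
  shows "v = (2 * H y v b) \<cdot> a + (2 * H y v a) \<cdot> b + (- H y v m) \<cdot> m"
proof -
  obtain c where c: "v = c \<cdot> y + ((2 * H y v b) \<cdot> a + (2 * H y v a) \<cdot> b + (- H y v m) \<cdot> m)"
    using frame_decomposition[OF y f v(2)] by blast
  have 0: "g p a = 0" "g p b = 0" "g p m = 0" "g p v = 0" using T v by (auto simp: T_def)
  have "g p v = c * g p y" by (subst c) (simp only: g_linear 0, simp)
  then have "c = 0" using 0 py by simp
  then show ?thesis using c by (metis add_0 fv.scale_zero_left)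
qed

text \<open>\<open>a + b\<close>, \<open>a - b\<close> and \<open>m\<close> are orthogonal with
  values 1, -1, -1, so \<open>H y\<close> still has rank three on
  \<open>T p \<inter> T y\<close>.\<close>

lemma anisotropic_transverse:
  assumes y: "smooth y" "rank3 y" and py: "g p y \<noteq> 0"
  shows "\<exists>x. x \<in> T y \<and> x \<in> T p \<and> lin_form n l x = 0 \<and> H y x x \<noteq> 0"
proof -
  obtain a b m where f: "normal_frame y a b m" and T: "a \<in> T p" "b \<in> T p" "m \<in> T p"
    using normal_frame_transverse[OF assms] by blast
  note FR = f[unfolded normal_frame_def]
  have "\<exists>x\<in>fv.span {a + b, a - b, m}. lin_form n l x = 0 \<and> H y x x \<noteq> 0"
    by (rule anisotropic_in_kernel; use FR in \<open>simp only: H_left H_right\<close>; simp)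
  moreover have "fv.span {a + b, a - b, m} \<subseteq> T y \<inter> T p"
    using FR T subspace_T by (intro fv.span_minimal fv.subspace_inter)
      (auto intro: fv.subspace_add fv.subspace_diff)
  ultimately show ?thesis by blast
qed

text \<open>The quadric cones at \<open>p\<close> and \<open>y\<close> cut the same conic in the
  projective plane \<open>T p \<inter> T y\<close>.\<close>

definition compatible :: "(nat \<Rightarrow> 'a) \<Rightarrow> (nat \<Rightarrow> 'a) \<Rightarrow> bool" where
  "compatible p y \<longleftrightarrow> (\<exists>c. c \<noteq> 0 \<and> (\<forall>v. v \<in> T p \<longrightarrow> v \<in> T y \<longrightarrow> H p v v = c * H y v v))"

text \<open>On the plane \<open>T p \<inter> T y\<close> the conic \<open>H y = 0\<close> is irreducible and lies in the zero set of
  \<open>F = H p * G\<close>, so one of the two factors vanishes on it.\<close>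

lemma conic_alternative:
  assumes p: "smooth p" "rank3 p" and y: "smooth y" "rank3 y" and py: "g p y \<noteq> 0"
    and G: "polyfun n G" "\<And>v. v \<in> T p \<Longrightarrow> F v = H p v v * G v"
  shows "compatible p y \<or> (\<forall>v. v \<in> T p \<longrightarrow> v \<in> T y \<longrightarrow> H y v v = 0 \<longrightarrow> G v = 0)"
proof -
  obtain a b m where f: "normal_frame y a b m" and T: "a \<in> T p" "b \<in> T p" "m \<in> T p"
    using normal_frame_transverse[OF y py] by blast
  note FR = f[unfolded normal_frame_def]
  let ?c = "conic_point a b m"
  have cT: "?c s t \<in> T p" for s t
    unfolding conic_point_def using T subspace_T by (intro fv.subspace_add fv.subspace_scale) auto
  have F0: "F (?c s t) = 0" for s t
    using conic_in_X[OF y(1) f, of 0 s t] by (metis add_0 fv.scale_zero_left)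
  have poly: "polyfun 1 (\<lambda>x. ?c (x 0) (x 1) i)" for i
    by (intro polyfun_conic_point polyfun.coord) auto
  have pH: "polyfun 1 (\<lambda>x. H p (?c (x 0) (x 1)) (?c (x 0) (x 1)))"
    by (rule polyfun_comp[OF polyfun_H_args[of "\<lambda>x. x" "\<lambda>x. x"]]) (rule polyfun.coord poly; assumption?)+
  have pG: "polyfun 1 (\<lambda>x. G (?c (x 0) (x 1)))"
    by (rule polyfun_comp[OF G(1)]) (rule poly)
  have "H p (?c (x 0) (x 1)) (?c (x 0) (x 1)) * G (?c (x 0) (x 1)) = 0" for x :: "nat \<Rightarrow> 'a"
    using G(2)[OF cT] F0 by metis
  from polyfun_mult_eq_0[OF pH pG this] have
    "(\<forall>s t. H p (?c s t) (?c s t) = 0) \<or> (\<forall>s t. G (?c s t) = 0)"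
  proof
    assume *: "\<forall>x::nat \<Rightarrow> 'a. H p (?c (x 0) (x 1)) (?c (x 0) (x 1)) = 0"
    have "H p (?c s t) (?c s t) = 0" for s t
      using *[rule_format, of "\<lambda>i. if i = 0 then s else t"] by simp
    then show ?thesis by blast
  next
    assume *: "\<forall>x::nat \<Rightarrow> 'a. G (?c (x 0) (x 1)) = 0"
    have "G (?c s t) = 0" for s t using *[rule_format, of "\<lambda>i. if i = 0 then s else t"] by simp
    then show ?thesis by blast
  qed
  then show ?thesis
  proof
    assume *: "\<forall>s t. G (?c s t) = 0"
    have "G v = 0" if v: "v \<in> T p" "v \<in> T y" "H y v v = 0" for v
    proof -
      obtain c s t where c: "v = c \<cdot> y + ?c s t" using null_vector_conic[OF y(1) f v(2,3)] by blast
      have "g p v = c * g p y + g p (?c s t)" unfolding c by (simp only: g_linear)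
      then have "c = 0" using v(1) cT[of s t] py by (simp add: T_def)
      then have "v = ?c s t" using c by (metis add_0 fv.scale_zero_left)
      then show ?thesis using * by simp
    qed
    then show ?thesis by blast
  next
    assume *: "\<forall>s t. H p (?c s t) (?c s t) = 0"
    define A B M' AB AM BM where "A = H p a a" and "B = H p b b" and "M' = H p m m" and
      "AB = H p a b" and "AM = H p a m" and "BM = H p b m"
    have sym: "H p b a = AB" "H p m a = AM" "H p m b = BM"
      unfolding AB_def AM_def BM_def using H_sym by auto
    have quad: "H p (x \<cdot> a + z \<cdot> b + w \<cdot> m) (x \<cdot> a + z \<cdot> b + w \<cdot> m) =
        x * x * A + z * z * B + w * w * M' + 2 * (x * z) * AB + 2 * (x * w) * AM + 2 * (z * w) * BM" for x z w
      by (simp only: H_left H_right sym flip: A_def B_def M'_def AB_def AM_def BM_def) (simp add: algebra_simps)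
    \<comment> \<open>A binary quartic with coefficients \<open>A\<close>, \<open>2 * AM\<close>,
      \<open>M' + 2 * AB\<close>, \<open>2 * BM\<close>, \<open>B\<close>; its values at five points
      show that they all vanish.\<close>
    have E: "s * s * (s * s) * A + t * t * (t * t) * B + (s * t) * (s * t) * M' + 2 * (s * s * (t * t)) * AB
        + 2 * (s * s * (s * t)) * AM + 2 * (t * t * (s * t)) * BM = 0" for s t
      using *[rule_format, of s t] unfolding conic_point_def quad .
    have AB0: "A = 0" "B = 0" using E[of 1 0] E[of 0 1] by simp_all
    have e1: "M' + 2 * AB + 2 * AM + 2 * BM = 0" using E[of 1 1] AB0 by simp
    have e2: "M' + 2 * AB - 2 * AM - 2 * BM = 0" using E[of 1 "-1"] AB0 by simp
    have e3: "4 * M' + 8 * AB + 16 * AM + 4 * BM = 0" using E[of 2 1] AB0 by simp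
    have "2 * (M' + 2 * AB) = (M' + 2 * AB + 2 * AM + 2 * BM) + (M' + 2 * AB - 2 * AM - 2 * BM)"
      by (simp add: algebra_simps)
    then have "2 * (M' + 2 * AB) = 0" unfolding e1 e2 by (simp only: add_0_right)
    then have s1: "M' + 2 * AB = 0" using mult_eq_0_iff zero_neq_numeral by metis
    have "2 * (AM + BM) = (M' + 2 * AB + 2 * AM + 2 * BM) - (M' + 2 * AB)" by (simp add: algebra_simps)
    then have "2 * (AM + BM) = 0" using e1 s1 by (metis diff_0_right)
    then have s2: "AM + BM = 0" using mult_eq_0_iff zero_neq_numeral by metis
    have "4 * M' + 8 * AB + 16 * AM + 4 * BM = 4 * (M' + 2 * AB) + 4 * (AM + BM) + 12 * AM"
      by (simp add: algebra_simps)
    then have s3: "AM = 0" using e3 s1 s2 by simp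
    then have s4: "BM = 0" using s2 by simp
    have M': "M' = - (2 * AB)" using s1 by (simp add: eq_neg_iff_add_eq_0)
    have rel: "H p v v = (2 * AB) * H y v v" if v: "v \<in> T p" "v \<in> T y" for v
    proof -
      define x z w where "x = 2 * H y v b" and "z = 2 * H y v a" and "w = - H y v m"
      have veq: "v = x \<cdot> a + z \<cdot> b + w \<cdot> m"
        unfolding x_def z_def w_def by (rule decomposition_transverse[OF y(1) py f T v])
      have "H p v v = (2 * AB) * (x * z - w * w)"
        unfolding veq quad AB0 s3 s4 M' by (simp add: algebra_simps)
      moreover have "H y v v = x * z - w * w" unfolding veq H_frame_comb[OF f] by simp
      ultimately show ?thesis by simp
    qed
    \<comment> \<open>Otherwise \<open>H p\<close> would vanish on the kernel of a linear form on
      \<open>T p\<close>, against rank three.\<close>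
    have "AB \<noteq> 0"
    proof
      assume "AB = 0"
      obtain u1 u2 u3 where u: "u1 \<in> T p" "u2 \<in> T p" "u3 \<in> T p" and
        o: "H p u1 u2 = 0" "H p u1 u3 = 0" "H p u2 u3 = 0"
        "H p u1 u1 \<noteq> 0" "H p u2 u2 \<noteq> 0" "H p u3 u3 \<noteq> 0" using p(2) unfolding rank3_def by blast
      obtain x where x: "x \<in> fv.span {u1, u2, u3}" "lin_form n (\<lambda>i. g y (unit_vec i)) x = 0" "H p x x \<noteq> 0"
        using anisotropic_in_kernel[OF o] by blast
      have "x \<in> T p" using x(1) u fv.span_minimal[OF _ subspace_T, of "{u1, u2, u3}"] by blast
      moreover from this have "x \<in> T y" using x(2) T_vecs unfolding T_eq[of y] by blast
      ultimately show False using rel[of x] x(3) \<open>AB = 0\<close> by simp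
    qed
    then have "2 * AB \<noteq> 0" by simp
    then have "compatible p y" unfolding compatible_def using rel by blast
    then show ?thesis ..
  qed
qed

lemma homog_H: "homog (d - 2) (\<lambda>x. H x u v)"
  unfolding H_def
proof (rule homog_dd)
  have "Suc (d - 2) = d - 1" using d_ge by simp
  then show "homog (Suc (d - 2)) (dd v F)" using homog_g[of v] unfolding g_def by (simp only:)
qed (rule polyfun_dd[OF polyfun_F])

lemma scaled_point:
  assumes "c \<noteq> 0"
  shows "T (c \<cdot> y) = T y" "H (c \<cdot> y) u v = 0 \<longleftrightarrow> H y u v = 0"
  using assms homog_g homog_H[of u v] unfolding T_def homog_def by auto

text \<open>As the general point \<open>y\<close> of the hypersurface specializes to \<open>p\<close>, the plane \<open>T p \<inter> T y\<close>
  specializes to one through \<open>p\<close>, and some zero of \<open>H y\<close> on it specializes to \<open>p\<close>; as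
  \<open>G p \<noteq> 0\<close>, this excludes that \<open>G\<close> vanishes on the conic.\<close>

lemma conic_not_in_residual:
  assumes p: "smooth p" "rank3 p" and G: "polyfun n G" "G p \<noteq> 0"
  shows "\<not> frequently (\<lambda>y. smooth y \<and> g p y \<noteq> 0 \<and>
    (\<forall>v. v \<in> T p \<longrightarrow> v \<in> T y \<longrightarrow> H y v v = 0 \<longrightarrow> G v = 0)) gen"
proof
  define \<phi> where "\<phi> y \<longleftrightarrow> smooth y \<and> g p y \<noteq> 0 \<and>
    (\<forall>v. v \<in> T p \<longrightarrow> v \<in> T y \<longrightarrow> H y v v = 0 \<longrightarrow> G v = 0)" for y
  assume "frequently (\<lambda>y. smooth y \<and> g p y \<noteq> 0 \<and>
    (\<forall>v. v \<in> T p \<longrightarrow> v \<in> T y \<longrightarrow> H y v v = 0 \<longrightarrow> G v = 0)) gen"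
  then have freq: "frequently \<phi> gen" by (simp add: \<phi>_def[abs_def])
  have pX: "p \<in> X" using p by (simp add: smooth_def)
  note pT = self_T[OF pX]
  obtain \<G> where \<G>: "place {x \<in> X. \<phi> x} \<G>" "\<And>f. polyfun n f \<Longrightarrow> (f, f p) \<in> \<G>"
    using generic_place[OF freq pX] by blast
  obtain k where k: "k \<le> n" "p k \<noteq> 0" using nonzero_coordinate[OF pX smooth_nonzero[OF p(1)]] by blast
  define S1 where "S1 = {x \<in> X. \<phi> x} \<inter> {x. x k \<noteq> 0}"
  have xk: "((\<lambda>x. x k), p k) \<in> \<G>" using \<G>(2)[OF polyfun.coord[OF k(1)]] .
  have S1: "place S1 \<G>" unfolding S1_def by (rule place_ne_0[OF \<G>(1) xk k(2)])
  note G1 = place_partial_hom[OF S1]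
  \<comment> \<open>Rescales the general point so that its coordinate at \<open>k\<close> agrees
    with that of \<open>p\<close>; the displacement \<open>v\<close> has no component there.\<close>
  define lam where "lam x = p k * (1 / x k)" for x :: "nat \<Rightarrow> 'a"
  have "((\<lambda>x. 1 / x k), 1 / p k) \<in> \<G>"
    by (rule place_inverse[OF S1 xk k(2)]) (simp add: S1_def)
  from partial_hom_cmult[OF G1 this, of "p k"] have lam: "(lam, 1) \<in> \<G>"
    unfolding lam_def[abs_def] using k(2) by simp
  have lamx: "((\<lambda>x. lam x * x i), p i) \<in> \<G>" if "i \<le> n" for i
    using partial_hom_mult[OF G1 lam \<G>(2)[OF polyfun.coord[OF that]]] by simp
  define v where "v i x = lam x * x i - p i" for i and x :: "nat \<Rightarrow> 'a"
  have v: "(v i, 0) \<in> \<G>" if "i \<le> n" for i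
    using partial_hom_diff[OF G1 lamx[OF that] partial_hom_const[OF G1, of "p i"]]
    unfolding v_def[abs_def] by simp
  have vec: "x i = 0" "p i = 0" if "x \<in> S1" "i > n" for x i
    using that pX by (auto simp: S1_def X_def vecs_def vec_in_def)
  have lam_nz: "lam x \<noteq> 0" if "x \<in> S1" for x using that k(2) by (simp add: lam_def S1_def)
  have "\<exists>i\<in>{..n}. v i x \<noteq> 0" if x: "x \<in> S1" for x
  proof (rule ccontr)
    assume neg: "\<not> (\<exists>i\<in>{..n}. v i x \<noteq> 0)"
    have "(lam x \<cdot> x) i = p i" for i
      using neg vec[OF x, of i] by (cases "i \<le> n") (auto simp: v_def)
    then have "lam x \<cdot> x = p" by blast
    then have "lam x * g p x = g p p" using g_linear(3)[of p "lam x" x] by simp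
    then have "g p x = 0" using g_self_0[OF pX] lam_nz[OF x] by simp
    then show False using x by (simp add: S1_def \<phi>_def)
  qed
  then obtain S2 j where S2: "S2 \<subseteq> S1" "place S2 \<G>" and j: "j \<le> n" "\<And>x. x \<in> S2 \<Longrightarrow> v j x \<noteq> 0"
      "\<And>i. i \<le> n \<Longrightarrow> \<exists>c. ((\<lambda>x. v i x / v j x), c) \<in> \<G>"
    using place_normalize[OF S1, of "{..n}" v] by auto
  note G2 = place_partial_hom[OF S2(2)]
  \<comment> \<open>The dominant coordinate of the displacement. Division by it gives the secant
    direction \<open>w\<close>, with limit \<open>w0\<close>.\<close>
  define \<epsilon> where "\<epsilon> = v j"
  have \<epsilon>: "(\<epsilon>, 0) \<in> \<G>" unfolding \<epsilon>_def by (rule v[OF j(1)])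
  have \<epsilon>_nz: "\<epsilon> x \<noteq> 0" if "x \<in> S2" for x using j(2)[OF that] by (simp add: \<epsilon>_def)
  define w where "w x i = v i x / \<epsilon> x" for x i
  obtain w0' where w0': "\<And>i. i \<le> n \<Longrightarrow> ((\<lambda>x. w x i), w0' i) \<in> \<G>"
    using j(3) unfolding w_def \<epsilon>_def by metis
  define w0 where "w0 i = (if i \<le> n then w0' i else 0)" for i
  have w0: "((\<lambda>x. w x i), w0 i) \<in> \<G>" if "i \<le> n" for i
    using w0'[OF that] that by (simp add: w0_def)
  have w0_vec: "w0 \<in> vecs n" by (simp add: w0_def vecs_def vec_in_def)
  have w0j: "w0 j = 1"
    by (rule partial_hom_unique[OF G2 w0[OF j(1)] partial_hom_const[OF G2, of 1]])
       (simp add: w_def \<epsilon>_def j(2))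
  have w0k: "w0 k = 0"
    by (rule partial_hom_zero[OF G2 w0[OF k(1)]])
       (use S2(1) in \<open>auto simp: w_def v_def lam_def S1_def\<close>)
  define y where "y x = lam x \<cdot> x" for x
  have y_eq: "y x = p + \<epsilon> x \<cdot> w x" if x: "x \<in> S2" for x
  proof
    fix i
    have "\<epsilon> x * w x i = v i x" using \<epsilon>_nz[OF x] by (simp add: w_def)
    then show "y x i = (p + \<epsilon> x \<cdot> w x) i" by (simp add: y_def v_def)
  qed
  have y_lim: "((\<lambda>x. y x i), p i) \<in> \<G>" if "i \<le> n" for i
    using lamx[OF that] by (simp add: y_def)
  have Ty: "T (y x) = T x" "H (y x) u u' = 0 \<longleftrightarrow> H x u u' = 0" if "x \<in> S2" for x u u'
    unfolding y_def using scaled_point lam_nz[of x] that S2(1) by blast+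
  have first_order: "((\<lambda>x. dd (w x) f p), dd w0 f p) \<in> \<G> \<and>
      (\<exists>R r. (R, r) \<in> \<G> \<and> (\<forall>x. f (p + \<epsilon> x \<cdot> w x) = f p + \<epsilon> x * dd (w x) f p + \<epsilon> x ^ 2 * R x))"
    if "polyfun n f" for f
    by (rule polyfun_lim_first_order[OF G2 _ \<epsilon> that]) (rule w0)
  \<comment> \<open>Both ends of the secant lie on \<open>X\<close>; after division by \<epsilon>
    only the first-order term survives in the limit.\<close>
  have w0T: "w0 \<in> T p"
  proof -
    obtain R r where R: "(R, r) \<in> \<G>" "\<And>x. F (p + \<epsilon> x \<cdot> w x) = F p + \<epsilon> x * dd (w x) F p + \<epsilon> x ^ 2 * R x"
      and lim: "((\<lambda>x. dd (w x) F p), dd w0 F p) \<in> \<G>"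
      using first_order[OF polyfun_F] by blast
    have "((\<lambda>x. dd (w x) F p + \<epsilon> x * R x), dd w0 F p + 0 * r) \<in> \<G>"
      by (rule partial_hom_add[OF G2 lim partial_hom_mult[OF G2 \<epsilon> R(1)]])
    then have "dd w0 F p + 0 * r = 0"
    proof (rule partial_hom_zero[OF G2])
      fix x assume x: "x \<in> S2"
      have "F (y x) = lam x ^ d * F x" using homog_F unfolding homog_def y_def by blast
      also have "F x = 0" using x S2(1) by (auto simp: S1_def X_def)
      finally have "F (y x) = 0" by simp
      then have "0 = F p + \<epsilon> x * dd (w x) F p + \<epsilon> x ^ 2 * R x" using R(2)[of x] y_eq[OF x] by metis
      also have "F p = 0" using pX by (simp add: X_def)
      finally have "\<epsilon> x * (dd (w x) F p + \<epsilon> x * R x) = 0" by (simp add: algebra_simps power2_eq_square)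
      then show "dd (w x) F p + \<epsilon> x * R x = 0" using \<epsilon>_nz[OF x] by simp
    qed
    then show ?thesis using w0_vec by (simp add: T_def g_def)
  qed
  \<comment> \<open>On \<open>T p\<close>, the tangent form at \<open>y x\<close> is \<epsilon>
    times a function with limit \<open>H p w0 u\<close>. So the planes
    \<open>T p \<inter> T (y x)\<close> tend to the polar of \<open>w0\<close> in
    \<open>T p\<close>.\<close>
  have \<theta>: "\<exists>\<theta>. (\<theta>, H p w0 u) \<in> \<G> \<and> (\<forall>x\<in>S2. g (y x) u = \<epsilon> x * \<theta> x)" if u: "u \<in> T p" for u
  proof -
    obtain R r where R: "(R, r) \<in> \<G>"
        "\<And>x. dd u F (p + \<epsilon> x \<cdot> w x) = dd u F p + \<epsilon> x * dd (w x) (dd u F) p + \<epsilon> x ^ 2 * R x"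
      and lim: "((\<lambda>x. dd (w x) (dd u F) p), dd w0 (dd u F) p) \<in> \<G>"
      using first_order[OF polyfun_dd[OF polyfun_F, where w = u]] by blast
    define \<theta> where "\<theta> x = dd (w x) (dd u F) p + \<epsilon> x * R x" for x
    have "(\<theta>, dd w0 (dd u F) p + 0 * r) \<in> \<G>"
      unfolding \<theta>_def[abs_def] by (rule partial_hom_add[OF G2 lim partial_hom_mult[OF G2 \<epsilon> R(1)]])
    moreover have "g (y x) u = \<epsilon> x * \<theta> x" if x: "x \<in> S2" for x
      unfolding g_def y_eq[OF x] R(2) \<theta>_def using u
      by (simp add: T_def g_def algebra_simps power2_eq_square)
    ultimately show ?thesis by (auto simp: H_def)
  qed
  obtain a b m where f: "normal_frame p a b m" using normal_frame_exists[OF p(2)] by blast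
  note FR = f[unfolded normal_frame_def]
  \<comment> \<open>The coordinates of \<open>w0\<close> at \<open>k\<close> and \<open>j\<close>
    are 0 and 1, so it is no multiple of \<open>p\<close> and not in the radical; its polar is a
    plane.\<close>
  have "H p w0 a \<noteq> 0 \<or> H p w0 b \<noteq> 0 \<or> H p w0 m \<noteq> 0"
  proof (rule ccontr)
    assume "\<not> ?thesis"
    then obtain c where c: "w0 = c \<cdot> p"
      using frame_decomposition[OF p(1) f w0T] by auto
    have "c * p k = 0" using fun_cong[OF c, of k] w0k by simp
    then have "c = 0" using k(2) by simp
    then show False using fun_cong[OF c, of j] w0j by simp
  qed
  then obtain u1 where u1: "u1 \<in> T p" "H p w0 u1 \<noteq> 0" using FR by blast
  obtain m1 where m1: "m1 \<in> T p" "H p w0 m1 = 0" "H p m1 m1 \<noteq> 0"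
  proof -
    obtain u1 u2 u3 where u: "u1 \<in> T p" "u2 \<in> T p" "u3 \<in> T p" and
      o: "H p u1 u2 = 0" "H p u1 u3 = 0" "H p u2 u3 = 0"
      "H p u1 u1 \<noteq> 0" "H p u2 u2 \<noteq> 0" "H p u3 u3 \<noteq> 0" using p(2) unfolding rank3_def by blast
    obtain x where x: "x \<in> fv.span {u1, u2, u3}" "lin_form n (\<lambda>i. H p (unit_vec i) w0) x = 0" "H p x x \<noteq> 0"
      using anisotropic_in_kernel[OF o] by blast
    have "x \<in> T p" using x(1) u fv.span_minimal[OF _ subspace_T, of "{u1, u2, u3}"] by blast
    moreover have "H p w0 x = 0" using x(2) H_form[of p x w0] H_sym[of p x w0] by simp
    ultimately show ?thesis using that x(3) by blast
  qed
  obtain \<theta>p where \<theta>p: "(\<theta>p, 0) \<in> \<G>" "\<And>x. x \<in> S2 \<Longrightarrow> g (y x) p = \<epsilon> x * \<theta>p x"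
    using \<theta>[OF pT] H_self_T(2)[OF w0T] by auto
  obtain \<theta>1 where \<theta>1: "(\<theta>1, H p w0 u1) \<in> \<G>" "\<And>x. x \<in> S2 \<Longrightarrow> g (y x) u1 = \<epsilon> x * \<theta>1 x"
    using \<theta>[OF u1(1)] by auto
  obtain \<theta>m where \<theta>m: "(\<theta>m, 0) \<in> \<G>" "\<And>x. x \<in> S2 \<Longrightarrow> g (y x) m1 = \<epsilon> x * \<theta>m x"
    using \<theta>[OF m1(1)] m1(2) by auto
  define S3 where "S3 = S2 \<inter> {x. \<theta>1 x \<noteq> 0}"
  have S3: "place S3 \<G>" unfolding S3_def by (rule place_ne_0[OF S2(2) \<theta>1(1) u1(2)])
  note G3 = place_partial_hom[OF S3]
  have inv1: "((\<lambda>x. 1 / \<theta>1 x), 1 / H p w0 u1) \<in> \<G>"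
    by (rule place_inverse[OF S3 \<theta>1(1) u1(2)]) (simp add: S3_def)
  define \<sigma> where "\<sigma> x = \<theta>p x * (1 / \<theta>1 x)" for x
  define \<tau> where "\<tau> x = \<theta>m x * (1 / \<theta>1 x)" for x
  have \<sigma>: "(\<sigma>, 0) \<in> \<G>" unfolding \<sigma>_def[abs_def] using partial_hom_mult[OF G3 \<theta>p(1) inv1] by simp
  have \<tau>: "(\<tau>, 0) \<in> \<G>" unfolding \<tau>_def[abs_def] using partial_hom_mult[OF G3 \<theta>m(1) inv1] by simp
  \<comment> \<open>Infinitesimal multiples of \<open>u1\<close> move \<open>p\<close> and
    \<open>m1\<close>, which lie in the limit plane, into \<open>T (y x)\<close>.\<close>
  define P where "P x = p + (- \<sigma> x) \<cdot> u1" for x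
  define Q where "Q x = m1 + (- \<tau> x) \<cdot> u1" for x
  have PQ_T: "P x \<in> T p" "Q x \<in> T p" for x
    unfolding P_def Q_def by (intro fv.subspace_add fv.subspace_scale subspace_T pT u1(1) m1(1))+
  have PQ_y: "g (y x) (P x) = 0" "g (y x) (Q x) = 0" if x: "x \<in> S3" for x
  proof -
    have x2: "x \<in> S2" "\<theta>1 x \<noteq> 0" using x by (auto simp: S3_def)
    show "g (y x) (P x) = 0" "g (y x) (Q x) = 0"
      unfolding P_def Q_def \<sigma>_def \<tau>_def using x2
      by (simp_all only: g_linear \<theta>p(2) \<theta>1(2) \<theta>m(2)) simp_all
  qed
  have Hlim: "((\<lambda>x. H (y x) u u'), H p u u') \<in> \<G>" for u u'
    by (rule polyfun_lim[OF G3 _ polyfun_H]) (rule y_lim)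
  have pm: "H p p m1 = 0" "H p p u1 = 0" "H p p p = 0" "H p m1 p = 0" "H p u1 p = 0"
    using H_self_T m1 u1 pT by auto
  \<comment> \<open>Coefficients of \<open>H (y x)\<close> on the line
    \<open>P x + t \<cdot> Q x\<close>. In the limit only \<open>H p m1 m1 * t ^ 2\<close> remains,
    so a root tends to 0 and the corresponding point to \<open>p\<close>.\<close>
  define \<alpha> where "\<alpha> x = H (y x) (Q x) (Q x)" for x
  define \<beta> where "\<beta> x = 2 * H (y x) (P x) (Q x)" for x
  define \<gamma> where "\<gamma> x = H (y x) (P x) (P x)" for x
  have "((\<lambda>x. H (y x) m1 m1 + - \<tau> x * H (y x) u1 m1 + - \<tau> x * (H (y x) m1 u1 + - \<tau> x * H (y x) u1 u1)),
      H p m1 m1 + - 0 * H p u1 m1 + - 0 * (H p m1 u1 + - 0 * H p u1 u1)) \<in> \<G>"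
    by (intro partial_hom_add[OF G3] partial_hom_mult[OF G3] partial_hom_uminus[OF G3] Hlim \<tau>)
  moreover have "\<alpha> = (\<lambda>x. H (y x) m1 m1 + - \<tau> x * H (y x) u1 m1 + - \<tau> x * (H (y x) m1 u1 + - \<tau> x * H (y x) u1 u1))"
    unfolding \<alpha>_def Q_def by (simp only: H_left H_right)
  ultimately have \<alpha>: "(\<alpha>, H p m1 m1) \<in> \<G>" by simp
  have "((\<lambda>x. 2 * (H (y x) p m1 + - \<sigma> x * H (y x) u1 m1 + - \<tau> x * (H (y x) p u1 + - \<sigma> x * H (y x) u1 u1))),
      2 * (H p p m1 + - 0 * H p u1 m1 + - 0 * (H p p u1 + - 0 * H p u1 u1))) \<in> \<G>"
    by (intro partial_hom_cmult[OF G3] partial_hom_add[OF G3] partial_hom_mult[OF G3] partial_hom_uminus[OF G3] Hlim \<tau> \<sigma>)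
  moreover have "\<beta> = (\<lambda>x. 2 * (H (y x) p m1 + - \<sigma> x * H (y x) u1 m1 + - \<tau> x * (H (y x) p u1 + - \<sigma> x * H (y x) u1 u1)))"
    unfolding \<beta>_def P_def Q_def by (simp only: H_left H_right)
  ultimately have \<beta>: "(\<beta>, 0) \<in> \<G>" using pm by simp
  have "((\<lambda>x. H (y x) p p + - \<sigma> x * H (y x) u1 p + - \<sigma> x * (H (y x) p u1 + - \<sigma> x * H (y x) u1 u1)),
      H p p p + - 0 * H p u1 p + - 0 * (H p p u1 + - 0 * H p u1 u1)) \<in> \<G>"
    by (intro partial_hom_add[OF G3] partial_hom_mult[OF G3] partial_hom_uminus[OF G3] Hlim \<sigma>)
  moreover have "\<gamma> = (\<lambda>x. H (y x) p p + - \<sigma> x * H (y x) u1 p + - \<sigma> x * (H (y x) p u1 + - \<sigma> x * H (y x) u1 u1))"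
    unfolding \<gamma>_def P_def by (simp only: H_left H_right)
  ultimately have \<gamma>: "(\<gamma>, 0) \<in> \<G>" using pm by simp
  define S4 where "S4 = S3 \<inter> {x. \<alpha> x \<noteq> 0}"
  have S4: "place S4 \<G>" unfolding S4_def by (rule place_ne_0[OF S3 \<alpha> m1(3)])
  note G4 = place_partial_hom[OF S4]
  have "\<exists>t. \<alpha> x * t ^ 2 + \<beta> x * t + \<gamma> x = 0" if "x \<in> S4" for x
  proof -
    have "degree [:\<gamma> x, \<beta> x, \<alpha> x:] \<ge> 1" using that by (simp add: S4_def)
    then obtain t where "poly [:\<gamma> x, \<beta> x, \<alpha> x:] t = 0" using alg unfolding alg_closed_field_def by blast
    then show ?thesis by (intro exI[of _ t]) (simp add: algebra_simps power2_eq_square)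
  qed
  then obtain t where t: "\<And>x. x \<in> S4 \<Longrightarrow> \<alpha> x * t x ^ 2 + \<beta> x * t x + \<gamma> x = 0" by metis
  have t0: "(t, 0) \<in> \<G>" by (rule place_quadratic_root[OF S4 \<alpha> m1(3) \<beta> \<gamma> t])
  define z where "z x = P x + t x \<cdot> Q x" for x
  have z_lim: "((\<lambda>x. z x i), p i) \<in> \<G>" for i
  proof -
    have "((\<lambda>x. (p i + - \<sigma> x * u1 i) + t x * (m1 i + - \<tau> x * u1 i)),
        (p i + - 0 * u1 i) + 0 * (m1 i + - 0 * u1 i)) \<in> \<G>"
      by (intro partial_hom_add[OF G4] partial_hom_mult[OF G4] partial_hom_uminus[OF G4]
          partial_hom_const[OF G4] \<sigma> \<tau> t0)
    then show ?thesis by (simp add: z_def P_def Q_def)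
  qed
  have Gz: "G (z x) = 0" if x: "x \<in> S4" for x
  proof -
    have x3: "x \<in> S3" "x \<in> S2" using x by (auto simp: S4_def S3_def)
    have zT: "z x \<in> T p" unfolding z_def using PQ_T subspace_T by (intro fv.subspace_add fv.subspace_scale)
    have "g (y x) (z x) = 0" unfolding z_def by (simp only: g_linear PQ_y[OF x3(1)]) simp
    then have "z x \<in> T (y x)" using zT T_vecs by (auto simp: T_def)
    then have zTx: "z x \<in> T x" using Ty(1)[OF x3(2)] by simp
    have "H (y x) (z x) (z x) = \<alpha> x * t x ^ 2 + \<beta> x * t x + \<gamma> x"
      unfolding z_def \<alpha>_def \<beta>_def \<gamma>_def
      by (simp only: H_left H_right H_sym[of "y x" "Q x" "P x"]) (simp add: algebra_simps power2_eq_square)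
    then have "H x (z x) (z x) = 0" using t[OF x] Ty(2)[OF x3(2)] by simp
    moreover have "\<phi> x" using x3(2) S2(1) by (auto simp: S1_def)
    ultimately show ?thesis using zT zTx unfolding \<phi>_def by blast
  qed
  have G_lim: "((\<lambda>x. G (z x)), G p) \<in> \<G>" by (rule polyfun_lim[OF G4 _ G(1)]) (rule z_lim)
  have "G p = 0" by (rule partial_hom_zero[OF G4 G_lim Gz])
  then show False using G(2) by simp
qed

section \<open>The quadric containing all the cones\<close>

lemma g_eventually:
  assumes "x \<in> vecs n" "g p x \<noteq> 0"
  shows "eventually (\<lambda>y. g p y \<noteq> 0) gen"
proof -
  have "polyfun n (\<lambda>y. g p y)" by (subst g_form) (rule polyfun_lin_form)
  moreover have "homog 1 (\<lambda>y. g p y)" by (simp add: homog_def g_linear)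
  ultimately show ?thesis using low_degree_eventually[of "\<lambda>y. g p y" 1 x] assms d_ge by simp
qed

text \<open>The form \<open>g y e\<close> in \<open>y\<close> has a nonzero derivative at
  \<open>p\<close> in direction \<open>w\<close>, so it is a nonzero form, of degree
  \<open>d - 1\<close>.\<close>

lemma polar_eventually:
  assumes "H p e w \<noteq> 0"
  shows "eventually (\<lambda>y. g y e \<noteq> 0) gen"
proof -
  have "\<exists>y. g y e \<noteq> 0"
  proof (rule ccontr)
    assume "\<not> (\<exists>y. g y e \<noteq> 0)"
    then have "dd e F = (\<lambda>_. 0)" by (auto simp: g_def fun_eq_iff)
    then have "H p w e = 0" by (simp add: H_def)
    then show False using assms H_sym by metis
  qed
  then show ?thesis
    using low_degree_eventually[OF polyfun_g homog_g] d_ge by auto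
qed

lemma eventually_compatible:
  assumes p: "smooth p" "rank3 p"
  shows "eventually (\<lambda>y. g p y \<noteq> 0 \<and> g y p \<noteq> 0 \<and> (smooth y \<and> rank3 y \<longrightarrow> compatible p y)) gen"
proof -
  obtain x where x: "x \<in> vecs n" "g p x \<noteq> 0" using p(1) by (auto simp: smooth_def)
  have 1: "eventually (\<lambda>y. g p y \<noteq> 0) gen" by (rule g_eventually[OF x])
  have "H p p x \<noteq> 0" using x(2) d_ge by (simp add: H_self)
  then have 2: "eventually (\<lambda>y. g y p \<noteq> 0) gen" by (rule polar_eventually)
  obtain G where G: "polyfun n G" "G p \<noteq> 0" "\<And>v. v \<in> T p \<Longrightarrow> F v = H p v v * G v"
    using quotient_by_second_form[OF p] by blast
  have 3: "eventually (\<lambda>y. \<not> (smooth y \<and> g p y \<noteq> 0 \<and>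
    (\<forall>v. v \<in> T p \<longrightarrow> v \<in> T y \<longrightarrow> H y v v = 0 \<longrightarrow> G v = 0))) gen"
    using conic_not_in_residual[OF p G(1,2)] unfolding frequently_def by simp
  show ?thesis
    using 1 2 3
  proof eventually_elim
    case (elim y)
    then show ?case using conic_alternative[OF p _ _ _ G(1,3), of y] by blast
  qed
qed

lemma polyfun_g_arg: "polyfun n (\<lambda>v. g p v)"
  by (subst g_form) (rule polyfun_lin_form)

text \<open>The quadric cones cut out by \<open>H p\<close> on the tangent hyperplanes \<open>T p\<close> at general points are
  compatible, and two of them determine a pencil of quadrics. All cones lie in members of this
  pencil, and pairwise compatibility forces them into one and the same quadric, which then
  contains the hypersurface.\<close>

lemma rank3_not_frequent: "\<not> frequently (\<lambda>p. smooth p \<and> rank3 p) gen"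
proof
  assume freq: "frequently (\<lambda>p. smooth p \<and> rank3 p) gen"
  have pick: "\<exists>y. (smooth y \<and> rank3 y) \<and> \<psi> y" if "eventually \<psi> gen" for \<psi>
  proof (rule ccontr)
    assume "\<not> ?thesis"
    then have "eventually (\<lambda>y. \<not> (smooth y \<and> rank3 y)) gen"
      using that by (auto elim: eventually_mono)
    then show False using freq by (simp add: frequently_def)
  qed
  obtain p where p: "smooth p" "rank3 p" using pick[of "\<lambda>_. True"] by auto
  note Ep = eventually_compatible[OF p]
  obtain q where q: "smooth q" "rank3 q" and pq: "g p q \<noteq> 0" "g q p \<noteq> 0" "compatible p q"
    using pick[OF Ep] by blast
  note Eq = eventually_compatible[OF q]
  \<comment> \<open>A vector tangent at \<open>p\<close> and \<open>q\<close>: adding multiples of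
    it moves points into a third tangent hyperplane without changing \<open>g p\<close> and
    \<open>g q\<close>. Coming from a frame, it is not tangent at the general point.\<close>
  obtain e b m where fe: "normal_frame p e b m" "e \<in> T q"
    using normal_frame_transverse[OF p pq(2)] by blast
  have eT: "e \<in> T p" and eb: "H p e b = 1 / 2" using fe(1) unfolding normal_frame_def by blast+
  have Ee: "eventually (\<lambda>y. g y e \<noteq> 0) gen" by (rule polar_eventually[of p e b]) (simp add: eb)
  obtain z where z: "smooth z" "rank3 z" and pz: "g p z \<noteq> 0" "g z p \<noteq> 0" "compatible p z"
    and qz: "g q z \<noteq> 0" "g z q \<noteq> 0" "compatible q z" and ez: "g z e \<noteq> 0"
    using pick[OF eventually_conj[OF Ep eventually_conj[OF Eq Ee]]] by blast
  note Ez = eventually_compatible[OF z]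
  obtain e1 b1 m1 where fe1: "normal_frame p e1 b1 m1" "e1 \<in> T z"
    using normal_frame_transverse[OF p pz(2)] by blast
  have e1T: "e1 \<in> T p" and eb1: "H p e1 b1 = 1 / 2" using fe1(1) unfolding normal_frame_def by blast+
  have Ee1: "eventually (\<lambda>y. g y e1 \<noteq> 0) gen" by (rule polar_eventually[of p e1 b1]) (simp add: eb1)
  obtain e2 b2 m2 where fe2: "normal_frame q e2 b2 m2" "e2 \<in> T z"
    using normal_frame_transverse[OF q qz(2)] by blast
  have e2T: "e2 \<in> T q" and eb2: "H q e2 b2 = 1 / 2" using fe2(1) unfolding normal_frame_def by blast+
  have Ee2: "eventually (\<lambda>y. g y e2 \<noteq> 0) gen" by (rule polar_eventually[of q e2 b2]) (simp add: eb2)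

  have pX: "p \<in> X" and qX: "q \<in> X" using p q by (auto simp: smooth_def)
  note pT = self_T[OF pX] and qT = self_T[OF qX]
  have gpp: "g p p = 0" "g q q = 0" using g_self_0 pX qX by auto
  have pqv: "p \<in> vecs n" "q \<in> vecs n" using pX qX by (auto simp: X_def)
  obtain \<kappa> where \<kappa>: "\<kappa> \<noteq> 0" "\<And>v. v \<in> T p \<Longrightarrow> v \<in> T q \<Longrightarrow> H p v v = \<kappa> * H q v v"
    using pq(3) unfolding compatible_def by blast
  define \<pi>1 where "\<pi>1 v = v + (- (1 / g p q) * g p v) \<cdot> q" for v
  define \<pi>2 where "\<pi>2 v = v + (- (1 / g q p) * g q v) \<cdot> p" for v
  have \<pi>_add: "\<pi>1 (u + v) = \<pi>1 u + \<pi>1 v" "\<pi>2 (u + v) = \<pi>2 u + \<pi>2 v" for u v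
    unfolding \<pi>1_def \<pi>2_def g_linear by (simp_all add: fun_eq_iff algebra_simps)
  have \<pi>_scl: "\<pi>1 (c \<cdot> v) = c \<cdot> \<pi>1 v" "\<pi>2 (c \<cdot> v) = c \<cdot> \<pi>2 v" for c v
    unfolding \<pi>1_def \<pi>2_def g_linear by (simp_all add: fun_eq_iff algebra_simps)
  have \<pi>_id: "\<pi>1 v = v" if "v \<in> T p" for v using that by (simp add: \<pi>1_def T_def)
  have \<pi>_id': "\<pi>2 v = v" if "v \<in> T q" for v using that by (simp add: \<pi>2_def T_def)
  have \<pi>1_T: "\<pi>1 v \<in> T p" "\<pi>1 v \<in> T q" if v: "v \<in> T q" for v
  proof -
    show *: "\<pi>1 v \<in> T q" unfolding \<pi>1_def by (intro fv.subspace_add fv.subspace_scale subspace_T v qT)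
    have "g p (\<pi>1 v) = 0" unfolding \<pi>1_def using pq(1) by (simp only: g_linear) simp
    then show "\<pi>1 v \<in> T p" using * by (simp add: T_def)
  qed
  have \<pi>2_T: "\<pi>2 v \<in> T p" "\<pi>2 v \<in> T q" if v: "v \<in> T p" for v
  proof -
    show *: "\<pi>2 v \<in> T p" unfolding \<pi>2_def by (intro fv.subspace_add fv.subspace_scale subspace_T v pT)
    have "g q (\<pi>2 v) = 0" unfolding \<pi>2_def using pq(2) by (simp only: g_linear) simp
    then show "\<pi>2 v \<in> T q" using * by (simp add: T_def)
  qed
  \<comment> \<open>Inclusion and exclusion with the projections along \<open>q\<close> and
    \<open>p\<close> glues \<open>H p\<close> on \<open>T p\<close> and
    \<open>\<kappa> * H q\<close> on \<open>T q\<close>, which agree on the intersection. The pencil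
    adds multiples of \<open>M\<close>, which vanishes on both hyperplanes.\<close>
  define B where "B u v = H p (\<pi>1 u) (\<pi>1 v) + \<kappa> * H q (\<pi>2 u) (\<pi>2 v) - \<kappa> * H q (\<pi>1 (\<pi>2 u)) (\<pi>1 (\<pi>2 v))" for u v
  have B_add: "B (u + v) w = B u w + B v w" for u v w
    unfolding B_def \<pi>_add by (simp only: H_left) (simp add: algebra_simps)
  have B_scl: "B (c \<cdot> u) w = c * B u w" for c u w
    unfolding B_def \<pi>_scl by (simp only: H_left) (simp add: algebra_simps)
  have B_sym: "B u v = B v u" for u v
    unfolding B_def using H_sym by metis
  have Bp: "B v v = H p v v" if v: "v \<in> T p" for v
    unfolding B_def \<pi>_id[OF v] \<pi>_id[OF \<pi>2_T(1)[OF v]] by simp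
  have Bq: "B v v = \<kappa> * H q v v" if v: "v \<in> T q" for v
    unfolding B_def \<pi>_id'[OF v] \<kappa>(2)[OF \<pi>1_T[OF v]] by simp
  define M where "M v = g p v * g q v" for v

  have pencil: "\<exists>a c. a \<noteq> 0 \<and> (\<forall>v\<in>T y. H y v v = a * (B v v + c * M v))"
    if y: "smooth y" "rank3 y" "g p y \<noteq> 0" "compatible p y" "compatible q y" "g y e \<noteq> 0" for y
  proof -
    obtain c1 where c1: "c1 \<noteq> 0" "\<And>v. v \<in> T p \<Longrightarrow> v \<in> T y \<Longrightarrow> H p v v = c1 * H y v v"
      using y(4) unfolding compatible_def by blast
    obtain c2 where c2: "c2 \<noteq> 0" "\<And>v. v \<in> T q \<Longrightarrow> v \<in> T y \<Longrightarrow> H q v v = c2 * H y v v"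
      using y(5) unfolding compatible_def by blast
    obtain x where x: "x \<in> T y" "x \<in> T p" "lin_form n (\<lambda>i. g q (unit_vec i)) x = 0" "H y x x \<noteq> 0"
      using anisotropic_transverse[OF y(1-3)] by blast
    have "x \<in> T q" using x(2,3) T_vecs unfolding T_eq[of q] by blast
    then have "c1 * H y x x = \<kappa> * (c2 * H y x x)"
      using Bp[of x] Bq[of x] c1(2)[of x] c2(2)[of x] x by simp
    then have c12: "\<kappa> * c2 = c1" using x(4) by (simp add: mult.assoc[symmetric])
    \<comment> \<open>As a quadratic form on \<open>T y\<close>, it vanishes where
      \<open>g p\<close> or \<open>g q\<close> does, hence is a multiple of \<open>M\<close>
      there.\<close>
    define D where "D u v = H y u v + (- (1 / c1)) * B u v" for u v
    define \<rho> where "\<rho> v = v + (- (g y v / g y e)) \<cdot> e" for v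
    have ge: "g p e = 0" "g q e = 0" using eT fe(2) by (auto simp: T_def)
    have ev: "e \<in> vecs n" using eT by (simp add: T_def)
    have \<rho>: "\<rho> v \<in> T y" "g p (\<rho> v) = g p v" "g q (\<rho> v) = g q v" if "v \<in> vecs n" for v
    proof -
      have "g y (\<rho> v) = 0" unfolding \<rho>_def using y(6) by (simp only: g_linear) simp
      moreover have "\<rho> v \<in> vecs n"
        unfolding \<rho>_def by (intro fv.subspace_add fv.subspace_scale subspace_vecs that ev)
      ultimately show "\<rho> v \<in> T y" by (simp add: T_def)
      show "g p (\<rho> v) = g p v" "g q (\<rho> v) = g q v" unfolding \<rho>_def by (simp_all only: g_linear ge) simp_all
    qed
    \<comment> \<open>Dual to \<open>g p\<close> and \<open>g q\<close> within \<open>T y\<close>;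
      the correction along \<open>e\<close> affects neither form.\<close>
    let ?f1 = "\<rho> ((1 / g p q) \<cdot> q)" and ?f2 = "\<rho> ((1 / g q p) \<cdot> p)"
    have vecs: "(1 / g p q) \<cdot> q \<in> vecs n" "(1 / g q p) \<cdot> p \<in> vecs n"
      by (intro fv.subspace_scale subspace_vecs pqv)+
    have "D v v = 2 * D ?f1 ?f2 * (g p v * g q v)" if v: "v \<in> T y" for v
    proof (rule bilinear_two_hyperplanes[where W = "T y"])
      show "D (u + v) w = D u w + D v w" for u v w
        unfolding D_def B_add H_left by (simp add: algebra_simps)
      show "D (c \<cdot> u) w = c * D u w" for c u w
        unfolding D_def B_scl H_left by (simp add: algebra_simps)
      show "D u v = D v u" for u v unfolding D_def using B_sym H_sym by metis
      show "?f1 \<in> T y" "?f2 \<in> T y" using \<rho>(1) vecs by auto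
      show "g p ?f1 = 1" "g q ?f1 = 0" "g p ?f2 = 0" "g q ?f2 = 1"
        using \<rho>(2,3)[OF vecs(1)] \<rho>(2,3)[OF vecs(2)] pq gpp by (simp_all add: g_linear)
      show "D w w = 0" if "w \<in> T y" "g p w = 0" for w
      proof -
        have "w \<in> T p" using that T_vecs by (auto simp: T_def)
        then show ?thesis using Bp[of w] c1 that(1) by (simp add: D_def)
      qed
      show "D w w = 0" if "w \<in> T y" "g q w = 0" for w
      proof -
        have "w \<in> T q" using that T_vecs by (auto simp: T_def)
        then have "B w w = c1 * H y w w" using Bq[of w] c2(2)[of w] that(1) c12 by (simp add: mult.assoc[symmetric])
        then show ?thesis using c1(1) by (simp add: D_def)
      qed
    qed (rule g_linear(1) g_linear(3) subspace_T v)+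
    then have Dv: "D v v = 2 * D ?f1 ?f2 * M v" if "v \<in> T y" for v using that by (simp only: M_def)
    have "H y v v = (1 / c1) * (B v v + (c1 * (2 * D ?f1 ?f2)) * M v)" if "v \<in> T y" for v
    proof -
      have "H y v v = (1 / c1) * B v v + D v v" by (simp add: D_def)
      also have "\<dots> = (1 / c1) * B v v + (1 / c1) * (c1 * (2 * D ?f1 ?f2) * M v)"
        unfolding Dv[OF that] using c1(1) by simp
      finally show ?thesis by (simp only: distrib_left)
    qed
    moreover have "1 / c1 \<noteq> 0" using c1(1) by simp
    ultimately show ?thesis by blast
  qed

  obtain az cz where az: "az \<noteq> 0" "\<And>v. v \<in> T z \<Longrightarrow> H z v v = az * (B v v + cz * M v)"
    using pencil[OF z pz(1,3) qz(3) ez] by blast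
  define f where "f v = B v v + cz * M v" for v

  have "f y = 0" if y: "smooth y" "rank3 y"
    and py: "g p y \<noteq> 0" "compatible p y" "compatible q y" "compatible z y" "g z y \<noteq> 0"
    and ey: "g y e \<noteq> 0" "g y e1 \<noteq> 0" "g y e2 \<noteq> 0" for y
  proof -
    obtain ay cy where ay: "ay \<noteq> 0" "\<And>v. v \<in> T y \<Longrightarrow> H y v v = ay * (B v v + cy * M v)"
      using pencil[OF y py(1,2,3) ey(1)] by blast
    obtain k where k: "k \<noteq> 0" "\<And>v. v \<in> T z \<Longrightarrow> v \<in> T y \<Longrightarrow> H z v v = k * H y v v"
      using py(4) unfolding compatible_def by blast
    obtain x where x: "x \<in> T y" "x \<in> T z" "lin_form n (\<lambda>i. g p (unit_vec i)) x = 0" "H y x x \<noteq> 0"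
      using anisotropic_transverse[OF y py(5)] by blast
    have "g p x = 0" using x(3) g_form[of p x] by simp
    then have Mx: "M x = 0" by (simp add: M_def)
    have Bx: "B x x \<noteq> 0" using ay(2)[OF x(1)] x(4) Mx by auto
    have "H z x x = az * B x x" "H y x x = ay * B x x"
      using ay(2)[OF x(1)] az(2)[OF x(2)] Mx by simp_all
    then have "az * B x x = (k * ay) * B x x" using k(2)[OF x(2,1)] by (metis mult.assoc)
    then have azk: "az = k * ay" using Bx by (metis mult_right_cancel)
    have zT: "z \<in> T z" using z self_T by (simp add: smooth_def)
    \<comment> \<open>Moving \<open>z\<close> into \<open>T y\<close> along \<open>e1\<close> keeps
      \<open>g p\<close> nonzero, along \<open>e2\<close> it keeps \<open>g q\<close> nonzero. One
      of \<open>v1\<close>, \<open>v2\<close>, \<open>v1 + v2\<close> then has both nonzero, and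
      comparing there gives \<open>cz = cy\<close>.\<close>
    define v1 where "v1 = z + (- (g y z / g y e1)) \<cdot> e1"
    define v2 where "v2 = z + (- (g y z / g y e2)) \<cdot> e2"
    have v12: "v1 \<in> T z" "v2 \<in> T z"
      unfolding v1_def v2_def by (intro fv.subspace_add fv.subspace_scale subspace_T zT fe1(2) fe2(2))+
    have gv: "g y v1 = 0" "g y v2 = 0"
      unfolding v1_def v2_def using ey by (simp_all only: g_linear) simp_all
    have vT: "v1 \<in> T y" "v2 \<in> T y" using v12 gv by (simp_all add: T_def)
    have ge: "g p e1 = 0" "g q e2 = 0" using e1T e2T by (auto simp: T_def)
    have gnz: "g p v1 \<noteq> 0" "g q v2 \<noteq> 0"
      unfolding v1_def v2_def using pz(1) qz(1) by (simp_all only: g_linear ge) simp_all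
    have "\<exists>v. v \<in> T z \<and> v \<in> T y \<and> g p v \<noteq> 0 \<and> g q v \<noteq> 0"
    proof (cases "g q v1 = 0 \<and> g p v2 = 0")
      case True
      then have "g p (v1 + v2) \<noteq> 0" "g q (v1 + v2) \<noteq> 0" using gnz by (simp_all only: g_linear) simp_all
      moreover have "v1 + v2 \<in> T z" "v1 + v2 \<in> T y"
        using v12 vT by (auto intro: fv.subspace_add[OF subspace_T])
      ultimately show ?thesis by blast
    next
      case False
      then show ?thesis using v12 vT gnz by blast
    qed
    then obtain v where v: "v \<in> T z" "v \<in> T y" "g p v \<noteq> 0" "g q v \<noteq> 0" by blast
    have "az * (B v v + cz * M v) = k * (ay * (B v v + cy * M v))"
      using az(2)[OF v(1)] ay(2)[OF v(2)] k(2)[OF v(1,2)] by metis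
    then have "az * (B v v + cz * M v) = az * (B v v + cy * M v)" using azk by (simp add: mult.assoc)
    then have "cz * M v = cy * M v" using az(1) by simp
    then have cc: "cz = cy" using v(3,4) by (simp add: M_def)
    have yT: "y \<in> T y" using y self_T by (simp add: smooth_def)
    have "ay * (B y y + cy * M y) = 0" using ay(2)[OF yT] H_self_T(1)[OF yT] by simp
    then show "f y = 0" using ay(1) cc by (simp add: f_def)
  qed
  note fy = this
  have "frequently (\<lambda>y. f y = 0) gen"
    unfolding frequently_def
  proof
    assume "eventually (\<lambda>y. f y \<noteq> 0) gen"
    from pick[OF eventually_conj[OF this eventually_conj[OF Ep eventually_conj[OF Eq eventually_conj[OF Ez
        eventually_conj[OF Ee eventually_conj[OF Ee1 Ee2]]]]]]]
    show False using fy by blast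
  qed
  moreover have "polyfun n f"
  proof -
    have \<pi>: "polyfun n (\<lambda>v. \<pi>1 v i)" "polyfun n (\<lambda>v. \<pi>2 v i)" if "i \<le> n" for i
      unfolding \<pi>1_def \<pi>2_def
      by (simp_all only: plus_fun_apply scl_apply)
         (intro polyfun.add polyfun.mult polyfun.const polyfun.coord polyfun_g_arg that)+
    have "polyfun n (\<lambda>v. \<pi>1 (\<pi>2 v) i)" if "i \<le> n" for i
      by (rule polyfun_comp[OF \<pi>(1)[OF that]]) (rule \<pi>(2))
    then show ?thesis
      unfolding f_def[abs_def] B_def M_def
      by (intro polyfun.add polyfun_diff polyfun.mult polyfun.const polyfun_g_arg polyfun_H_args \<pi>)
  qed
  moreover have "homog 2 f"
  proof -
    have "B v (c \<cdot> v') = c * B v v'" for c v v' using B_scl B_sym by metis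
    then show ?thesis
      unfolding homog_def f_def M_def B_scl by (simp add: B_scl g_linear power2_eq_square algebra_simps)
  qed
  \<comment> \<open>For \<open>d \<ge> 3\<close> a quadric containing \<open>X\<close> must be zero,
    but on \<open>T p\<close> this one restricts to \<open>H p\<close>.\<close>
  ultimately have f0: "f v = 0" for v using low_degree_eq_0[of f 2 v] d_ge3 by simp
  obtain u where u: "u \<in> T p" "H p u u \<noteq> 0" using p(2) unfolding rank3_def by blast
  then have "f u \<noteq> 0" using Bp[OF u(1)] by (simp add: f_def M_def T_def)
  then show False using f0 by simp
qed

end

context covered_sections
begin

lemma eventually_covered:
  assumes "n \<ge> 5 \<or> d \<ge> 3"
  shows "eventually covered gen"
proof -
  have "eventually (\<lambda>p. \<not> (smooth p \<and> rank3 p)) gen"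
  proof (cases "n \<ge> 5")
    case True
    then have "\<not> (smooth p \<and> rank3 p)" for p using rank3_n_eq_4[of p] by auto
    then show ?thesis by simp
  next
    case False
    then have nd: "n = 4" "d \<ge> 3" using n_ge assms by auto
    interpret covered_threefold n d F by unfold_locales (use nd in auto)
    show ?thesis using rank3_not_frequent by (simp add: frequently_def)
  qed
  then show ?thesis
    using smooth_eventually second_form_nonzero by eventually_elim (use low_rank_covered in blast)
qed

end

section \<open>The hypersurface of a form\<close>

lemma homog_meval:
  assumes "homog_form n d F"
  shows "homog d (meval F)"
  unfolding homog_def
proof (intro allI)
  fix c :: 'a and x
  have "mon_eval m (c \<cdot> x) = c ^ d * mon_eval m x" if "m \<in> Poly_Mapping.keys F" for m
  proof -
    have "mon_deg m = d" using assms that by (simp add: homog_form_def)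
    then show ?thesis
      by (simp add: mon_eval_def mon_deg_def power_mult_distrib prod.distrib flip: power_sum)
  qed
  then show "meval F (c \<cdot> x) = c ^ d * meval F x"
    unfolding meval_superset[OF finite_keys subset_refl] by (simp add: sum_distrib_left mult.left_commute)
qed

lemma hypersurface_meval:
  fixes F :: "'k::field_char_0 mpoly"
  assumes alg: "alg_closed_field TYPE('k)" and F: "homog_form n d F" "irreducible F" "d \<ge> 2"
  shows "hypersurface n d (meval F)"
proof
  have Ffv: "F \<in> first_vars (Suc n)"
    using F(1) by (auto simp: homog_form_def first_vars_def subset_iff less_Suc_eq_le)
  show pF: "polyfun n (meval F)" by (rule polyfun_meval[OF Ffv])
  show "homog d (meval F)" by (rule homog_meval[OF F(1)])
  have "F \<noteq> 0" using F(1) by (simp add: homog_form_def)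
  then show "\<exists>x. meval F x \<noteq> 0" using meval_nonzero_first_vars[OF Ffv] by blast
  \<comment> \<open>The locale tests zeros in \<open>vecs n\<close> only; coordinates beyond
    \<open>n\<close> can be set to zero, as the polynomials do not involve them.\<close>
  have trunc: "meval P x = 0" if "P \<in> first_vars (Suc n)" "meval F x = 0"
    and "\<And>x. x \<in> vecs n \<Longrightarrow> meval F x = 0 \<Longrightarrow> meval P x = 0" for P x
  proof -
    let ?x = "\<lambda>i. if i \<le> n then x i else 0"
    have "meval P ?x = meval P x" "meval F ?x = meval F x"
      using that(1) Ffv by (auto intro!: meval_first_vars_cong)
    moreover have "?x \<in> vecs n" by (simp add: vecs_def vec_in_def)
    ultimately show ?thesis using that by metis
  qed
  show "\<exists>Q. polyfun n Q \<and> (\<forall>x. P x = meval F x * Q x)"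
    if P: "polyfun n P" "\<And>x. x \<in> vecs n \<Longrightarrow> meval F x = 0 \<Longrightarrow> P x = 0" for P
  proof -
    obtain P' where P': "P' \<in> first_vars (Suc n)" "P = meval P'" using polyfun_meval_ex[OF P(1)] by blast
    have "F dvd P'"
      by (rule hypersurface_nullstellensatz[OF alg F(2) Ffv P'(1)]) (use trunc[OF P'(1)] P(2) P'(2) in blast)
    then obtain Q where "P' = F * Q" "Q \<in> first_vars (Suc n)" using first_vars_dvdE P'(1) by metis
    then show ?thesis using P' polyfun_meval[of Q n] by (intro exI[of _ "meval Q"]) simp
  qed
  show "(\<forall>x\<in>vecs n. meval F x = 0 \<longrightarrow> P x = 0) \<or> (\<forall>x\<in>vecs n. meval F x = 0 \<longrightarrow> Q x = 0)"
    if PQ: "polyfun n P" "polyfun n Q" "\<And>x. x \<in> vecs n \<Longrightarrow> meval F x = 0 \<Longrightarrow> P x * Q x = 0" for P Q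
  proof -
    obtain P' Q' where P': "P' \<in> first_vars (Suc n)" "P = meval P'" and Q': "Q' \<in> first_vars (Suc n)" "Q = meval Q'"
      using polyfun_meval_ex PQ(1,2) by metis
    have "F dvd P' * Q'"
    proof (rule hypersurface_nullstellensatz[OF alg F(2) Ffv first_vars_mult[OF P'(1) Q'(1)]])
      fix x assume "meval F x = 0"
      then show "meval (P' * Q') x = 0"
        by (rule trunc[OF first_vars_mult[OF P'(1) Q'(1)]]) (use PQ(3) P' Q' in simp)
    qed
    then have "F dvd P' \<or> F dvd Q'" by (rule irreducible_mpoly_prime[OF F(2)])
    then show ?thesis using P' Q' by auto
  qed
qed (rule alg F(3))+

theorem theorem7p5:
  fixes F :: "'k::field_char_0 mpoly" and n d :: nat
  assumes "alg_closed_field TYPE('k)"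
    and "homog_form n d F"
    and "irreducible F"
    and "d \<ge> 2"
    and "n \<ge> 5 \<or> (n = 4 \<and> d \<ge> 3)"
    and "\<forall>a. hyperplane_coeffs n a \<longrightarrow> section_covered n a F"
  shows "hypersurface_covered n F"
proof -
  interpret hypersurface n d "meval F" by (rule hypersurface_meval[OF assms(1-4)])
  have n: "n \<ge> 4" using assms(5) by auto
  interpret covered_sections n d "meval F"
  proof
    fix a p
    assume a: "hyperplane_coeffs n a" and p: "p \<in> X" "p \<noteq> 0" "lin_form n a p = 0"
    have "proj_point n p" using p by (auto simp: proj_point_def X_def vecs_def zero_fun_def)
    moreover have "meval F p = 0" using p(1) by (simp add: X_def)
    ultimately obtain v where v: "lin_frame n (n - 3) v" "in_span (n - 3) v p"
      "\<forall>q. in_span (n - 3) v q \<longrightarrow> lin_form n a q = 0 \<and> meval F q = 0"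
      using assms(6) a p(3) unfolding section_covered_def by blast
    have "Suc (n - 3) = n - 2" using n by simp
    then show "\<exists>V. fv.subspace V \<and> V \<subseteq> vecs n \<and> fv.dim V = n - 2 \<and> p \<in> V \<and>
        (\<forall>q\<in>V. lin_form n a q = 0 \<and> meval F q = 0)"
      using subspace_of_frame[OF v(1)] v(2,3) by (intro exI[of _ "{q. in_span (n - 3) v q}"]) auto
  qed (rule n)
  have ev: "eventually covered gen" by (rule eventually_covered) (use assms(5) in auto)
  show ?thesis
    unfolding hypersurface_covered_def
  proof (intro allI impI)
    fix p assume "proj_point n p \<and> meval F p = 0"
    then have "p \<in> X" "p \<noteq> 0" by (auto simp: proj_point_def X_def vecs_def zero_fun_def)
    then show "\<exists>v. lin_frame n (n - 2) v \<and> in_span (n - 2) v p \<and> (\<forall>q. in_span (n - 2) v q \<longrightarrow> meval F q = 0)"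
      using covered_closed[OF ev] n by simp
  qed
qed

end
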